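(* Let $f$ be a relation on a Tychonoff space $X$, and let $\mathcal U_M$ be the maximum uniformity compatible with the topology of $X$. (a) If $\mathcal Gf$ is an equivalence relation, then $\mathcal Gf$ is the smallest closed equivalence relation which contains $f$. (b) Assume that $\mathcal A_{\mathcal U_M}f$ is an equivalence relation. The relation $\mathcal A_{\mathcal U_M}f$ is the smallest closed equivalence relation $E$ containing $f$ such that the quotient space $X/E$ is completely Hausdorff. In particular, $\mathcal Gf=\mathcal A_{\mathcal U_M}f$ iff $\mathcal Gf$ is an equivalence relation with the quotient space $X/\mathcal Gf$ completely Hausdorff. For every $d\in\Gamma(\mathcal U_M)$, $\ell_d^f=s\ell_d^f$, and the set $\{\ell_d^f:d\in\Gamma(\mathcal U_M)\}$ projects to the gage of the maximum uniformity with topology $\tau(X/\mathcal A_{\mathcal U_M}f)$. If $X$ is a locally compact, paracompact Hausdorff space and either $X$ is $\sigma$-compact or $f$ is a proper relation, then $1_X\cup\mathcal Gf=\mathcal A_{\mathcal U_M}f$. The space $X/\mathcal A_{\mathcal U_M}f$ is then Hausdorff and normal and so $X/\mathcal A_{\mathcal U_M}f=\tau(X/\mathcal A_{\mathcal U_M}f)$. (c) Assume that $\mathcal C_{\mathcal U_M}f$ is an equivalence relation. The relation $\mathcal C_{\mathcal U_M}f$ is the smallest closed equivalence relation $E$ containing $f$ such that the quotient space $X/E$ is totally disconnected. For every $d\in\Gamma(\mathcal U_M)$, $m_d^f=sm_d^f$, and the set $\{m_d^f:d\in\Gamma(\mathcal U_M)\}$ projects to the gage of the maximum zero-dimensional uniformity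 with topology $\tau_0(X/\mathcal C_{\mathcal U_M}f)$. If $X$ is a locally compact, paracompact Hausdorff space and either $X$ is $\sigma$-compact or $f$ is a proper relation, then $X/\mathcal C_{\mathcal U_M}f$ is a Hausdorff, strongly zero-dimensional space and so $X/\mathcal C_{\mathcal U_M}f=\tau(X/\mathcal C_{\mathcal U_M}f)=\tau_0(X/\mathcal C_{\mathcal U_M}f)$.
   Context: $X$ is nonempty; a Tychonoff space is a completely regular Hausdorff space; a relation on $X$ is a subset of $X\times X$; $1_X$ is the diagonal. All pseudo-metrics are bounded. The gage $\Gamma(\mathcal U)$ is the set of bounded pseudo-metrics $d$ with $\{d<\epsilon\}\in\mathcal U$ for all $\epsilon>0$; $\Gamma(\mathcal U_M)$ is the set of all bounded continuous pseudo-metrics on $X$. $\mathcal Gf$ is the smallest closed transitive relation containing $f$. Barrier functions: $\ell_d^f(x,y)=\inf\{d(x,a_1)+\sum_{i=1}^{n-1}d(b_i,a_{i+1})+d(b_n,y)\}$ and $m_d^f(x,y)=\inf\{\max(d(x,a_1),d(b_1,a_2),\dots,d(b_{n-1},a_n),d(b_n,y))\}$, infima over $n\ge1$ and sequences $(a_1,b_1),\dots,(a_n,b_n)$ in $f$. $s\ell_d^f(x,y)=\max(\ell_d^f(x,y),\ell_d^f(y,x))$ and $sm_d^f(x,y)=\max(m_d^f(x,y),m_d^f(y,x))$. $\mathcal A_{\mathcal U_M}f$ (resp. $\mathcal C_{\mathcal U_M}f$) is the set of $(x,y)$ such that for every $d\in\Gamma(\mathcal U_M)$ and $\epsilon>0$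 there are $n\ge1$ and a sequence $(a_1,b_1),\dots,(a_n,b_n)$ in $f$ for which $d(x,a_1)+\sum_{i=1}^{n-1}d(b_i,a_{i+1})+d(b_n,y)<\epsilon$ (resp. $\max(d(x,a_1),d(b_1,a_2),\dots,d(b_{n-1},a_n),d(b_n,y))<\epsilon$). $f$ is cusc if $f(x)$ is compact for every $x$ and $f^{-1}(B)=\{x:f(x)\cap B\ne\emptyset\}$ is closed for every closed $B$; $f$ is proper if both $f$ and $f^{-1}$ are cusc. A space $Y$ is completely Hausdorff if the bounded continuous real-valued functions distinguish its points; totally disconnected if for each $y\in Y$ the intersection of all clopen sets containing $y$ is $\{y\}$; strongly zero-dimensional if for every closed set $C$, every neighborhood of $C$ contains a clopen set containing $C$. $\tau Y$ is the set $Y$ with the weak (coarsest) topology making all bounded continuous real-valued functions on $Y$ continuous; $\tau_0Y$ is the set $Y$ with the topology having the clopen subsets of $Y$ as a basis. Quotients carry the quotient topology. "The set $S$ of pseudo-metrics on $X$ projects to the gage on the quotient $X/E$" means: with $q:X\to X/E$ the quotient map, $S=\{\bar d\circ(q\times q):\bar d\text{ in that gage}\}$. The gage of the maximum uniformity with topology $\tau Y$ is the set of all bounded continuous pseudo-metrics on $\tau Y$ (equivalently on $Y$). In the zero-dimensional case (uniformities generated by equivalence relations), the gage of the maximum zero-dimensional uniformity with topology $\tau_0Y$ means the set of all bounded continuous pseudo-ultrametrics on $\tau_0Y$ (equivalently on $Y$), a pseudo-ultrametric being a pseudo-metric with $d(x,y)\le\max(d(x,z),d(z,y))$. *)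

theory Defs
  imports "HOL-Analysis.Analysis"
begin

text \<open>
  Spaces are abstract topologies with carrier \<open>topspace X\<close>, since quotient spaces live on sets of
  equivalence classes. Relations are sets of pairs; \<open>f(x)\<close> is \<open>f `` {x}\<close> and
  \<open>f\<^sup>-\<^sup>1(B)\<close> is \<open>converse f `` B\<close>.
\<close>

section \<open>Pseudo-metrics, uniformities and gages\<close>

definition pseudo_metric_on :: "'a set \<Rightarrow> ('a \<Rightarrow> 'a \<Rightarrow> real) \<Rightarrow> bool" where
  "pseudo_metric_on S d \<longleftrightarrow>
     (\<forall>x\<in>S. \<forall>y\<in>S. 0 \<le> d x y) \<and>
     (\<forall>x\<in>S. d x x = 0) \<and>
     (\<forall>x\<in>S. \<forall>y\<in>S. d x y = d y x) \<and>
     (\<forall>x\<in>S. \<forall>y\<in>S. \<forall>z\<in>S. d x z \<le> d x y + d y z)"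

definition pseudo_ultrametric_on :: "'a set \<Rightarrow> ('a \<Rightarrow> 'a \<Rightarrow> real) \<Rightarrow> bool" where
  "pseudo_ultrametric_on S d \<longleftrightarrow>
     pseudo_metric_on S d \<and> (\<forall>x\<in>S. \<forall>y\<in>S. \<forall>z\<in>S. d x y \<le> max (d x z) (d z y))"

definition bounded_dist_on :: "'a set \<Rightarrow> ('a \<Rightarrow> 'a \<Rightarrow> real) \<Rightarrow> bool" where
  "bounded_dist_on S d \<longleftrightarrow> (\<exists>B. \<forall>x\<in>S. \<forall>y\<in>S. d x y \<le> B)"

text \<open>
  A uniformity on \<open>S\<close> is a filter on \<open>S \<times> S\<close>, subject to the axioms of the class
  \<open>uniform_space\<close>; an entourage is a set \<open>V\<close> with \<open>eventually (\<lambda>p. p \<in> V) U\<close>.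
\<close>

definition uniformity_on_set :: "'a set \<Rightarrow> ('a \<times> 'a) filter \<Rightarrow> bool" where
  "uniformity_on_set S U \<longleftrightarrow>
     U \<le> principal (S \<times> S) \<and>
     (\<forall>V. eventually V U \<longrightarrow> (\<forall>x\<in>S. V (x, x))) \<and>
     (\<forall>V. eventually V U \<longrightarrow> eventually (\<lambda>(x, y). V (y, x)) U) \<and>
     (\<forall>V. eventually V U \<longrightarrow>
        (\<exists>D. eventually D U \<and> (\<forall>x y z. D (x, y) \<longrightarrow> D (y, z) \<longrightarrow> V (x, z))))"

definition compatible_uniformity :: "'a topology \<Rightarrow> ('a \<times> 'a) filter \<Rightarrow> bool" where
  "compatible_uniformity X U \<longleftrightarrow>
     uniformity_on_set (topspace X) U \<and>
     (\<forall>W. openin X W \<longleftrightarrow>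
        W \<subseteq> topspace X \<and> (\<forall>x\<in>W. eventually (\<lambda>(x', y). x' = x \<longrightarrow> y \<in> W) U))"

text \<open>
  The order on filters is the reverse of inclusion of the families of entourages, so the maximum
  uniformity is the least filter. It exists whenever \<open>X\<close> is completely regular.
\<close>

definition max_uniformity :: "'a topology \<Rightarrow> ('a \<times> 'a) filter" where
  "max_uniformity X = (LEAST U. compatible_uniformity X U)"

definition gage :: "'a set \<Rightarrow> ('a \<times> 'a) filter \<Rightarrow> ('a \<Rightarrow> 'a \<Rightarrow> real) set" where
  "gage S U =
     {d. pseudo_metric_on S d \<and> bounded_dist_on S d \<and>
         (\<forall>\<epsilon>>0. eventually (\<lambda>(x, y). d x y < \<epsilon>) U)}"

text \<open>The gage of the maximum zero-dimensional uniformity of a zero-dimensional space \<open>Z\<close>.\<close>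

definition zero_dim_gage :: "'a topology \<Rightarrow> ('a \<Rightarrow> 'a \<Rightarrow> real) set" where
  "zero_dim_gage Z =
     {d. pseudo_ultrametric_on (topspace Z) d \<and> bounded_dist_on (topspace Z) d \<and>
         continuous_map (prod_topology Z Z) euclideanreal (\<lambda>(x, y). d x y)}"

section \<open>Relations and barrier functions\<close>

definition smallest_rel :: "(('a \<times> 'a) set \<Rightarrow> bool) \<Rightarrow> ('a \<times> 'a) set \<Rightarrow> bool" where
  "smallest_rel P R \<longleftrightarrow> P R \<and> (\<forall>E. P E \<longrightarrow> R \<subseteq> E)"

definition closed_rel :: "'a topology \<Rightarrow> ('a \<times> 'a) set \<Rightarrow> bool" where
  "closed_rel X R \<longleftrightarrow> closedin (prod_topology X X) R"

definition G_rel :: "'a topology \<Rightarrow> ('a \<times> 'a) set \<Rightarrow> ('a \<times> 'a) set" where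
  "G_rel X f = \<Inter>{R. closed_rel X R \<and> trans R \<and> f \<subseteq> R}"

text \<open>
  For \<open>ps = [(a\<^sub>1, b\<^sub>1), \<dots>, (a\<^sub>n, b\<^sub>n)]\<close> these are the sum and the maximum of
  \<open>d x a\<^sub>1\<close>, \<open>d b\<^sub>1 a\<^sub>2\<close>, \<dots>, \<open>d b\<^sub>n\<^sub>-\<^sub>1 a\<^sub>n\<close>, \<open>d b\<^sub>n y\<close>. The empty list, giving \<open>d x y\<close>, only serves
  the recursion: everywhere below \<open>ps \<in> chains f\<close> is nonempty.
\<close>

fun chain_sum :: "('a \<Rightarrow> 'a \<Rightarrow> real) \<Rightarrow> 'a \<Rightarrow> ('a \<times> 'a) list \<Rightarrow> 'a \<Rightarrow> real" where
  "chain_sum d x [] y = d x y"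
| "chain_sum d x ((a, b) # ps) y = d x a + chain_sum d b ps y"

fun chain_max :: "('a \<Rightarrow> 'a \<Rightarrow> real) \<Rightarrow> 'a \<Rightarrow> ('a \<times> 'a) list \<Rightarrow> 'a \<Rightarrow> real" where
  "chain_max d x [] y = d x y"
| "chain_max d x ((a, b) # ps) y = max (d x a) (chain_max d b ps y)"

definition chains :: "('a \<times> 'a) set \<Rightarrow> ('a \<times> 'a) list set" where
  "chains f = {ps. ps \<noteq> [] \<and> set ps \<subseteq> f}"

text \<open>
  Real infima. They are only used for nonempty \<open>f\<close>, where the sets of chain values are nonempty
  and bounded below by \<open>0\<close>: if \<open>f\<close> is empty, so are the relations \<open>A_rel\<close> and \<open>C_rel\<close> below,
  and these are not equivalence relations on a nonempty carrier.
\<close>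

definition ell :: "('a \<times> 'a) set \<Rightarrow> ('a \<Rightarrow> 'a \<Rightarrow> real) \<Rightarrow> 'a \<Rightarrow> 'a \<Rightarrow> real" where
  "ell f d x y = (INF ps\<in>chains f. chain_sum d x ps y)"

definition m_bar :: "('a \<times> 'a) set \<Rightarrow> ('a \<Rightarrow> 'a \<Rightarrow> real) \<Rightarrow> 'a \<Rightarrow> 'a \<Rightarrow> real" where
  "m_bar f d x y = (INF ps\<in>chains f. chain_max d x ps y)"

definition s_ell :: "('a \<times> 'a) set \<Rightarrow> ('a \<Rightarrow> 'a \<Rightarrow> real) \<Rightarrow> 'a \<Rightarrow> 'a \<Rightarrow> real" where
  "s_ell f d x y = max (ell f d x y) (ell f d y x)"

definition s_m_bar :: "('a \<times> 'a) set \<Rightarrow> ('a \<Rightarrow> 'a \<Rightarrow> real) \<Rightarrow> 'a \<Rightarrow> 'a \<Rightarrow> real" where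
  "s_m_bar f d x y = max (m_bar f d x y) (m_bar f d y x)"

definition A_rel :: "'a set \<Rightarrow> ('a \<times> 'a) filter \<Rightarrow> ('a \<times> 'a) set \<Rightarrow> ('a \<times> 'a) set" where
  "A_rel S U f = {(x, y) \<in> S \<times> S.
     \<forall>d\<in>gage S U. \<forall>\<epsilon>>0. \<exists>ps\<in>chains f. chain_sum d x ps y < \<epsilon>}"

definition C_rel :: "'a set \<Rightarrow> ('a \<times> 'a) filter \<Rightarrow> ('a \<times> 'a) set \<Rightarrow> ('a \<times> 'a) set" where
  "C_rel S U f = {(x, y) \<in> S \<times> S.
     \<forall>d\<in>gage S U. \<forall>\<epsilon>>0. \<exists>ps\<in>chains f. chain_max d x ps y < \<epsilon>}"

definition cusc :: "'a topology \<Rightarrow> ('a \<times> 'a) set \<Rightarrow> bool" where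
  "cusc X f \<longleftrightarrow>
     (\<forall>x\<in>topspace X. compactin X (f `` {x})) \<and>
     (\<forall>B. closedin X B \<longrightarrow> closedin X (converse f `` B))"

definition proper_rel :: "'a topology \<Rightarrow> ('a \<times> 'a) set \<Rightarrow> bool" where
  "proper_rel X f \<longleftrightarrow> cusc X f \<and> cusc X (converse f)"

section \<open>Topological notions\<close>

definition sigma_compact_space :: "'a topology \<Rightarrow> bool" where
  "sigma_compact_space X \<longleftrightarrow>
     (\<exists>\<K>. countable \<K> \<and> (\<forall>K\<in>\<K>. compactin X K) \<and> \<Union>\<K> = topspace X)"

definition paracompact_space :: "'a topology \<Rightarrow> bool" where
  "paracompact_space X \<longleftrightarrow>
     (\<forall>\<U>. (\<forall>U\<in>\<U>. openin X U) \<and> \<Union>\<U> = topspace X \<longrightarrow>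
        (\<exists>\<V>. (\<forall>V\<in>\<V>. openin X V) \<and> \<Union>\<V> = topspace X \<and>
             (\<forall>V\<in>\<V>. \<exists>U\<in>\<U>. V \<subseteq> U) \<and> locally_finite_in X \<V>))"

definition clopenin :: "'a topology \<Rightarrow> 'a set \<Rightarrow> bool" where
  "clopenin Y C \<longleftrightarrow> openin Y C \<and> closedin Y C"

definition bounded_cont_fun :: "'a topology \<Rightarrow> ('a \<Rightarrow> real) \<Rightarrow> bool" where
  "bounded_cont_fun Y g \<longleftrightarrow> continuous_map Y euclideanreal g \<and> bounded (g ` topspace Y)"

definition completely_Hausdorff_space :: "'a topology \<Rightarrow> bool" where
  "completely_Hausdorff_space Y \<longleftrightarrow>
     (\<forall>x\<in>topspace Y. \<forall>y\<in>topspace Y. x \<noteq> y \<longrightarrow> (\<exists>g. bounded_cont_fun Y g \<and> g x \<noteq> g y))"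

definition totally_disconnected_space :: "'a topology \<Rightarrow> bool" where
  "totally_disconnected_space Y \<longleftrightarrow> (\<forall>y\<in>topspace Y. \<Inter>{C. clopenin Y C \<and> y \<in> C} = {y})"

definition strongly_zero_dim_space :: "'a topology \<Rightarrow> bool" where
  "strongly_zero_dim_space Y \<longleftrightarrow>
     (\<forall>C N. closedin Y C \<and> N \<subseteq> topspace Y \<and> C \<subseteq> Y interior_of N \<longrightarrow>
        (\<exists>K. clopenin Y K \<and> C \<subseteq> K \<and> K \<subseteq> N))"

definition tau :: "'a topology \<Rightarrow> 'a topology" where
  "tau Y = topology_generated_by
     {{y \<in> topspace Y. g y \<in> W} | g W. bounded_cont_fun Y g \<and> open W}"

definition tau0 :: "'a topology \<Rightarrow> 'a topology" where
  "tau0 Y = topology (arbitrary union_of clopenin Y)"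

definition quotient_space :: "'a topology \<Rightarrow> ('a \<times> 'a) set \<Rightarrow> 'a set topology" where
  "quotient_space X E = topology (\<lambda>W. W \<subseteq> topspace X // E \<and>
     openin X {x \<in> topspace X. E `` {x} \<in> W})"

text \<open>
  The functions in \<open>D\<close> and in \<open>\<Gamma>\<close> matter only on the carriers \<open>topspace X\<close> and
  \<open>topspace X // E\<close>, so both sides are restricted to \<open>topspace X \<times> topspace X\<close>.
\<close>

definition projects_to_gage ::
  "'a topology \<Rightarrow> ('a \<times> 'a) set \<Rightarrow> ('a \<Rightarrow> 'a \<Rightarrow> real) set \<Rightarrow>
   ('a set \<Rightarrow> 'a set \<Rightarrow> real) set \<Rightarrow> bool" where
  "projects_to_gage X E D \<Gamma> \<longleftrightarrow>
     (\<lambda>d. restrict (\<lambda>(x, y). d x y) (topspace X \<times> topspace X)) ` D =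
     (\<lambda>e. restrict (\<lambda>(x, y). e (E `` {x}) (E `` {y})) (topspace X \<times> topspace X)) ` \<Gamma>"

lemma openin_quotient_space:
  "openin (quotient_space X E) W \<longleftrightarrow>
     W \<subseteq> topspace X // E \<and> openin X {x \<in> topspace X. E `` {x} \<in> W}"
proof -
  have "istopology (\<lambda>W. W \<subseteq> topspace X // E \<and> openin X {x \<in> topspace X. E `` {x} \<in> W})"
    unfolding istopology_def
  proof (intro conjI allI impI)
    fix S T
    assume S: "S \<subseteq> topspace X // E \<and> openin X {x \<in> topspace X. E `` {x} \<in> S}"
      and T: "T \<subseteq> topspace X // E \<and> openin X {x \<in> topspace X. E `` {x} \<in> T}"
    then show "S \<inter> T \<subseteq> topspace X // E" by blast
    have "{x \<in> topspace X. E `` {x} \<in> S \<inter> T} =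
        {x \<in> topspace X. E `` {x} \<in> S} \<inter> {x \<in> topspace X. E `` {x} \<in> T}" by blast
    then show "openin X {x \<in> topspace X. E `` {x} \<in> S \<inter> T}"
      using S T by (simp only: openin_Int)
  next
    fix \<K>
    assume K: "\<forall>K\<in>\<K>. K \<subseteq> topspace X // E \<and> openin X {x \<in> topspace X. E `` {x} \<in> K}"
    then show "\<Union>\<K> \<subseteq> topspace X // E" by blast
    have "{x \<in> topspace X. E `` {x} \<in> \<Union>\<K>} = (\<Union>K\<in>\<K>. {x \<in> topspace X. E `` {x} \<in> K})"
      by blast
    then show "openin X {x \<in> topspace X. E `` {x} \<in> \<Union>\<K>}" using K by auto
  qed
  then show ?thesis unfolding quotient_space_def by (simp add: topology_inverse')
qed

lemma topspace_quotient_space: "topspace (quotient_space X E) = topspace X // E"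
proof -
  have "{x \<in> topspace X. E `` {x} \<in> topspace X // E} = topspace X"
    by (auto intro: quotientI)
  then have "openin (quotient_space X E) (topspace X // E)"
    by (simp add: openin_quotient_space)
  then show ?thesis
    by (meson openin_quotient_space openin_subset openin_topspace subset_antisym)
qed

lemma quotient_map_quotient_space:
  "quotient_map X (quotient_space X E) (\<lambda>x. E `` {x})"
  unfolding quotient_map_def topspace_quotient_space openin_quotient_space
  by (auto simp: quotient_def)

lemma openin_tau0: "openin (tau0 Y) = arbitrary union_of clopenin Y"
proof -
  have "istopology (arbitrary union_of clopenin Y)"
    by (rule istopology_base) (auto simp: clopenin_def)
  then show ?thesis unfolding tau0_def by (simp add: topology_inverse')
qed

lemma topspace_tau: "topspace (tau Y) = topspace Y"
proof -
  have "bounded_cont_fun Y (\<lambda>_. 0)"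
    by (auto simp: bounded_cont_fun_def image_constant_conv)
  then have "topspace Y \<in> {{y \<in> topspace Y. g y \<in> W} | g W. bounded_cont_fun Y g \<and> open W}"
    by (force intro!: exI[where x = "\<lambda>_. 0"] exI[where x = UNIV])
  then show ?thesis unfolding tau_def topology_generated_by_topspace by blast
qed

end

(* For an equivalence relation A (resp. C) the barrier functions ell d (resp. m_bar d) are continuous
   pseudo-metrics (resp. pseudo-ultrametrics) below d that vanish exactly on A (resp. C), so they
   descend to the quotient and separate its points; conversely a bounded continuous pseudo-metric on
   the quotient pulls back to one that is its own barrier function. A sigma-compact locally compact
   space, and any locally compact paracompact one with f proper, is a disjoint union of open
   invariant pieces, each exhausted by compact sets K n with K n inside the interior of K (n+1). On
   such a space a closed preorder admits a monotone Urysohn lemma (separate inductively in K n),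
   which turns a pair outside the reflexive closure of G_rel into a function excluding it from
   A_rel, and the same induction with clopen saturated sets gives strong zero-dimensionality. *)

theory Submission
  imports Defs
begin

section \<open>The gage of the maximum uniformity\<close>

text \<open>A chain must use at least one pair of \<open>f\<close>, so the barrier functions are not
  automatically below \<open>d\<close> or zero on the diagonal. Reflexivity of \<open>A\<close> or
  \<open>C\<close> supplies cheap loops at every point: they give \<open>ell f d \<le> d\<close> and
  \<open>m_bar f d \<le> d\<close>, hence continuity, and for \<open>m_bar\<close> they also repair
  concatenation, where the gap between two chains would otherwise be bounded by a sum instead of a
  maximum. The gage of the maximum uniformity turns out to be the set of all bounded continuous
  pseudo-metrics, so a bounded continuous function or a clopen set can be used directly as a test
  against \<open>A_rel\<close> or \<open>C_rel\<close>. A product of quotient maps need not be a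
  quotient map, so continuity of pseudo-metrics on a quotient is tested on balls. Compactness
  separates compact sets only, while the closed sets at hand are rarely compact; this forces the
  induction along an exhaustion, and the interior condition makes the limit sets open. The pieces
  have to be respected not only by \<open>f\<close> but by \<open>A\<close> and \<open>C\<close> as
  well: being clopen and \<open>f\<close>-invariant, they are left by no pair of \<open>C\<close>,
  hence by none of \<open>A\<close>.\<close>

definition cont_pmetrics :: "'a topology \<Rightarrow> ('a \<Rightarrow> 'a \<Rightarrow> real) set" where
  "cont_pmetrics X = {d. pseudo_metric_on (topspace X) d \<and> bounded_dist_on (topspace X) d \<and>
     continuous_map (prod_topology X X) euclideanreal (\<lambda>(x, y). d x y)}"

lemma pseudo_metric_onD:
  assumes "pseudo_metric_on S d" "x \<in> S" "y \<in> S"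
  shows "0 \<le> d x y" "d x x = 0" "d x y = d y x" "z \<in> S \<Longrightarrow> d x z \<le> d x y + d y z"
  using assms unfolding pseudo_metric_on_def by blast+

text \<open>The difference of \<open>d x y\<close> and \<open>d u v\<close> is at most
  \<open>d x u + d y v\<close>, so joint continuity follows from neighbourhoods inside balls. All
  later continuity proofs for pseudo-metrics go through this criterion.\<close>

lemma pseudo_metric_open_balls_imp_continuous:
  assumes pm: "pseudo_metric_on (topspace X) d"
    and nb: "\<And>x \<epsilon>. x \<in> topspace X \<Longrightarrow> 0 < \<epsilon> \<Longrightarrow> \<exists>W. openin X W \<and> x \<in> W \<and> (\<forall>y\<in>W. d x y < \<epsilon>)"
  shows "continuous_map (prod_topology X X) euclideanreal (\<lambda>(x, y). d x y)"
proof -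
  have "\<exists>U. openin (prod_topology X X) U \<and> p \<in> U \<and> (\<forall>q\<in>U. (\<lambda>(x, y). d x y) q \<in> ball ((\<lambda>(x, y). d x y) p) \<epsilon>)"
    if p: "p \<in> topspace (prod_topology X X)" and e: "\<epsilon> > 0" for p \<epsilon>
  proof -
    obtain x y where xy: "p = (x, y)" "x \<in> topspace X" "y \<in> topspace X" using p by auto
    obtain V where V: "openin X V" "x \<in> V" "\<forall>z\<in>V. d x z < \<epsilon>/2"
      using nb[OF xy(2), of "\<epsilon>/2"] e by auto
    obtain W where W: "openin X W" "y \<in> W" "\<forall>z\<in>W. d y z < \<epsilon>/2"
      using nb[OF xy(3), of "\<epsilon>/2"] e by auto
    have "\<bar>d x y - d u v\<bar> < \<epsilon>" if uv: "u \<in> V" "v \<in> W" for u v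
    proof -
      have in_S: "u \<in> topspace X" "v \<in> topspace X" using uv V(1) W(1) openin_subset by blast+
      have "d x u < \<epsilon>/2" "d y v < \<epsilon>/2" using uv V W by auto
      moreover have "d x y \<le> d x u + d u y" "d u y \<le> d u v + d v y"
        "d u v \<le> d u x + d x v" "d x v \<le> d x y + d y v" "d u x = d x u" "d v y = d y v"
        by (rule pseudo_metric_onD[OF pm]; use in_S xy in blast)+
      ultimately show ?thesis by linarith
    qed
    then show ?thesis
      using V W xy by (intro exI[of _ "V \<times> W"]) (auto simp: openin_prod_Times_iff dist_real_def)
  qed
  then show ?thesis
    by (subst mtopology_is_euclidean[symmetric], subst Met_TC.continuous_map_to_metric)
      (auto simp: dist_commute)
qed

lemma continuous_map_pmetric:
  assumes "d \<in> cont_pmetrics X" "x \<in> topspace X"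
  shows "continuous_map X euclideanreal (d x)"
proof -
  have "continuous_map X euclideanreal ((\<lambda>(x, y). d x y) \<circ> (\<lambda>y. (x, y)))"
    using assms unfolding cont_pmetrics_def
    by (intro continuous_map_compose[of _ "prod_topology X X"]) (auto simp: continuous_map_pairwise o_def)
  then show ?thesis by (simp add: o_def)
qed

lemma openin_pmetric_ball:
  assumes "d \<in> cont_pmetrics X" "x \<in> topspace X"
  shows "openin X {y \<in> topspace X. d x y < \<epsilon>}"
  using openin_continuous_map_preimage[OF continuous_map_pmetric[OF assms], of "{..<\<epsilon>}"] by simp

lemma cont_pmetricsI:
  assumes "pseudo_metric_on (topspace X) d" "bounded_dist_on (topspace X) d"
    and "\<And>x \<epsilon>. x \<in> topspace X \<Longrightarrow> 0 < \<epsilon> \<Longrightarrow> \<exists>W. openin X W \<and> x \<in> W \<and> (\<forall>y\<in>W. d x y < \<epsilon>)"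
  shows "d \<in> cont_pmetrics X"
  using assms pseudo_metric_open_balls_imp_continuous[of X d] by (auto simp: cont_pmetrics_def)

lemma cont_pmetricsD:
  assumes "d \<in> cont_pmetrics X"
  shows "pseudo_metric_on (topspace X) d" "bounded_dist_on (topspace X) d"
  using assms by (auto simp: cont_pmetrics_def)

text \<open>Balls of \<open>e\<close> contain balls of \<open>d\<close>. This is how barrier
  functions inherit boundedness and continuity from \<open>d\<close>.\<close>

lemma cont_pmetrics_dominated:
  assumes d: "d \<in> cont_pmetrics X" and e: "pseudo_metric_on (topspace X) e"
    and le: "\<And>x y. x \<in> topspace X \<Longrightarrow> y \<in> topspace X \<Longrightarrow> e x y \<le> d x y"
  shows "e \<in> cont_pmetrics X"
proof (rule cont_pmetricsI[OF e])
  obtain B where "\<forall>x\<in>topspace X. \<forall>y\<in>topspace X. d x y \<le> B"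
    using cont_pmetricsD(2)[OF d] by (auto simp: bounded_dist_on_def)
  then show "bounded_dist_on (topspace X) e"
    unfolding bounded_dist_on_def using le by (meson order_trans)
next
  fix x and \<epsilon> :: real assume "x \<in> topspace X" "0 < \<epsilon>"
  then show "\<exists>W. openin X W \<and> x \<in> W \<and> (\<forall>y\<in>W. e x y < \<epsilon>)"
    using openin_pmetric_ball[OF d, of x \<epsilon>] le[of x] pseudo_metric_onD(2)[OF cont_pmetricsD(1)[OF d]]
    by (intro exI[of _ "{y \<in> topspace X. d x y < \<epsilon>}"]) (auto intro: le_less_trans)
qed

text \<open>Lets real-valued functions act as members of the gage; every exclusion of a pair from
  \<open>A_rel\<close> or \<open>C_rel\<close> by a test function starts here.\<close>

lemma fun_dist_cont_pmetrics:
  assumes "bounded_cont_fun X h"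
  shows "(\<lambda>x y. \<bar>h x - h y\<bar>) \<in> cont_pmetrics X"
proof (rule cont_pmetricsI)
  have h: "continuous_map X euclideanreal h" and "bounded (h ` topspace X)"
    using assms by (auto simp: bounded_cont_fun_def)
  then obtain B where B: "\<And>x. x \<in> topspace X \<Longrightarrow> \<bar>h x\<bar> \<le> B" by (auto simp: bounded_iff)
  show "pseudo_metric_on (topspace X) (\<lambda>x y. \<bar>h x - h y\<bar>)" by (auto simp: pseudo_metric_on_def)
  have "\<bar>h x - h y\<bar> \<le> 2 * B" if "x \<in> topspace X" "y \<in> topspace X" for x y
    using B[OF that(1)] B[OF that(2)] by linarith
  then show "bounded_dist_on (topspace X) (\<lambda>x y. \<bar>h x - h y\<bar>)"
    unfolding bounded_dist_on_def by blast
  fix x and \<epsilon> :: real assume x: "x \<in> topspace X" "0 < \<epsilon>"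
  have "openin X {y \<in> topspace X. h y \<in> ball (h x) \<epsilon>}"
    by (rule openin_continuous_map_preimage[OF h]) simp
  then show "\<exists>W. openin X W \<and> x \<in> W \<and> (\<forall>y\<in>W. \<bar>h x - h y\<bar> < \<epsilon>)"
    using x by (intro exI[of _ "{y \<in> topspace X. h y \<in> ball (h x) \<epsilon>}"]) (auto simp: dist_real_def)
qed

section \<open>Normal sequences and the maximum uniformity\<close>

definition normal_seq :: "'a topology \<Rightarrow> (nat \<Rightarrow> ('a \<times> 'a) set) \<Rightarrow> bool" where
  "normal_seq X W \<longleftrightarrow> (\<forall>n. W n \<subseteq> topspace X \<times> topspace X \<and>
     (\<forall>x\<in>topspace X. \<exists>G. openin X G \<and> x \<in> G \<and> G \<times> G \<subseteq> W n) \<and>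
     W (Suc n) O W (Suc n) \<subseteq> W n)"

text \<open>Every entourage of a uniformity compatible with \<open>X\<close> is the start of such a sequence, so the
  filter below is the maximum uniformity as soon as it is compatible; no pseudo-metrization of
  uniformities is needed.\<close>

definition normal_filter :: "'a topology \<Rightarrow> ('a \<times> 'a) filter" where
  "normal_filter X = Abs_filter (\<lambda>P. \<exists>W. normal_seq X W \<and> (\<forall>p\<in>W 0. P p))"

lemma normal_seq_Int:
  assumes "normal_seq X V" "normal_seq X W"
  shows "normal_seq X (\<lambda>n. V n \<inter> W n)"
proof -
  have "\<exists>G. openin X G \<and> x \<in> G \<and> G \<times> G \<subseteq> V n \<inter> W n" if "x \<in> topspace X" for x n
  proof -
    obtain G H where "openin X G" "x \<in> G" "G \<times> G \<subseteq> V n" "openin X H" "x \<in> H" "H \<times> H \<subseteq> W n"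
      using assms \<open>x \<in> topspace X\<close> unfolding normal_seq_def by meson
    then show ?thesis by (intro exI[of _ "G \<inter> H"]) auto
  qed
  moreover have "(V (Suc n) \<inter> W (Suc n)) O (V (Suc n) \<inter> W (Suc n)) \<subseteq> V n \<inter> W n" for n
    using assms unfolding normal_seq_def by blast
  ultimately show ?thesis using assms by (auto simp: normal_seq_def)
qed

lemma eventually_normal_filter:
  "eventually P (normal_filter X) \<longleftrightarrow> (\<exists>W. normal_seq X W \<and> (\<forall>p\<in>W 0. P p))"
  unfolding normal_filter_def
proof (rule eventually_Abs_filter, rule is_filter.intro)
  have "normal_seq X (\<lambda>_. topspace X \<times> topspace X)"
    unfolding normal_seq_def by blast
  then show "\<exists>W. normal_seq X W \<and> (\<forall>p\<in>W 0. True)" by blast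
next
  fix P Q :: "'a \<times> 'a \<Rightarrow> bool"
  assume "\<exists>W. normal_seq X W \<and> (\<forall>p\<in>W 0. P p)" "\<exists>W. normal_seq X W \<and> (\<forall>p\<in>W 0. Q p)"
  then obtain V W where "normal_seq X V" "\<forall>p\<in>V 0. P p" "normal_seq X W" "\<forall>p\<in>W 0. Q p"
    by blast
  then show "\<exists>W. normal_seq X W \<and> (\<forall>p\<in>W 0. P p \<and> Q p)"
    by (intro exI[of _ "\<lambda>n. V n \<inter> W n"]) (auto intro: normal_seq_Int)
qed blast

lemma eventually_normal_filterI:
  "normal_seq X W \<Longrightarrow> (\<And>x y. (x, y) \<in> W 0 \<Longrightarrow> P (x, y)) \<Longrightarrow> eventually P (normal_filter X)"
  unfolding eventually_normal_filter by fast

text \<open>Halving the radius at each index is exactly what the triangle inequality charges for one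
  composition.\<close>

lemma normal_seq_pmetric:
  assumes d: "d \<in> cont_pmetrics X" and e: "0 < \<epsilon>"
  shows "normal_seq X (\<lambda>n. {(x, y) \<in> topspace X \<times> topspace X. d x y < \<epsilon> / 2 ^ n})"
proof -
  note pm = pseudo_metric_onD[OF cont_pmetricsD(1)[OF d]]
  define W where "W n = {(x, y) \<in> topspace X \<times> topspace X. d x y < \<epsilon> / 2 ^ n}" for n
  have half: "\<epsilon> / 2 ^ Suc n + \<epsilon> / 2 ^ Suc n = \<epsilon> / 2 ^ n" for n by simp
  have comp: "W (Suc n) O W (Suc n) \<subseteq> W n" for n
  proof clarify
    fix x y z assume "(x, y) \<in> W (Suc n)" "(y, z) \<in> W (Suc n)"
    then have S: "x \<in> topspace X" "y \<in> topspace X" "z \<in> topspace X"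
      and *: "d x y < \<epsilon> / 2 ^ Suc n" "d y z < \<epsilon> / 2 ^ Suc n"
      unfolding W_def by blast+
    then show "(x, z) \<in> W n"
      using pm(4)[OF S(1,2,3)] half[of n] unfolding W_def by force
  qed
  have nhd: "\<exists>G. openin X G \<and> x \<in> G \<and> G \<times> G \<subseteq> W n" if x: "x \<in> topspace X" for x n
  proof -
    define G where "G = {y \<in> topspace X. d x y < \<epsilon> / 2 ^ Suc n}"
    have "G \<times> G \<subseteq> W n"
    proof clarify
      fix y z assume "y \<in> G" "z \<in> G"
      then have S: "y \<in> topspace X" "z \<in> topspace X"
        and *: "d x y < \<epsilon> / 2 ^ Suc n" "d x z < \<epsilon> / 2 ^ Suc n"
        unfolding G_def by blast+
      then show "(y, z) \<in> W n"
        using pm(4)[OF S(1) x S(2)] pm(3)[OF S(1) x] half[of n] unfolding W_def by force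
    qed
    moreover have "openin X G" unfolding G_def by (rule openin_pmetric_ball[OF d x])
    moreover have "x \<in> G" using x e pm(2)[OF x x] by (auto simp: G_def)
    ultimately show ?thesis by blast
  qed
  have "W n \<subseteq> topspace X \<times> topspace X" for n by (auto simp: W_def)
  with comp nhd have "normal_seq X W" unfolding normal_seq_def by blast
  then show ?thesis unfolding W_def .
qed

lemma uniformity_normal_filter: "uniformity_on_set (topspace X) (normal_filter X)"
  unfolding uniformity_on_set_def
proof (intro conjI allI impI)
  have "normal_seq X (\<lambda>_. topspace X \<times> topspace X)"
    unfolding normal_seq_def by blast
  then show "normal_filter X \<le> principal (topspace X \<times> topspace X)"
    by (auto simp: le_principal eventually_normal_filter)
next
  fix V :: "'a \<times> 'a \<Rightarrow> bool" assume "eventually V (normal_filter X)"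
  then obtain W where W: "normal_seq X W" "\<forall>p\<in>W 0. V p" by (auto simp: eventually_normal_filter)
  show "\<forall>x\<in>topspace X. V (x, x)" using W unfolding normal_seq_def by (meson SigmaI subsetD)
  have "normal_seq X (\<lambda>n. (W n)\<inverse>)"
    unfolding normal_seq_def
  proof (intro allI conjI ballI)
    fix n
    show "(W n)\<inverse> \<subseteq> topspace X \<times> topspace X" "(W (Suc n))\<inverse> O (W (Suc n))\<inverse> \<subseteq> (W n)\<inverse>"
      using W(1) unfolding normal_seq_def by blast+
    fix x assume "x \<in> topspace X"
    then obtain G where "openin X G" "x \<in> G" "G \<times> G \<subseteq> W n"
      using W(1) unfolding normal_seq_def by meson
    then show "\<exists>G. openin X G \<and> x \<in> G \<and> G \<times> G \<subseteq> (W n)\<inverse>"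
      by (intro exI[of _ G]) auto
  qed
  then show "eventually (\<lambda>(x, y). V (y, x)) (normal_filter X)"
    using W(2) unfolding eventually_normal_filter by fastforce
  \<comment> \<open>Without its first term a normal sequence stays normal, and its new start
    composes into \<open>W 0\<close>: this is the uniform halving axiom.\<close>
  have "normal_seq X (\<lambda>n. W (Suc n))" using W(1) by (auto simp: normal_seq_def)
  moreover have "W (Suc 0) O W (Suc 0) \<subseteq> W 0" using W(1) by (auto simp: normal_seq_def)
  ultimately show "\<exists>D. eventually D (normal_filter X) \<and> (\<forall>x y z. D (x, y) \<longrightarrow> D (y, z) \<longrightarrow> V (x, z))"
    using W(2) unfolding eventually_normal_filter
    by (intro exI[of _ "\<lambda>p. p \<in> W (Suc 0)"]) (auto intro!: exI[of _ "\<lambda>n. W (Suc n)"])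
qed

text \<open>Complete regularity turns an open set into an entourage by way of a Urysohn function;
  conversely, the squares \<open>G \<times> G\<close> inside an entourage make uniformly open sets
  open.\<close>

lemma compatible_normal_filter:
  assumes "completely_regular_space X"
  shows "compatible_uniformity X (normal_filter X)"
  unfolding compatible_uniformity_def
proof (intro conjI uniformity_normal_filter allI iffI ballI)
  fix Q assume Q: "openin X Q"
  show "Q \<subseteq> topspace X" using Q by (rule openin_subset)
  fix x assume x: "x \<in> Q"
  have "closedin X (topspace X - Q)" "x \<in> topspace X - (topspace X - Q)"
    using Q x openin_subset by blast+
  then obtain g where g: "continuous_map X (top_of_set {0..1::real}) g" "g x = 0" "g ` (topspace X - Q) \<subseteq> {1}"
    using assms unfolding completely_regular_space_def by meson
  then have "bounded_cont_fun X g"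
    using bounded_subset[of "{0..1::real}" "g ` topspace X"]
    by (auto simp: bounded_cont_fun_def continuous_map_in_subtopology image_subset_iff Pi_iff)
  \<comment> \<open>At index 0 the bound is 1, the value of \<open>g\<close> off \<open>Q\<close>,
    while \<open>g\<close> is 0 at the chosen point; so its partners stay in
    \<open>Q\<close>.\<close>
  then have "normal_seq X (\<lambda>n. {(x, y) \<in> topspace X \<times> topspace X. \<bar>g x - g y\<bar> < 1 / 2 ^ n})"
    by (intro normal_seq_pmetric fun_dist_cont_pmetrics) simp_all
  then show "eventually (\<lambda>(x', y). x' = x \<longrightarrow> y \<in> Q) (normal_filter X)"
    by (rule eventually_normal_filterI) (use g in \<open>force simp: image_subset_iff\<close>)
next
  fix Q assume Q: "Q \<subseteq> topspace X \<and> (\<forall>x\<in>Q. eventually (\<lambda>(x', y). x' = x \<longrightarrow> y \<in> Q) (normal_filter X))"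
  have "\<exists>G. openin X G \<and> x \<in> G \<and> G \<subseteq> Q" if x: "x \<in> Q" for x
  proof -
    obtain W where W: "normal_seq X W" "\<forall>p\<in>W 0. (\<lambda>(x', y). x' = x \<longrightarrow> y \<in> Q) p"
      using Q x unfolding eventually_normal_filter by meson
    then obtain G where "openin X G" "x \<in> G" "G \<times> G \<subseteq> W 0"
      using Q x unfolding normal_seq_def by (meson subsetD)
    then show ?thesis using W(2) by fast
  qed
  then show "openin X Q" by (subst openin_subopen) blast
qed

text \<open>Two points that are \<open>D\<close>-close to \<open>x\<close> in both orders are joined
  through \<open>x\<close>, so they are \<open>V\<close>-close. An entourage section need not be
  open, hence the passage to its uniform interior.\<close>

lemma compatible_uniformity_nhds_diag:
  assumes U: "compatible_uniformity X U" and V: "eventually V U" and x: "x \<in> topspace X"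
  shows "\<exists>G. openin X G \<and> x \<in> G \<and> (\<forall>p\<in>G \<times> G. V p)"
proof -
  note * = U[unfolded compatible_uniformity_def uniformity_on_set_def]
  have refl: "V (y, y)" if "eventually V U" "y \<in> topspace X" for V y using * that by blast
  have half: "\<exists>D. eventually D U \<and> (\<forall>x y z. D (x, y) \<longrightarrow> D (y, z) \<longrightarrow> V (x, z))" if "eventually V U" for V
    using * that by blast
  obtain D where D: "eventually D U" "\<And>x y z. D (x, y) \<Longrightarrow> D (y, z) \<Longrightarrow> V (x, z)"
    using half[OF V] by blast
  have D': "eventually (\<lambda>p. D p \<and> D (snd p, fst p)) U"
  proof (rule eventually_conj[OF D(1)])
    show "eventually (\<lambda>p. D (snd p, fst p)) U"
      using * D(1) unfolding case_prod_beta by blast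
  qed
  \<comment> \<open>The uniform interior of the set of points \<open>D\<close>-close to
    \<open>x\<close> in both orders. Halving the witness \<open>D'\<close> once shows that
    \<open>G\<close> is a uniform neighbourhood of each of its points, which is openness by
    compatibility.\<close>
  define G where "G = {y \<in> topspace X. \<exists>D'. eventually D' U \<and> (\<forall>z\<in>topspace X. D' (y, z) \<longrightarrow> D (x, z) \<and> D (z, x))}"
  have "eventually (\<lambda>(y', z). y' = y \<longrightarrow> z \<in> G) U" if y: "y \<in> G" for y
  proof -
    obtain D' where D': "eventually D' U" "\<forall>z\<in>topspace X. D' (y, z) \<longrightarrow> D (x, z) \<and> D (z, x)"
      using y by (auto simp: G_def)
    obtain D'' where D'': "eventually D'' U" "\<And>x y z. D'' (x, y) \<Longrightarrow> D'' (y, z) \<Longrightarrow> D' (x, z)"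
      using half[OF D'(1)] by blast
    have "eventually (\<lambda>p. p \<in> topspace X \<times> topspace X) U"
      using * by (simp add: le_principal)
    with D''(1) have "eventually (\<lambda>p. D'' p \<and> p \<in> topspace X \<times> topspace X) U"
      by (rule eventually_conj)
    then show ?thesis
    proof (rule eventually_mono, clarify)
      fix z assume z: "D'' (y, z)" "z \<in> topspace X"
      then have "\<forall>w\<in>topspace X. D'' (z, w) \<longrightarrow> D (x, w) \<and> D (w, x)"
        using D'(2) D''(2) by blast
      with D''(1) z(2) show "z \<in> G" unfolding G_def by blast
    qed
  qed
  moreover have "G \<subseteq> topspace X" by (auto simp: G_def)
  ultimately have "openin X G" using * by blast
  moreover have "x \<in> G" using x D' by (fastforce simp: G_def)
  moreover have "V (y, z)" if "y \<in> G" "z \<in> G" for y z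
  proof -
    have "D (x, w) \<and> D (w, x)" if "w \<in> G" for w using that refl by (auto simp: G_def)
    with that show ?thesis using D(2)[of y x z] by blast
  qed
  ultimately show ?thesis by (intro exI[of _ G]) auto
qed

text \<open>Repeated halving of an entourage of a compatible \<open>U\<close> yields a normal
  sequence, its neighbourhood condition coming from \<open>compatible_uniformity_nhds_diag\<close>.
  Hence all entourages of \<open>U\<close> belong to \<open>normal_filter X\<close>, which makes
  that filter the least one.\<close>

lemma max_uniformity_eq:
  assumes "completely_regular_space X"
  shows "max_uniformity X = normal_filter X"
  unfolding max_uniformity_def
proof (rule Least_equality)
  show "compatible_uniformity X (normal_filter X)" by (rule compatible_normal_filter[OF assms])
  fix U assume U: "compatible_uniformity X U"
  note * = U[unfolded compatible_uniformity_def uniformity_on_set_def]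
  have half: "\<exists>D. eventually D U \<and> (\<forall>x y z. D (x, y) \<longrightarrow> D (y, z) \<longrightarrow> V (x, z))" if "eventually V U" for V
    using * that by blast
  define ent where "ent V \<longleftrightarrow> V \<subseteq> topspace X \<times> topspace X \<and> eventually (\<lambda>p. p \<in> V) U" for V
  have S: "eventually (\<lambda>p. p \<in> topspace X \<times> topspace X) U"
    using * by (simp add: le_principal)
  show "normal_filter X \<le> U"
    unfolding le_filter_def
  proof (intro allI impI)
    fix P assume P: "eventually P U"
    have 0: "ent {p \<in> topspace X \<times> topspace X. P p}"
      using eventually_conj[OF S P] unfolding ent_def by simp
    have step: "\<exists>D. ent D \<and> D O D \<subseteq> V" if V: "ent V" for V
    proof -
      obtain D where D: "eventually D U" "\<forall>x y z. D (x, y) \<longrightarrow> D (y, z) \<longrightarrow> (x, z) \<in> V"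
        using half[of "\<lambda>p. p \<in> V"] V unfolding ent_def by blast
      then have "ent {p \<in> topspace X \<times> topspace X. D p}"
        using eventually_conj[OF S D(1)] unfolding ent_def by simp
      with D(2) show ?thesis by (intro exI[of _ "{p \<in> topspace X \<times> topspace X. D p}"]) blast
    qed
    \<comment> \<open>One choice function for halving, iterated below from the entourage of
      \<open>P\<close> to produce the whole sequence.\<close>
    obtain h where h: "\<And>V. ent V \<Longrightarrow> ent (h V) \<and> h V O h V \<subseteq> V" using step by metis
    define W where "W n = (h ^^ n) {p \<in> topspace X \<times> topspace X. P p}" for n
    have ent_W: "ent (W n)" for n by (induction n) (use 0 h in \<open>auto simp: W_def\<close>)
    then have W: "W 0 = {p \<in> topspace X \<times> topspace X. P p}" "\<And>n. ent (W n)"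
        "\<And>n. W (Suc n) O W (Suc n) \<subseteq> W n"
      using h[OF ent_W] unfolding W_def by simp_all
    have "normal_seq X W"
      unfolding normal_seq_def
    proof (intro allI conjI ballI)
      fix n x assume "x \<in> topspace X"
      then show "\<exists>G. openin X G \<and> x \<in> G \<and> G \<times> G \<subseteq> W n"
        using compatible_uniformity_nhds_diag[OF U, of "\<lambda>p. p \<in> W n" x] W(2)[of n]
        unfolding ent_def by (auto simp: subset_eq)
    next
      fix n show "W n \<subseteq> topspace X \<times> topspace X" using W(2) by (simp add: ent_def)
    qed (rule W(3))
    then show "eventually P (normal_filter X)"
      unfolding eventually_normal_filter using W(1) by (intro exI[of _ W]) auto
  qed
qed

text \<open>One inclusion reads neighbourhoods off entourages, the other halves the radius. From
  here on statements about the maximum uniformity are statements about continuous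
  pseudo-metrics.\<close>

lemma gage_max_uniformity:
  assumes "completely_regular_space X"
  shows "gage (topspace X) (max_uniformity X) = cont_pmetrics X"
proof (intro set_eqI iffI)
  fix d assume "d \<in> gage (topspace X) (max_uniformity X)"
  then have d: "pseudo_metric_on (topspace X) d" "bounded_dist_on (topspace X) d"
      "\<And>\<epsilon>. \<epsilon> > 0 \<Longrightarrow> eventually (\<lambda>(x, y). d x y < \<epsilon>) (normal_filter X)"
    by (auto simp: gage_def max_uniformity_eq[OF assms])
  show "d \<in> cont_pmetrics X"
  proof (rule cont_pmetricsI[OF d(1,2)])
    fix x and \<epsilon> :: real assume x: "x \<in> topspace X" "0 < \<epsilon>"
    show "\<exists>W. openin X W \<and> x \<in> W \<and> (\<forall>y\<in>W. d x y < \<epsilon>)"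
      using compatible_uniformity_nhds_diag[OF compatible_normal_filter[OF assms] d(3)[OF x(2)] x(1)]
      by auto
  qed
next
  fix d assume d: "d \<in> cont_pmetrics X"
  have "eventually (\<lambda>(x, y). d x y < \<epsilon>) (normal_filter X)" if "\<epsilon> > 0" for \<epsilon>
    by (rule eventually_normal_filterI[OF normal_seq_pmetric[OF d that]]) simp
  then show "d \<in> gage (topspace X) (max_uniformity X)"
    using cont_pmetricsD[OF d] by (auto simp: gage_def max_uniformity_eq[OF assms])
qed

section \<open>The topologies generated by functions and by clopen sets\<close>

lemma openin_tauI:
  "bounded_cont_fun Y g \<Longrightarrow> open W \<Longrightarrow> openin (tau Y) {y \<in> topspace Y. g y \<in> W}"
  unfolding tau_def by (rule topology_generated_by_Basis) blast

lemma openin_tau_imp_openin: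
  assumes "openin (tau Y) W" shows "openin Y W"
proof -
  have "continuous_map Y (tau Y) id"
    unfolding tau_def
  proof (rule continuous_on_generated_topo)
    fix U assume "U \<in> {{y \<in> topspace Y. g y \<in> W} | g W. bounded_cont_fun Y g \<and> open W}"
    then obtain g V where "U = {y \<in> topspace Y. g y \<in> V}" "bounded_cont_fun Y g" "open V" by blast
    then show "openin Y (id -` U \<inter> topspace Y)"
      using openin_continuous_map_preimage[of Y euclideanreal g V]
      by (simp add: bounded_cont_fun_def Collect_conj_eq Int_commute)
  next
    show "id ` topspace Y \<subseteq> \<Union>{{y \<in> topspace Y. g y \<in> W} | g W. bounded_cont_fun Y g \<and> open W}"
      using topspace_tau[of Y] unfolding tau_def topology_generated_by_topspace by simp
  qed
  from openin_continuous_map_preimage[OF this assms] show ?thesis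
    using openin_subset[OF assms] by (simp add: topspace_tau Collect_conj_eq Int_absorb1)
qed

lemma continuous_map_tau:
  assumes "bounded_cont_fun Y g" shows "continuous_map (tau Y) euclideanreal g"
  using openin_tauI[OF assms] by (simp add: continuous_map_def topspace_tau)

text \<open>Needed to apply \<open>gage_max_uniformity\<close> to \<open>tau Y\<close>. The
  separating function is built along the generation of the open set: a truncated distance to the
  value at \<open>x\<close> for a basic set, a maximum for an intersection, one member's function
  for a union.\<close>

lemma completely_regular_space_tau: "completely_regular_space (tau Y)"
proof -
  let ?B = "{{y \<in> topspace Y. g y \<in> W} | g W. bounded_cont_fun Y g \<and> open W}"
  have *: "\<exists>h. continuous_map (tau Y) euclideanreal h \<and> h x = 0 \<and> (\<forall>y\<in>topspace Y - W. h y = 1)"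
    if "generate_topology_on ?B W" "x \<in> W" for x W
    using that
  proof (induction W)
    case Empty then show ?case by simp
  next
    case (Int V W)
    then obtain g h where gh: "continuous_map (tau Y) euclideanreal g" "g x = 0" "\<forall>y\<in>topspace Y - V. g y = 1"
      "continuous_map (tau Y) euclideanreal h" "h x = 0" "\<forall>y\<in>topspace Y - W. h y = 1" by blast
    then have "1 \<le> max (g y) (h y)" if "y \<in> topspace Y - V \<inter> W" for y
      using that by (cases "y \<in> V") auto
    with gh show ?case
      by (intro exI[of _ "\<lambda>y. min 1 (max (g y) (h y))"] conjI continuous_intros) auto
  next
    case (UN \<K>)
    then obtain W where "W \<in> \<K>" "x \<in> W" by blast
    with UN.IH[of W] obtain h where h: "continuous_map (tau Y) euclideanreal h" "h x = 0"
      "\<forall>y\<in>topspace Y - W. h y = 1" by blast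
    then show ?case using \<open>W \<in> \<K>\<close> by (intro exI[of _ h]) auto
  next
    case (Basis W)
    then obtain g V where g: "W = {y \<in> topspace Y. g y \<in> V}" "bounded_cont_fun Y g" "open V" by blast
    then obtain \<epsilon> where e: "\<epsilon> > 0" "ball (g x) \<epsilon> \<subseteq> V" using Basis.prems by (auto simp: open_contains_ball)
    have "\<bar>g y - g x\<bar> / \<epsilon> \<ge> 1" if "y \<in> topspace Y - W" for y
    proof -
      have "g y \<notin> ball (g x) \<epsilon>" using that e g(1) by blast
      then show ?thesis using e(1) by (simp add: dist_real_def abs_minus_commute)
    qed
    then show ?case
      using e(1) continuous_map_tau[OF g(2)]
      by (intro exI[of _ "\<lambda>y. min 1 (\<bar>g y - g x\<bar> / \<epsilon>)"] conjI continuous_intros) auto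
  qed
  show ?thesis
    unfolding completely_regular_space_alt'
  proof clarify
    fix W x assume W: "openin (tau Y) W" "x \<in> W"
    have "generate_topology_on ?B W"
      using W(1) unfolding tau_def by (rule openin_topology_generated_by)
    from *[OF this W(2)] show "\<exists>h. continuous_map (tau Y) euclideanreal h \<and> h x = 0 \<and> h ` (topspace (tau Y) - W) \<subseteq> {1}"
      by (auto simp: topspace_tau image_subset_iff)
  qed
qed

lemma tau_completely_regular:
  assumes "completely_regular_space Y" shows "tau Y = Y"
  unfolding topology_eq
proof (intro allI iffI)
  fix W assume W: "openin Y W"
  have "\<exists>G. openin (tau Y) G \<and> x \<in> G \<and> G \<subseteq> W" if x: "x \<in> W" for x
  proof -
    have "closedin Y (topspace Y - W)" "x \<in> topspace Y - (topspace Y - W)"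
      using W x openin_subset by blast+
    then obtain g where g: "continuous_map Y (top_of_set {0..1::real}) g" "g x = 0" "g ` (topspace Y - W) \<subseteq> {1}"
      using assms unfolding completely_regular_space_def by meson
    then have "bounded_cont_fun Y g"
      using bounded_subset[of "{0..1::real}" "g ` topspace Y"]
      by (auto simp: bounded_cont_fun_def continuous_map_in_subtopology image_subset_iff Pi_iff)
    from openin_tauI[OF this, of "{..<1}"] show ?thesis
      using g x openin_subset[OF W] by (intro exI[of _ "{y \<in> topspace Y. g y \<in> {..<1}}"]) auto
  qed
  then show "openin (tau Y) W" by (subst openin_subopen) blast
qed (rule openin_tau_imp_openin)

lemma cont_pmetrics_bounded_cont_fun:
  assumes "d \<in> cont_pmetrics X" "x \<in> topspace X" shows "bounded_cont_fun X (d x)"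
proof -
  obtain B where "\<forall>x\<in>topspace X. \<forall>y\<in>topspace X. d x y \<le> B"
    using cont_pmetricsD(2)[OF assms(1)] by (auto simp: bounded_dist_on_def)
  then have "d x ` topspace X \<subseteq> {0..B}"
    using assms(2) pseudo_metric_onD(1)[OF cont_pmetricsD(1)[OF assms(1)]] by auto
  then show ?thesis
    using continuous_map_pmetric[OF assms] bounded_subset[of "{0..B}"] by (auto simp: bounded_cont_fun_def)
qed

text \<open>For fixed \<open>x\<close> the function \<open>d x\<close> is itself bounded and
  continuous, so the balls of a continuous \<open>d\<close> are already open in the weak
  topology.\<close>

lemma cont_pmetrics_tau: "cont_pmetrics (tau Y) = cont_pmetrics Y"
proof (intro set_eqI iffI)
  fix d assume d: "d \<in> cont_pmetrics (tau Y)"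
  show "d \<in> cont_pmetrics Y"
  proof (rule cont_pmetricsI)
    fix x and \<epsilon> :: real assume "x \<in> topspace Y" "0 < \<epsilon>"
    then show "\<exists>W. openin Y W \<and> x \<in> W \<and> (\<forall>y\<in>W. d x y < \<epsilon>)"
      using openin_tau_imp_openin[OF openin_pmetric_ball[OF d, of x \<epsilon>]]
        pseudo_metric_onD(2)[OF cont_pmetricsD(1)[OF d]]
      by (intro exI[of _ "{y \<in> topspace (tau Y). d x y < \<epsilon>}"]) (auto simp: topspace_tau)
  qed (use cont_pmetricsD[OF d] in \<open>simp_all add: topspace_tau\<close>)
next
  fix d assume d: "d \<in> cont_pmetrics Y"
  show "d \<in> cont_pmetrics (tau Y)"
  proof (rule cont_pmetricsI)
    fix x and \<epsilon> :: real assume "x \<in> topspace (tau Y)" "0 < \<epsilon>"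
    then show "\<exists>W. openin (tau Y) W \<and> x \<in> W \<and> (\<forall>y\<in>W. d x y < \<epsilon>)"
      using openin_tauI[OF cont_pmetrics_bounded_cont_fun[OF d, of x], of "{..<\<epsilon>}"]
        pseudo_metric_onD(2)[OF cont_pmetricsD(1)[OF d]]
      by (intro exI[of _ "{y \<in> topspace Y. d x y \<in> {..<\<epsilon>}}"]) (auto simp: topspace_tau)
  qed (use cont_pmetricsD[OF d] in \<open>simp_all add: topspace_tau\<close>)
qed

section \<open>The topology generated by clopen sets\<close>

lemma openin_tau0_clopen: "clopenin Y C \<Longrightarrow> openin (tau0 Y) C"
  unfolding openin_tau0 by (rule union_of_inc) (auto simp: arbitrary_def)

lemma openin_tau0_imp_openin: "openin (tau0 Y) W \<Longrightarrow> openin Y W"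
  by (fastforce simp: openin_tau0 union_of_def clopenin_def)

lemma topspace_tau0: "topspace (tau0 Y) = topspace Y"
proof
  show "topspace (tau0 Y) \<subseteq> topspace Y"
    using openin_subset[OF openin_tau0_imp_openin[OF openin_topspace]] .
  show "topspace Y \<subseteq> topspace (tau0 Y)"
    by (rule openin_subset, rule openin_tau0_clopen) (simp add: clopenin_def)
qed

text \<open>If \<open>y\<close> lies outside the ball about \<open>x\<close>, then the ball of the
  same radius about \<open>y\<close> misses it: a common point \<open>z\<close> would force
  \<open>d x y < \<epsilon>\<close>.\<close>

lemma clopenin_ultrametric_ball:
  assumes d: "d \<in> cont_pmetrics Y" and u: "pseudo_ultrametric_on (topspace Y) d" and x: "x \<in> topspace Y"
  shows "clopenin Y {y \<in> topspace Y. d x y < \<epsilon>}"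
proof -
  note pm = pseudo_metric_onD[OF cont_pmetricsD(1)[OF d]]
  have "\<exists>G. openin Y G \<and> y \<in> G \<and> G \<subseteq> topspace Y - {y \<in> topspace Y. d x y < \<epsilon>}"
    if y: "y \<in> topspace Y - {y \<in> topspace Y. d x y < \<epsilon>}" for y
  proof (cases "\<epsilon> > 0")
    case True
    have "d x z \<ge> \<epsilon>" if z: "z \<in> topspace Y" "d y z < \<epsilon>" for z
    proof -
      have "d x y \<le> max (d x z) (d z y)" "d z y = d y z"
        using u x y z pm by (auto simp: pseudo_ultrametric_on_def)
      then show ?thesis using y z by auto
    qed
    then show ?thesis
      using openin_pmetric_ball[OF d, of y \<epsilon>] True y pm(2)[of y y]
      by (intro exI[of _ "{z \<in> topspace Y. d y z < \<epsilon>}"]) (force simp: not_less)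
  next
    case False
    then have "{y \<in> topspace Y. d x y < \<epsilon>} = {}" using pm(1)[OF x] by force
    then show ?thesis using y by auto
  qed
  then have "openin Y (topspace Y - {y \<in> topspace Y. d x y < \<epsilon>})" by (subst openin_subopen) blast
  then show ?thesis using openin_pmetric_ball[OF d x] by (auto simp: clopenin_def closedin_def)
qed

text \<open>Balls of a continuous pseudo-ultrametric are clopen, hence open in
  \<open>tau0 Y\<close>; so continuity over \<open>tau0 Y\<close> and over \<open>Y\<close>
  agree.\<close>

lemma zero_dim_gage_tau0:
  "zero_dim_gage (tau0 Y) = {d \<in> cont_pmetrics Y. pseudo_ultrametric_on (topspace Y) d}"
proof -
  have "zero_dim_gage (tau0 Y) = {d \<in> cont_pmetrics (tau0 Y). pseudo_ultrametric_on (topspace Y) d}"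
    by (auto simp: zero_dim_gage_def cont_pmetrics_def topspace_tau0 pseudo_ultrametric_on_def)
  moreover have "d \<in> cont_pmetrics Y" if d: "d \<in> cont_pmetrics (tau0 Y)" for d
  proof (rule cont_pmetricsI)
    fix x and \<epsilon> :: real assume "x \<in> topspace Y" "0 < \<epsilon>"
    then show "\<exists>W. openin Y W \<and> x \<in> W \<and> (\<forall>y\<in>W. d x y < \<epsilon>)"
      using openin_tau0_imp_openin[OF openin_pmetric_ball[OF d, of x \<epsilon>]]
        pseudo_metric_onD(2)[OF cont_pmetricsD(1)[OF d]]
      by (intro exI[of _ "{y \<in> topspace (tau0 Y). d x y < \<epsilon>}"]) (auto simp: topspace_tau0)
  qed (use cont_pmetricsD[OF d] in \<open>simp_all add: topspace_tau0\<close>)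
  moreover have "d \<in> cont_pmetrics (tau0 Y)"
    if d: "d \<in> cont_pmetrics Y" "pseudo_ultrametric_on (topspace Y) d" for d
  proof (rule cont_pmetricsI)
    fix x and \<epsilon> :: real assume "x \<in> topspace (tau0 Y)" "0 < \<epsilon>"
    then show "\<exists>W. openin (tau0 Y) W \<and> x \<in> W \<and> (\<forall>y\<in>W. d x y < \<epsilon>)"
      using openin_tau0_clopen[OF clopenin_ultrametric_ball[OF d, of x \<epsilon>]]
        pseudo_metric_onD(2)[OF cont_pmetricsD(1)[OF d(1)]]
      by (intro exI[of _ "{y \<in> topspace Y. d x y < \<epsilon>}"]) (auto simp: topspace_tau0)
  qed (use cont_pmetricsD[OF d(1)] in \<open>simp_all add: topspace_tau0\<close>)
  ultimately show ?thesis by blast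
qed

section \<open>Barrier functions\<close>

lemma gage_pseudo_metric: "d \<in> gage S U \<Longrightarrow> pseudo_metric_on S d"
  by (simp add: gage_def)

lemma chains_nonempty: "f \<noteq> {} \<Longrightarrow> chains f \<noteq> {}"
proof -
  assume "f \<noteq> {}"
  then obtain p where "p \<in> f" by blast
  then have "[p] \<in> chains f" by (simp add: chains_def)
  then show ?thesis by blast
qed

lemma chains_append: "ps \<in> chains f \<Longrightarrow> qs \<in> chains f \<Longrightarrow> ps @ qs \<in> chains f"
  by (auto simp: chains_def)

lemma eq_zero_iff_less: "0 \<le> r \<Longrightarrow> (r = 0) = (\<forall>\<epsilon>>0. r < \<epsilon>)" for r :: real
  by (metis less_eq_real_def order_less_irrefl)

text \<open>Nonemptiness of \<open>f\<close> keeps the real infima from being taken over the empty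
  set; in the applications it follows from reflexivity of \<open>A\<close> or
  \<open>C\<close>.\<close>

locale pseudo_metric_rel =
  fixes S :: "'a set" and d :: "'a \<Rightarrow> 'a \<Rightarrow> real" and f :: "('a \<times> 'a) set"
  assumes pm: "pseudo_metric_on S d" and fS: "f \<subseteq> S \<times> S" and f_ne: "f \<noteq> {}"
begin

lemma nonneg: "x \<in> S \<Longrightarrow> y \<in> S \<Longrightarrow> 0 \<le> d x y"
  and refl_0: "x \<in> S \<Longrightarrow> d x x = 0"
  and sym: "x \<in> S \<Longrightarrow> y \<in> S \<Longrightarrow> d x y = d y x"
  and tri: "x \<in> S \<Longrightarrow> y \<in> S \<Longrightarrow> z \<in> S \<Longrightarrow> d x z \<le> d x y + d y z"
  using pm by (auto simp: pseudo_metric_on_def)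

lemma chain_sum_nonneg: "set ps \<subseteq> f \<Longrightarrow> x \<in> S \<Longrightarrow> y \<in> S \<Longrightarrow> 0 \<le> chain_sum d x ps y"
proof (induction ps arbitrary: x)
  case (Cons p ps)
  then show ?case using fS nonneg by (cases p) (auto intro!: add_nonneg_nonneg)
qed (simp add: nonneg)

lemma chain_max_nonneg: "set ps \<subseteq> f \<Longrightarrow> x \<in> S \<Longrightarrow> y \<in> S \<Longrightarrow> 0 \<le> chain_max d x ps y"
proof (induction ps arbitrary: x)
  case (Cons p ps)
  then show ?case using fS nonneg by (cases p) (auto simp: le_max_iff_disj)
qed (simp add: nonneg)

lemma chain_max_le_sum: "set ps \<subseteq> f \<Longrightarrow> x \<in> S \<Longrightarrow> y \<in> S \<Longrightarrow> chain_max d x ps y \<le> chain_sum d x ps y"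
proof (induction ps arbitrary: x)
  case (Cons p ps)
  obtain a b where p: "p = (a, b)" by (cases p)
  with Cons.prems fS have ab: "a \<in> S" "b \<in> S" by auto
  have "chain_max d b ps y \<le> chain_sum d b ps y" using Cons ab by auto
  moreover have "0 \<le> chain_sum d b ps y" using Cons.prems ab by (intro chain_sum_nonneg) auto
  moreover have "0 \<le> d x a" using nonneg ab Cons.prems by auto
  ultimately show ?case using p by simp
qed simp

lemma chain_sum_start:
  assumes "set ps \<subseteq> f" "x \<in> S" "y \<in> S" "z \<in> S"
  shows "chain_sum d x ps y \<le> d x z + chain_sum d z ps y"
proof (cases ps)
  case Nil then show ?thesis using assms tri by simp
next
  case (Cons p qs)
  obtain a b where p: "p = (a, b)" by (cases p)
  with assms Cons fS have "a \<in> S" by auto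
  then show ?thesis using tri[of x z a] assms Cons p by simp
qed

text \<open>The gap where the two chains meet is at most the sum of their gaps to \<open>z\<close>,
  and this sum is already part of the right-hand side.\<close>

lemma chain_sum_append:
  assumes "set ps \<subseteq> f" "set qs \<subseteq> f" "x \<in> S" "y \<in> S" "z \<in> S"
  shows "chain_sum d x (ps @ qs) y \<le> chain_sum d x ps z + chain_sum d z qs y"
  using assms
proof (induction ps arbitrary: x)
  case Nil then show ?case using chain_sum_start by simp
next
  case (Cons p ps)
  obtain a b where p: "p = (a, b)" by (cases p)
  with Cons.prems fS have "b \<in> S" by auto
  then have "chain_sum d b (ps @ qs) y \<le> chain_sum d b ps z + chain_sum d z qs y"
    using Cons by auto
  then show ?case by (simp add: p)
qed

text \<open>The second chain is the empty list, whose value is \<open>d z y\<close>.\<close>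

lemma chain_sum_end:
  assumes "set ps \<subseteq> f" "x \<in> S" "y \<in> S" "z \<in> S"
  shows "chain_sum d x ps y \<le> chain_sum d x ps z + d z y"
  using chain_sum_append[of ps "[]" x y z] assms by simp

text \<open>Moving the endpoint affects only the last gap. The price \<open>d z y\<close> stands
  outside the maximum because \<open>d\<close> need not be an ultrametric.\<close>

lemma chain_max_end:
  assumes "set ps \<subseteq> f" "x \<in> S" "y \<in> S" "z \<in> S"
  shows "chain_max d x ps y \<le> chain_max d x ps z + d z y"
  using assms
proof (induction ps arbitrary: x)
  case Nil then show ?case using tri by simp
next
  case (Cons p ps)
  obtain a b where p: "p = (a, b)" by (cases p)
  with Cons.prems fS have "b \<in> S" by auto
  then have "chain_max d b ps y \<le> chain_max d b ps z + d z y"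
    using Cons by auto
  moreover have "0 \<le> d z y" using nonneg Cons.prems by auto
  ultimately show ?case by (auto simp: p max_def)
qed

text \<open>Splitting at a pair of the chain itself loses nothing; this exact identity is what makes
  an inserted loop useful.\<close>

lemma chain_max_append_Cons:
  "chain_max d x (ps @ (a, b) # qs) y = max (chain_max d x ps a) (chain_max d b qs y)"
  by (induction ps arbitrary: x) (auto simp: max.assoc)

text \<open>A loop at \<open>z\<close> separates the two chains, so that the triangle inequality is only needed for
  terms of the loop; this is what makes \<open>m_bar\<close> an ultrametric below.\<close>

lemma chain_max_append_loop:
  assumes "set ps \<subseteq> f" "set rs \<subseteq> f" "set qs \<subseteq> f" "rs \<noteq> []" "qs \<noteq> []" "x \<in> S" "y \<in> S" "z \<in> S"
  shows "chain_max d x (ps @ rs @ qs) y \<le> max (chain_max d x ps z) (chain_max d z qs y) + chain_max d z rs z"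
proof -
  obtain a b rs' where rs: "rs = (a, b) # rs'" using assms(4) by (cases rs) auto
  obtain a' b' qs' where qs: "qs = (a', b') # qs'" using assms(5) by (cases qs) auto
  have S: "a \<in> S" "b \<in> S" "a' \<in> S" "b' \<in> S" using assms rs qs fS by auto
  have "chain_max d x (ps @ rs @ qs) y
      = max (chain_max d x ps a) (max (chain_max d b rs' a') (chain_max d b' qs' y))"
    using chain_max_append_Cons by (simp add: rs qs)
  moreover have "chain_max d x ps a \<le> chain_max d x ps z + d z a"
    using chain_max_end assms S by blast
  \<comment> \<open>The middle part costs at most the loop plus \<open>d z a'\<close>, and
    \<open>d z a'\<close> is already the first gap of the chain from \<open>z\<close> along
    \<open>qs\<close>. So the total error is a single loop value.\<close>
  moreover have "chain_max d b rs' a' \<le> chain_max d b rs' z + d z a'"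
    using chain_max_end[of rs' b a' z] assms S rs by auto
  moreover have "0 \<le> chain_max d z rs z" using chain_max_nonneg assms by blast
  ultimately show ?thesis by (auto simp: rs qs)
qed

lemma ell_less_iff:
  assumes "x \<in> S" "y \<in> S"
  shows "ell f d x y < r \<longleftrightarrow> (\<exists>ps\<in>chains f. chain_sum d x ps y < r)"
proof -
  have "bdd_below ((\<lambda>ps. chain_sum d x ps y) ` chains f)"
    using chain_sum_nonneg assms by (intro bdd_belowI[of _ 0]) (auto simp: chains_def)
  then show ?thesis unfolding ell_def by (intro cINF_less_iff chains_nonempty f_ne)
qed

lemma m_bar_less_iff:
  assumes "x \<in> S" "y \<in> S"
  shows "m_bar f d x y < r \<longleftrightarrow> (\<exists>ps\<in>chains f. chain_max d x ps y < r)"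
proof -
  have "bdd_below ((\<lambda>ps. chain_max d x ps y) ` chains f)"
    using chain_max_nonneg assms by (intro bdd_belowI[of _ 0]) (auto simp: chains_def)
  then show ?thesis unfolding m_bar_def by (intro cINF_less_iff chains_nonempty f_ne)
qed

lemma ell_nonneg: "x \<in> S \<Longrightarrow> y \<in> S \<Longrightarrow> 0 \<le> ell f d x y"
  using chain_sum_nonneg unfolding ell_def
  by (intro cINF_greatest chains_nonempty f_ne) (auto simp: chains_def)

lemma m_bar_nonneg: "x \<in> S \<Longrightarrow> y \<in> S \<Longrightarrow> 0 \<le> m_bar f d x y"
  using chain_max_nonneg unfolding m_bar_def
  by (intro cINF_greatest chains_nonempty f_ne) (auto simp: chains_def)

lemma ell_rel: "(a, b) \<in> f \<Longrightarrow> ell f d a b = 0"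
proof -
  assume ab: "(a, b) \<in> f"
  then have S: "a \<in> S" "b \<in> S" using fS by auto
  have "[(a, b)] \<in> chains f" "chain_sum d a [(a, b)] b = 0"
    using ab S refl_0 by (auto simp: chains_def)
  then have "\<forall>\<epsilon>>0. ell f d a b < \<epsilon>" using ell_less_iff[OF S] by metis
  then show ?thesis using ell_nonneg[OF S] eq_zero_iff_less by blast
qed

lemma m_bar_rel: "(a, b) \<in> f \<Longrightarrow> m_bar f d a b = 0"
proof -
  assume ab: "(a, b) \<in> f"
  then have S: "a \<in> S" "b \<in> S" using fS by auto
  have "[(a, b)] \<in> chains f" "chain_max d a [(a, b)] b = 0"
    using ab S refl_0 by (auto simp: chains_def)
  then have "\<forall>\<epsilon>>0. m_bar f d a b < \<epsilon>" using m_bar_less_iff[OF S] by metis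
  then show ?thesis using m_bar_nonneg[OF S] eq_zero_iff_less by blast
qed

lemma ell_triangle:
  assumes "x \<in> S" "y \<in> S" "z \<in> S"
  shows "ell f d x z \<le> ell f d x y + ell f d y z"
proof (rule field_le_epsilon)
  fix \<epsilon> :: real assume "\<epsilon> > 0"
  then have "ell f d x y < ell f d x y + \<epsilon>/2" "ell f d y z < ell f d y z + \<epsilon>/2" by auto
  then obtain ps qs where ps: "ps \<in> chains f" "chain_sum d x ps y < ell f d x y + \<epsilon>/2"
    and qs: "qs \<in> chains f" "chain_sum d y qs z < ell f d y z + \<epsilon>/2"
    using ell_less_iff assms by metis
  have "chain_sum d x (ps @ qs) z \<le> chain_sum d x ps y + chain_sum d y qs z"
    using chain_sum_append ps(1) qs(1) assms by (simp add: chains_def)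
  then have "chain_sum d x (ps @ qs) z < ell f d x y + ell f d y z + \<epsilon>"
    using ps(2) qs(2) by linarith
  then have "ell f d x z < ell f d x y + ell f d y z + \<epsilon>"
    using ell_less_iff[OF assms(1,3)] chains_append[OF ps(1) qs(1)] by blast
  then show "ell f d x z \<le> ell f d x y + ell f d y z + \<epsilon>" by simp
qed

text \<open>The hypothesis gives an almost free loop at \<open>x\<close>; moving its end from
  \<open>x\<close> to \<open>y\<close> costs \<open>d x y\<close>.\<close>

lemma ell_le:
  assumes "ell f d x x = 0" and S: "x \<in> S" "y \<in> S"
  shows "ell f d x y \<le> d x y"
proof (rule field_le_epsilon)
  fix \<epsilon> :: real assume "\<epsilon> > 0"
  then obtain ps where ps: "ps \<in> chains f" "chain_sum d x ps x < \<epsilon>"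
    using ell_less_iff assms by metis
  have "chain_sum d x ps y \<le> chain_sum d x ps x + d x y"
    using chain_sum_end ps(1) S by (simp add: chains_def)
  then have "chain_sum d x ps y < d x y + \<epsilon>" using ps(2) by linarith
  then show "ell f d x y \<le> d x y + \<epsilon>" using ell_less_iff[OF S] ps(1) by (meson less_imp_le)
qed

lemma m_bar_le:
  assumes "m_bar f d x x = 0" and S: "x \<in> S" "y \<in> S"
  shows "m_bar f d x y \<le> d x y"
proof (rule field_le_epsilon)
  fix \<epsilon> :: real assume "\<epsilon> > 0"
  then obtain ps where ps: "ps \<in> chains f" "chain_max d x ps x < \<epsilon>"
    using m_bar_less_iff assms by metis
  have "chain_max d x ps y \<le> chain_max d x ps x + d x y"
    using chain_max_end ps(1) S by (simp add: chains_def)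
  then have "chain_max d x ps y < d x y + \<epsilon>" using ps(2) by linarith
  then show "m_bar f d x y \<le> d x y + \<epsilon>" using m_bar_less_iff[OF S] ps(1) by (meson less_imp_le)
qed

text \<open>Near-optimal chains are joined through a loop at \<open>y\<close> of value below
  \<open>\<epsilon>/2\<close>, which absorbs the error of concatenation.\<close>

lemma m_bar_ultra:
  assumes "m_bar f d y y = 0" and S: "x \<in> S" "y \<in> S" "z \<in> S"
  shows "m_bar f d x z \<le> max (m_bar f d x y) (m_bar f d y z)"
proof (rule field_le_epsilon)
  fix \<epsilon> :: real assume e: "\<epsilon> > 0"
  then have "m_bar f d x y < m_bar f d x y + \<epsilon>/2" "m_bar f d y z < m_bar f d y z + \<epsilon>/2"
    "m_bar f d y y < \<epsilon>/2" using assms(1) by auto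
  then obtain ps qs rs where ps: "ps \<in> chains f" "chain_max d x ps y < m_bar f d x y + \<epsilon>/2"
    and qs: "qs \<in> chains f" "chain_max d y qs z < m_bar f d y z + \<epsilon>/2"
    and rs: "rs \<in> chains f" "chain_max d y rs y < \<epsilon>/2"
    using m_bar_less_iff S by metis
  have "chain_max d x (ps @ rs @ qs) z \<le> max (chain_max d x ps y) (chain_max d y qs z) + chain_max d y rs y"
    using chain_max_append_loop ps(1) qs(1) rs(1) S by (simp add: chains_def)
  then have "chain_max d x (ps @ rs @ qs) z < max (m_bar f d x y) (m_bar f d y z) + \<epsilon>"
    using ps(2) qs(2) rs(2) by linarith
  then have "m_bar f d x z < max (m_bar f d x y) (m_bar f d y z) + \<epsilon>"
    using m_bar_less_iff[OF S(1,3)] chains_append[OF ps(1) chains_append[OF rs(1) qs(1)]] by blast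
  then show "m_bar f d x z \<le> max (m_bar f d x y) (m_bar f d y z) + \<epsilon>" by simp
qed

text \<open>Only symmetry needs work. A chain is read backwards: a gap \<open>d x a\<close> bounds
  \<open>ell f d a x\<close> by \<open>ell_le\<close> and symmetry of \<open>d\<close>, and a pair
  \<open>(a, b)\<close> is recrossed for free by \<open>conv\<close>.\<close>

lemma ell_pseudo_metric:
  assumes refl: "\<And>x. x \<in> S \<Longrightarrow> ell f d x x = 0" and conv: "\<And>a b. (a, b) \<in> f \<Longrightarrow> ell f d b a = 0"
  shows "pseudo_metric_on S (ell f d)"
proof -
  have rev: "ell f d y x \<le> chain_sum d x ps y" if "set ps \<subseteq> f" "x \<in> S" "y \<in> S" for ps x y
    using that
  proof (induction ps arbitrary: x)
    case Nil then show ?case using ell_le[OF refl, of y x] sym by simp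
  next
    case (Cons p ps)
    obtain a b where p: "p = (a, b)" by (cases p)
    with Cons.prems fS have S: "a \<in> S" "b \<in> S" and ab: "(a, b) \<in> f" by auto
    have "ell f d y x \<le> ell f d y b + ell f d b x" using ell_triangle Cons.prems S by blast
    moreover have "ell f d b x \<le> ell f d b a + ell f d a x" using ell_triangle Cons.prems S by blast
    moreover have "ell f d a x \<le> d x a" using ell_le[OF refl, of a x] sym Cons.prems S by simp
    moreover have "ell f d y b \<le> chain_sum d b ps y" using Cons S by auto
    ultimately show ?case using conv[OF ab] by (simp add: p)
  qed
  have le: "ell f d y x \<le> ell f d x y" if "x \<in> S" "y \<in> S" for x y
    unfolding ell_def[of f d x y] using rev that
    by (intro cINF_greatest chains_nonempty f_ne) (auto simp: chains_def)
  have "ell f d x y = ell f d y x" if "x \<in> S" "y \<in> S" for x y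
    using le that by (meson order_antisym)
  then show ?thesis
    unfolding pseudo_metric_on_def using ell_nonneg refl ell_triangle by blast
qed

text \<open>Chains are reversed as for \<open>ell\<close>, with maxima. Here the ultrametric
  inequality comes before the triangle inequality, which follows from it by nonnegativity.\<close>

lemma m_bar_pseudo_ultrametric:
  assumes refl: "\<And>x. x \<in> S \<Longrightarrow> m_bar f d x x = 0" and conv: "\<And>a b. (a, b) \<in> f \<Longrightarrow> m_bar f d b a = 0"
  shows "pseudo_ultrametric_on S (m_bar f d)"
proof -
  note ultra = m_bar_ultra[OF refl]
  have rev: "m_bar f d y x \<le> chain_max d x ps y" if "set ps \<subseteq> f" "x \<in> S" "y \<in> S" for ps x y
    using that
  proof (induction ps arbitrary: x)
    case Nil then show ?case using m_bar_le[OF refl, of y x] sym by simp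
  next
    case (Cons p ps)
    obtain a b where p: "p = (a, b)" by (cases p)
    with Cons.prems fS have S: "a \<in> S" "b \<in> S" and ab: "(a, b) \<in> f" by auto
    have "m_bar f d y x \<le> max (m_bar f d y b) (m_bar f d b x)" using ultra Cons.prems S by blast
    moreover have "m_bar f d b x \<le> max (m_bar f d b a) (m_bar f d a x)" using ultra Cons.prems S by blast
    moreover have "m_bar f d a x \<le> d x a" using m_bar_le[OF refl, of a x] sym Cons.prems S by simp
    moreover have "m_bar f d y b \<le> chain_max d b ps y" using Cons S by auto
    moreover have "0 \<le> d x a" using nonneg Cons.prems S by blast
    ultimately show ?case using conv[OF ab] by (auto simp: p)
  qed
  have le: "m_bar f d y x \<le> m_bar f d x y" if "x \<in> S" "y \<in> S" for x y
    unfolding m_bar_def[of f d x y] using rev that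
    by (intro cINF_greatest chains_nonempty f_ne) (auto simp: chains_def)
  have sym: "m_bar f d x y = m_bar f d y x" if "x \<in> S" "y \<in> S" for x y
    using le that by (meson order_antisym)
  have "m_bar f d x z \<le> m_bar f d x y + m_bar f d y z" if "x \<in> S" "y \<in> S" "z \<in> S" for x y z
    using ultra[of y x z] m_bar_nonneg that by (smt (verit))
  then have "pseudo_metric_on S (m_bar f d)"
    unfolding pseudo_metric_on_def using m_bar_nonneg refl sym by blast
  then show ?thesis
    unfolding pseudo_ultrametric_on_def using ultra by blast
qed

text \<open>With the pairs of \<open>f\<close> at distance zero, a chain is a path from
  \<open>x\<close> to \<open>y\<close>, and its length is at least \<open>d x y\<close>.\<close>

lemma chain_sum_zero_on_rel:
  assumes zero: "\<And>a b. (a, b) \<in> f \<Longrightarrow> d a b = 0"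
  shows "set ps \<subseteq> f \<Longrightarrow> x \<in> S \<Longrightarrow> y \<in> S \<Longrightarrow> d x y \<le> chain_sum d x ps y"
proof (induction ps arbitrary: x)
  case (Cons p ps)
  obtain a b where p: "p = (a, b)" by (cases p)
  with Cons.prems fS have S: "a \<in> S" "b \<in> S" and ab: "(a, b) \<in> f" by auto
  have "d b y \<le> chain_sum d b ps y" using Cons S by auto
  moreover have "d x y \<le> d x a + d a y" "d a y \<le> d a b + d b y" using tri Cons.prems S by blast+
  ultimately show ?case using zero[OF ab] by (simp add: p)
qed simp

lemma chain_max_zero_on_rel:
  assumes zero: "\<And>a b. (a, b) \<in> f \<Longrightarrow> d a b = 0" and u: "pseudo_ultrametric_on S d"
  shows "set ps \<subseteq> f \<Longrightarrow> x \<in> S \<Longrightarrow> y \<in> S \<Longrightarrow> d x y \<le> chain_max d x ps y"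
proof (induction ps arbitrary: x)
  case (Cons p ps)
  obtain a b where p: "p = (a, b)" by (cases p)
  with Cons.prems fS have S: "a \<in> S" "b \<in> S" and ab: "(a, b) \<in> f" by auto
  have "d b y \<le> chain_max d b ps y" using Cons S by auto
  moreover have "d x y \<le> max (d x a) (d a y)" "d a y \<le> max (d a b) (d b y)"
    using u Cons.prems S by (auto simp: pseudo_ultrametric_on_def)
  moreover have "0 \<le> d x a" using nonneg Cons.prems S by blast
  ultimately show ?case using zero[OF ab] by (auto simp: p)
qed simp

text \<open>Pseudo-metrics that vanish on \<open>f\<close> are fixed by the barrier construction.
  Pull-backs from the quotient are of this kind, so every member of the gage downstairs is
  reached.\<close>

lemma ell_eq:
  assumes "\<And>a b. (a, b) \<in> f \<Longrightarrow> d a b = 0" "ell f d x x = 0" "x \<in> S" "y \<in> S"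
  shows "ell f d x y = d x y"
proof (rule antisym)
  show "d x y \<le> ell f d x y"
    unfolding ell_def using chain_sum_zero_on_rel assms
    by (intro cINF_greatest chains_nonempty f_ne) (auto simp: chains_def)
qed (use ell_le assms in blast)

lemma m_bar_eq:
  assumes "\<And>a b. (a, b) \<in> f \<Longrightarrow> d a b = 0" "pseudo_ultrametric_on S d" "m_bar f d x x = 0" "x \<in> S" "y \<in> S"
  shows "m_bar f d x y = d x y"
proof (rule antisym)
  show "d x y \<le> m_bar f d x y"
    unfolding m_bar_def using chain_max_zero_on_rel assms
    by (intro cINF_greatest chains_nonempty f_ne) (auto simp: chains_def)
qed (use m_bar_le assms in blast)

end

section \<open>Barrier relations as zero sets, and their test functions\<close>

lemma A_rel_eq:
  assumes f: "f \<subseteq> S \<times> S" "f \<noteq> {}"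
  shows "A_rel S U f = {(x, y) \<in> S \<times> S. \<forall>d\<in>gage S U. ell f d x y = 0}"
proof -
  have "(\<forall>\<epsilon>>0. \<exists>ps\<in>chains f. chain_sum d x ps y < \<epsilon>) \<longleftrightarrow> ell f d x y = 0"
    if "d \<in> gage S U" "x \<in> S" "y \<in> S" for d x y
  proof -
    interpret pseudo_metric_rel S d f using that f by unfold_locales (auto simp: gage_pseudo_metric)
    show ?thesis using that by (simp add: eq_zero_iff_less ell_nonneg ell_less_iff)
  qed
  then have "(\<forall>d\<in>gage S U. \<forall>\<epsilon>>0. \<exists>ps\<in>chains f. chain_sum d x ps y < \<epsilon>) \<longleftrightarrow> (\<forall>d\<in>gage S U. ell f d x y = 0)"
    if "x \<in> S" "y \<in> S" for x y
    using that by (intro ball_cong) auto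
  then show ?thesis unfolding A_rel_def by (intro Collect_cong) (simp only: split_beta mem_Times_iff fst_conv snd_conv cong: conj_cong)
qed

lemma C_rel_eq:
  assumes f: "f \<subseteq> S \<times> S" "f \<noteq> {}"
  shows "C_rel S U f = {(x, y) \<in> S \<times> S. \<forall>d\<in>gage S U. m_bar f d x y = 0}"
proof -
  have "(\<forall>\<epsilon>>0. \<exists>ps\<in>chains f. chain_max d x ps y < \<epsilon>) \<longleftrightarrow> m_bar f d x y = 0"
    if "d \<in> gage S U" "x \<in> S" "y \<in> S" for d x y
  proof -
    interpret pseudo_metric_rel S d f using that f by unfold_locales (auto simp: gage_pseudo_metric)
    show ?thesis using that by (simp add: eq_zero_iff_less m_bar_nonneg m_bar_less_iff)
  qed
  then have "(\<forall>d\<in>gage S U. \<forall>\<epsilon>>0. \<exists>ps\<in>chains f. chain_max d x ps y < \<epsilon>) \<longleftrightarrow> (\<forall>d\<in>gage S U. m_bar f d x y = 0)"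
    if "x \<in> S" "y \<in> S" for x y
    using that by (intro ball_cong) auto
  then show ?thesis unfolding C_rel_def by (intro Collect_cong) (simp only: split_beta mem_Times_iff fst_conv snd_conv cong: conj_cong)
qed

lemma A_rel_empty: "gage S U \<noteq> {} \<Longrightarrow> A_rel S U {} = {}"
  by (auto simp: A_rel_def chains_def intro: zero_less_one)

lemma C_rel_empty: "gage S U \<noteq> {} \<Longrightarrow> C_rel S U {} = {}"
  by (auto simp: C_rel_def chains_def intro: zero_less_one)

lemma A_rel_subset_C_rel:
  assumes f: "f \<subseteq> S \<times> S"
  shows "A_rel S U f \<subseteq> C_rel S U f"
proof -
  have "\<exists>ps\<in>chains f. chain_max d x ps y < \<epsilon>"
    if "d \<in> gage S U" "x \<in> S" "y \<in> S" "ps \<in> chains f" "chain_sum d x ps y < \<epsilon>" for d x y \<epsilon> ps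
  proof -
    have "f \<noteq> {}" using \<open>ps \<in> chains f\<close> by (auto simp: chains_def)
    then interpret pseudo_metric_rel S d f using that f by unfold_locales (auto simp: gage_pseudo_metric)
    have "chain_max d x ps y \<le> chain_sum d x ps y"
      using that by (intro chain_max_le_sum) (auto simp: chains_def)
    then show ?thesis using that by force
  qed
  then show ?thesis unfolding A_rel_def C_rel_def by blast
qed

text \<open>Telescoping: \<open>h\<close> can fall only across the gaps, by at most their lengths,
  and never across a pair of \<open>f\<close>.\<close>

lemma fun_le_chain_sum:
  fixes h :: "'a \<Rightarrow> real"
  assumes "\<And>a b. (a, b) \<in> f \<Longrightarrow> h a \<le> h b" "set ps \<subseteq> f"
  shows "h x - h y \<le> chain_sum (\<lambda>x y. \<bar>h x - h y\<bar>) x ps y"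
  using assms(2)
proof (induction ps arbitrary: x)
  case (Cons p ps)
  obtain a b where p: "p = (a, b)" by (cases p)
  then have "h b - h y \<le> chain_sum (\<lambda>x y. \<bar>h x - h y\<bar>) b ps y" "h a \<le> h b"
    using Cons assms(1) by auto
  then show ?case by (simp add: p)
qed simp

text \<open>A one-sided test that respects the direction of \<open>f\<close>: with the pseudo-metric
  of \<open>h\<close>, cheap chains bound \<open>h x - h y\<close> by every positive number.\<close>

lemma A_rel_monotone:
  assumes X: "completely_regular_space X" and h: "bounded_cont_fun X h"
    and mono: "\<And>a b. (a, b) \<in> f \<Longrightarrow> h a \<le> h b"
    and xy: "(x, y) \<in> A_rel (topspace X) (max_uniformity X) f"
  shows "h x \<le> h y"
proof (rule field_le_epsilon)
  fix \<epsilon> :: real assume e: "\<epsilon> > 0"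
  have "(\<lambda>x y. \<bar>h x - h y\<bar>) \<in> gage (topspace X) (max_uniformity X)"
    using fun_dist_cont_pmetrics[OF h] by (simp add: gage_max_uniformity[OF X])
  then obtain ps where "ps \<in> chains f" "chain_sum (\<lambda>x y. \<bar>h x - h y\<bar>) x ps y < \<epsilon>"
    using xy e unfolding A_rel_def by blast
  then show "h x \<le> h y + \<epsilon>"
    using fun_le_chain_sum[of f h ps x y] mono by (auto simp: chains_def)
qed

lemma clopen_bounded_cont_fun:
  assumes "clopenin X K" shows "bounded_cont_fun X (indicat_real K)"
proof -
  have "openin X {x \<in> topspace X. indicat_real K x \<in> W}" for W
  proof -
    define V where "V = {x \<in> topspace X. indicat_real K x \<in> W}"
    have "V \<in> {{}, K, topspace X - K, topspace X}"
      unfolding V_def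
      using assms closedin_subset[of X K] by (auto simp: clopenin_def indicator_def split: if_splits)
    then have "openin X V" using assms by (auto simp: clopenin_def closedin_def)
    then show ?thesis by (simp add: V_def)
  qed
  moreover have "bounded (indicat_real K ` topspace X)"
    by (rule bounded_subset[of "{0..1}"]) auto
  ultimately show ?thesis by (simp add: bounded_cont_fun_def continuous_map_def)
qed

text \<open>Distances of an indicator function are 0 or 1, so a chain of maximum below 1 never
  crosses the boundary of \<open>K\<close> in a gap, and by \<open>inv\<close> not in a pair of
  \<open>f\<close> either.\<close>

lemma C_rel_clopen:
  assumes X: "completely_regular_space X" and K: "clopenin X K"
    and inv: "\<And>a b. (a, b) \<in> f \<Longrightarrow> a \<in> K \<longleftrightarrow> b \<in> K"
    and xy: "(x, y) \<in> C_rel (topspace X) (max_uniformity X) f"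
  shows "x \<in> K \<longleftrightarrow> y \<in> K"
proof -
  let ?d = "\<lambda>x y. \<bar>indicat_real K x - indicat_real K y\<bar>"
  have "?d \<in> gage (topspace X) (max_uniformity X)"
    using fun_dist_cont_pmetrics[OF clopen_bounded_cont_fun[OF K]] by (simp add: gage_max_uniformity[OF X])
  then obtain ps where ps: "ps \<in> chains f" "chain_max ?d x ps y < 1"
    using xy unfolding C_rel_def by (blast intro: zero_less_one)
  have "x \<in> K \<longleftrightarrow> y \<in> K" if "set ps \<subseteq> f" "chain_max ?d x ps y < 1" for ps x
    using that
  proof (induction ps arbitrary: x)
    case Nil then show ?case by (auto simp: indicator_def split: if_splits)
  next
    case (Cons p ps)
    obtain a b where p: "p = (a, b)" by (cases p)
    with Cons.prems have prems: "set ps \<subseteq> f" "(a, b) \<in> f" "chain_max ?d b ps y < 1" "?d x a < 1"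
      by simp_all
    have "b \<in> K \<longleftrightarrow> y \<in> K" by (rule Cons.IH[OF prems(1,3)])
    moreover have "a \<in> K \<longleftrightarrow> b \<in> K" by (rule inv[OF prems(2)])
    moreover have "x \<in> K \<longleftrightarrow> a \<in> K" using prems(4) by (auto simp: indicator_def split: if_splits)
    ultimately show ?case by blast
  qed
  then show ?thesis using ps unfolding chains_def by blast
qed

lemma zero_in_cont_pmetrics: "(\<lambda>_ _. 0) \<in> cont_pmetrics X"
proof (rule cont_pmetricsI)
  fix x and \<epsilon> :: real assume "x \<in> topspace X" "0 < \<epsilon>"
  then show "\<exists>W. openin X W \<and> x \<in> W \<and> (\<forall>y\<in>W. 0 < \<epsilon>)" by blast
qed (auto simp: pseudo_metric_on_def bounded_dist_on_def)

text \<open>For \<open>(a, b) \<in> f\<close> symmetry of \<open>A_rel\<close> puts \<open>(b, a)\<close> into \<open>A_rel\<close>, so chains can be reversed at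
  no cost.\<close>

lemma ell_of_equiv_A_rel:
  assumes ne: "topspace X \<noteq> {}" and X: "completely_regular_space X" and f: "f \<subseteq> topspace X \<times> topspace X"
    and A: "A = A_rel (topspace X) (max_uniformity X) f" and eq: "equiv (topspace X) A"
  shows "f \<noteq> {}" and "f \<subseteq> A"
    and "A = {(x, y) \<in> topspace X \<times> topspace X. \<forall>d\<in>cont_pmetrics X. ell f d x y = 0}"
    and "d \<in> cont_pmetrics X \<Longrightarrow> ell f d \<in> cont_pmetrics X"
proof -
  note G = gage_max_uniformity[OF X]
  \<comment> \<open>Without pairs there are no chains, so \<open>A\<close> would be empty and could
    not be reflexive on a nonempty carrier. The zero pseudo-metric ensures that the condition
    defining \<open>A\<close> is not vacuous.\<close>
  show f_ne: "f \<noteq> {}"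
  proof
    assume "f = {}"
    then have "A = {}"
      using A_rel_empty[of "topspace X" "max_uniformity X"] zero_in_cont_pmetrics A unfolding G by blast
    then show False using eq ne by (auto simp: equiv_def refl_on_def)
  qed
  show A': "A = {(x, y) \<in> topspace X \<times> topspace X. \<forall>d\<in>cont_pmetrics X. ell f d x y = 0}"
    unfolding A A_rel_eq[OF f f_ne] G ..
  have loc: "pseudo_metric_rel (topspace X) d f" if "d \<in> cont_pmetrics X" for d
    using that f f_ne cont_pmetricsD(1) by unfold_locales
  show fA: "f \<subseteq> A" using f pseudo_metric_rel.ell_rel[OF loc] unfolding A' by blast
  assume d: "d \<in> cont_pmetrics X"
  interpret pseudo_metric_rel "topspace X" d f by (rule loc[OF d])
  have zero: "ell f d x y = 0" if "(x, y) \<in> A" for x y using that d unfolding A' by blast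
  have refl: "ell f d x x = 0" if "x \<in> topspace X" for x
    using zero eq that by (auto simp: equiv_def refl_on_def)
  show "ell f d \<in> cont_pmetrics X"
  proof (rule cont_pmetrics_dominated[OF d])
    show "pseudo_metric_on (topspace X) (ell f d)"
      using refl zero fA eq by (intro ell_pseudo_metric) (auto simp: equiv_def dest: symD)
  qed (use ell_le refl in blast)
qed

lemma m_bar_of_equiv_C_rel:
  assumes ne: "topspace X \<noteq> {}" and X: "completely_regular_space X" and f: "f \<subseteq> topspace X \<times> topspace X"
    and C: "C = C_rel (topspace X) (max_uniformity X) f" and eq: "equiv (topspace X) C"
  shows "f \<noteq> {}" and "f \<subseteq> C"
    and "C = {(x, y) \<in> topspace X \<times> topspace X. \<forall>d\<in>cont_pmetrics X. m_bar f d x y = 0}"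
    and "d \<in> cont_pmetrics X \<Longrightarrow> m_bar f d \<in> cont_pmetrics X"
    and "d \<in> cont_pmetrics X \<Longrightarrow> pseudo_ultrametric_on (topspace X) (m_bar f d)"
proof -
  note G = gage_max_uniformity[OF X]
  show f_ne: "f \<noteq> {}"
  proof
    assume "f = {}"
    then have "C = {}"
      using C_rel_empty[of "topspace X" "max_uniformity X"] zero_in_cont_pmetrics C unfolding G by blast
    then show False using eq ne by (auto simp: equiv_def refl_on_def)
  qed
  show C': "C = {(x, y) \<in> topspace X \<times> topspace X. \<forall>d\<in>cont_pmetrics X. m_bar f d x y = 0}"
    unfolding C C_rel_eq[OF f f_ne] G ..
  have loc: "pseudo_metric_rel (topspace X) d f" if "d \<in> cont_pmetrics X" for d
    using that f f_ne cont_pmetricsD(1) by unfold_locales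
  show fC: "f \<subseteq> C" using f pseudo_metric_rel.m_bar_rel[OF loc] unfolding C' by blast
  assume d: "d \<in> cont_pmetrics X"
  interpret pseudo_metric_rel "topspace X" d f by (rule loc[OF d])
  have zero: "m_bar f d x y = 0" if "(x, y) \<in> C" for x y using that d unfolding C' by blast
  have refl: "m_bar f d x x = 0" if "x \<in> topspace X" for x
    using zero eq that by (auto simp: equiv_def refl_on_def)
  show u: "pseudo_ultrametric_on (topspace X) (m_bar f d)"
    using refl zero fC eq by (intro m_bar_pseudo_ultrametric) (auto simp: equiv_def dest: symD)
  show "m_bar f d \<in> cont_pmetrics X"
    using u m_bar_le refl by (intro cont_pmetrics_dominated[OF d]) (auto simp: pseudo_ultrametric_on_def)
qed

section \<open>Quotients by barrier relations\<close>

lemma continuous_map_quotient_space: "continuous_map X (quotient_space X E) (\<lambda>x. E `` {x})"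
  using quotient_map_quotient_space by (rule quotient_imp_continuous_map)

lemma bounded_cont_fun_quotient:
  assumes "bounded_cont_fun (quotient_space X E) g"
  shows "bounded_cont_fun X (\<lambda>x. g (E `` {x}))"
proof -
  have "(\<lambda>x. g (E `` {x})) ` topspace X \<subseteq> g ` topspace (quotient_space X E)"
    by (auto simp: topspace_quotient_space intro!: imageI quotientI)
  moreover have "continuous_map X euclideanreal (g \<circ> (\<lambda>x. E `` {x}))"
    using assms unfolding bounded_cont_fun_def
    by (intro continuous_map_compose[OF continuous_map_quotient_space]) auto
  ultimately show ?thesis
    using assms bounded_subset unfolding bounded_cont_fun_def o_def by blast
qed

lemma clopenin_quotient:
  assumes "clopenin (quotient_space X E) K"
  shows "clopenin X {x \<in> topspace X. E `` {x} \<in> K}"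
  using assms openin_continuous_map_preimage[OF continuous_map_quotient_space]
    closedin_continuous_map_preimage[OF continuous_map_quotient_space]
  unfolding clopenin_def by blast

lemma ball_quotient_iff: "(\<forall>P\<in>S // E. Q P) \<longleftrightarrow> (\<forall>x\<in>S. Q (E `` {x}))"
  by (auto simp: quotient_def)

text \<open>Joint continuity on a product of quotients is not tested by preimages in
  \<open>X \<times> X\<close>, as a product of quotient maps may fail to be one. Balls avoid this: a
  ball about a class is a subset of one quotient, and its preimage is the ball of the pulled-back
  pseudo-metric.\<close>

lemma cont_pmetrics_quotient_iff:
  "e \<in> cont_pmetrics (quotient_space X E) \<longleftrightarrow> (\<lambda>x y. e (E `` {x}) (E `` {y})) \<in> cont_pmetrics X"
  (is "_ \<longleftrightarrow> ?e \<in> _")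
proof -
  have pm: "pseudo_metric_on (topspace X // E) e \<longleftrightarrow> pseudo_metric_on (topspace X) ?e"
    "bounded_dist_on (topspace X // E) e \<longleftrightarrow> bounded_dist_on (topspace X) ?e"
    unfolding pseudo_metric_on_def bounded_dist_on_def ball_quotient_iff by simp_all
  have pre: "openin (quotient_space X E) {Q \<in> topspace X // E. e (E `` {x}) Q < \<epsilon>} \<longleftrightarrow>
      openin X {y \<in> topspace X. ?e x y < \<epsilon>}" for x \<epsilon>
  proof -
    have "{y \<in> topspace X. E `` {y} \<in> {Q \<in> topspace X // E. e (E `` {x}) Q < \<epsilon>}} =
        {y \<in> topspace X. ?e x y < \<epsilon>}"
      by (auto intro: quotientI)
    then show ?thesis unfolding openin_quotient_space by auto
  qed
  show ?thesis
  proof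
    assume e: "e \<in> cont_pmetrics (quotient_space X E)"
    show "?e \<in> cont_pmetrics X"
    proof (rule cont_pmetricsI)
      show p: "pseudo_metric_on (topspace X) ?e" "bounded_dist_on (topspace X) ?e"
        using cont_pmetricsD[OF e] by (simp_all add: topspace_quotient_space pm)
      fix x and \<epsilon> :: real assume x: "x \<in> topspace X" "0 < \<epsilon>"
      then have "openin X {y \<in> topspace X. ?e x y < \<epsilon>}"
        using openin_pmetric_ball[OF e, of "E `` {x}" \<epsilon>] pre[of x \<epsilon>]
        by (simp add: topspace_quotient_space quotientI)
      then show "\<exists>W. openin X W \<and> x \<in> W \<and> (\<forall>y\<in>W. ?e x y < \<epsilon>)"
        using x pseudo_metric_onD(2)[OF p(1)] by (intro exI[of _ "{y \<in> topspace X. ?e x y < \<epsilon>}"]) auto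
    qed
  next
    assume e: "?e \<in> cont_pmetrics X"
    show "e \<in> cont_pmetrics (quotient_space X E)"
    proof (rule cont_pmetricsI)
      show p: "pseudo_metric_on (topspace (quotient_space X E)) e" "bounded_dist_on (topspace (quotient_space X E)) e"
        using cont_pmetricsD[OF e] by (simp_all add: topspace_quotient_space pm)
      fix Q and \<epsilon> :: real assume Q: "Q \<in> topspace (quotient_space X E)" "0 < \<epsilon>"
      then obtain x where x: "x \<in> topspace X" "Q = E `` {x}"
        by (auto simp: topspace_quotient_space quotient_def)
      have "openin (quotient_space X E) {R \<in> topspace X // E. e Q R < \<epsilon>}"
        using openin_pmetric_ball[OF e x(1), of \<epsilon>] pre[of x \<epsilon>] x(2) by simp
      then show "\<exists>W. openin (quotient_space X E) W \<and> Q \<in> W \<and> (\<forall>y\<in>W. e Q y < \<epsilon>)"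
        using Q pseudo_metric_onD(2)[OF p(1) Q(1) Q(1)]
        by (intro exI[of _ "{R \<in> topspace X // E. e Q R < \<epsilon>}"]) (auto simp: topspace_quotient_space)
    qed
  qed
qed

text \<open>The representatives are arbitrary; for a pseudo-metric vanishing on the equivalence
  relation the value does not depend on them.\<close>

definition quotient_dist :: "('a \<Rightarrow> 'a \<Rightarrow> real) \<Rightarrow> 'a set \<Rightarrow> 'a set \<Rightarrow> real" where
  "quotient_dist d P Q = d (SOME p. p \<in> P) (SOME q. q \<in> Q)"

lemma quotient_dist_eq:
  assumes E: "equiv S E" and d: "pseudo_metric_on S d" and zero: "\<And>x y. (x, y) \<in> E \<Longrightarrow> d x y = 0"
    and S: "x \<in> S" "y \<in> S"
  shows "quotient_dist d (E `` {x}) (E `` {y}) = d x y"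
proof -
  define p q where "p = (SOME p. p \<in> E `` {x})" and "q = (SOME q. q \<in> E `` {y})"
  have p: "(x, p) \<in> E" unfolding p_def
    using someI[of "\<lambda>p. p \<in> E `` {x}" x] equiv_class_self[OF E S(1)] by blast
  have q: "(y, q) \<in> E" unfolding q_def
    using someI[of "\<lambda>q. q \<in> E `` {y}" y] equiv_class_self[OF E S(2)] by blast
  have S': "p \<in> S" "q \<in> S" using E p q by (auto simp: equiv_def refl_on_def)
  have "d x p = 0" "d y q = 0" "d p x = 0" "d q y = 0"
    using zero p q pseudo_metric_onD(3)[OF d] S S' by metis+
  moreover have "d x y \<le> d x p + d p y" "d p y \<le> d p q + d q y" "d p q \<le> d p x + d x q" "d x q \<le> d x y + d y q"
    using pseudo_metric_onD(4)[OF d] S S' by blast+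
  ultimately show ?thesis unfolding quotient_dist_def p_def[symmetric] q_def[symmetric] by linarith
qed

lemma quotient_dist_comp:
  assumes "equiv S E" "pseudo_metric_on S d" "\<And>x y. (x, y) \<in> E \<Longrightarrow> d x y = 0"
  shows "restrict (\<lambda>(x, y). quotient_dist d (E `` {x}) (E `` {y})) (S \<times> S) = restrict (\<lambda>(x, y). d x y) (S \<times> S)"
  using quotient_dist_eq[OF assms] by (auto intro: restrict_ext)

lemma cont_pmetrics_cong:
  assumes "d \<in> cont_pmetrics X" "\<And>x y. x \<in> topspace X \<Longrightarrow> y \<in> topspace X \<Longrightarrow> e x y = d x y"
  shows "e \<in> cont_pmetrics X"
proof (rule cont_pmetrics_dominated[OF assms(1)])
  show "pseudo_metric_on (topspace X) e"
    using cont_pmetricsD(1)[OF assms(1)] assms(2) by (simp add: pseudo_metric_on_def)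
qed (simp add: assms(2))

lemma quotient_dist_cont_pmetrics:
  assumes E: "equiv (topspace X) E" and d: "d \<in> cont_pmetrics X" and zero: "\<And>x y. (x, y) \<in> E \<Longrightarrow> d x y = 0"
  shows "quotient_dist d \<in> cont_pmetrics (quotient_space X E)"
  unfolding cont_pmetrics_quotient_iff
  by (rule cont_pmetrics_cong[OF d]) (rule quotient_dist_eq[OF E cont_pmetricsD(1)[OF d] zero])

lemma quotient_dist_ultrametric:
  assumes E: "equiv S E" and u: "pseudo_ultrametric_on S d" and zero: "\<And>x y. (x, y) \<in> E \<Longrightarrow> d x y = 0"
  shows "pseudo_ultrametric_on (S // E) (quotient_dist d)"
proof -
  have eq: "quotient_dist d (E `` {x}) (E `` {y}) = d x y" if "x \<in> S" "y \<in> S" for x y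
    using quotient_dist_eq[OF E _ zero] u that by (simp add: pseudo_ultrametric_on_def)
  have "pseudo_ultrametric_on (S // E) (quotient_dist d) \<longleftrightarrow> pseudo_ultrametric_on S d"
    unfolding pseudo_ultrametric_on_def pseudo_metric_on_def ball_quotient_iff
    by (simp only: eq cong: ball_cong)
  then show ?thesis using u by blast
qed

lemma projects_to_gageI:
  assumes E: "equiv (topspace X) E"
    and D: "\<And>d. d \<in> D \<Longrightarrow> d \<in> cont_pmetrics X \<and> (\<forall>(x, y)\<in>E. d x y = 0)"
    and to: "\<And>d. d \<in> D \<Longrightarrow> quotient_dist d \<in> \<Gamma>"
    and \<Gamma>: "\<And>e. e \<in> \<Gamma> \<Longrightarrow> e \<in> cont_pmetrics (quotient_space X E)"
    and ret: "\<And>e. e \<in> \<Gamma> \<Longrightarrow> \<exists>d\<in>D. \<forall>x\<in>topspace X. \<forall>y\<in>topspace X. d x y = e (E `` {x}) (E `` {y})"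
  shows "projects_to_gage X E D \<Gamma>"
  unfolding projects_to_gage_def
proof (intro equalityI subsetI; elim imageE)
  fix r d assume r: "r = restrict (\<lambda>(x, y). d x y) (topspace X \<times> topspace X)" and d: "d \<in> D"
  have "r = restrict (\<lambda>(x, y). quotient_dist d (E `` {x}) (E `` {y})) (topspace X \<times> topspace X)"
    unfolding r using D[OF d] cont_pmetricsD(1)[of d X] by (intro quotient_dist_comp[OF E, symmetric]) auto
  then show "r \<in> (\<lambda>e. restrict (\<lambda>(x, y). e (E `` {x}) (E `` {y})) (topspace X \<times> topspace X)) ` \<Gamma>"
    using to[OF d] by blast
next
  fix r e assume r: "r = restrict (\<lambda>(x, y). e (E `` {x}) (E `` {y})) (topspace X \<times> topspace X)" and e: "e \<in> \<Gamma>"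
  obtain d where d: "d \<in> D" "\<forall>x\<in>topspace X. \<forall>y\<in>topspace X. d x y = e (E `` {x}) (E `` {y})"
    using ret[OF e] by blast
  then have "r = restrict (\<lambda>(x, y). d x y) (topspace X \<times> topspace X)"
    unfolding r by (intro restrict_ext) auto
  then show "r \<in> (\<lambda>d. restrict (\<lambda>(x, y). d x y) (topspace X \<times> topspace X)) ` D"
    using d(1) by blast
qed

text \<open>An intersection of zero sets of continuous functions. The operator \<open>b\<close>
  stands for either barrier construction, here and in the next lemmas.\<close>

lemma closed_rel_zero_set:
  assumes "\<And>d. d \<in> cont_pmetrics X \<Longrightarrow> b d \<in> cont_pmetrics X"
    and "E = {(x, y) \<in> topspace X \<times> topspace X. \<forall>d\<in>cont_pmetrics X. b d x y = (0::real)}"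
  shows "closed_rel X E"
proof -
  have "E = (\<Inter>d\<in>cont_pmetrics X. {p \<in> topspace (prod_topology X X). (\<lambda>(x, y). b d x y) p \<in> {0}})"
    using assms(2) zero_in_cont_pmetrics by auto
  moreover have "closedin (prod_topology X X) {p \<in> topspace (prod_topology X X). (\<lambda>(x, y). b d x y) p \<in> {0}}"
    if "d \<in> cont_pmetrics X" for d
    using assms(1)[OF that] by (intro closedin_continuous_map_preimage[of _ euclideanreal]) (auto simp: cont_pmetrics_def)
  ultimately show ?thesis
    using zero_in_cont_pmetrics[of X] unfolding closed_rel_def by (metis (no_types, lifting) closedin_INT empty_iff)
qed

text \<open>The separating function is the distance to the class of \<open>x\<close>, for a barrier
  function that does not vanish at \<open>(x, y)\<close>.\<close>

lemma completely_Hausdorff_quotient: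
  assumes E: "equiv (topspace X) E"
    and b: "\<And>d. d \<in> cont_pmetrics X \<Longrightarrow> b d \<in> cont_pmetrics X"
    and eq: "E = {(x, y) \<in> topspace X \<times> topspace X. \<forall>d\<in>cont_pmetrics X. b d x y = (0::real)}"
  shows "completely_Hausdorff_space (quotient_space X E)"
  unfolding completely_Hausdorff_space_def topspace_quotient_space ball_quotient_iff
proof (intro ballI impI)
  fix x y assume xy: "x \<in> topspace X" "y \<in> topspace X" "E `` {x} \<noteq> E `` {y}"
  then have "(x, y) \<notin> E" using equiv_class_eq[OF E] by blast
  then obtain d where d: "d \<in> cont_pmetrics X" "b d x y \<noteq> 0" using xy eq by blast
  have zero: "b d x y = 0" if "(x, y) \<in> E" for x y using that eq d by blast
  note q = quotient_dist_eq[OF E cont_pmetricsD(1)[OF b[OF d(1)]] zero xy(1)]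
  have "bounded_cont_fun (quotient_space X E) (quotient_dist (b d) (E `` {x}))"
    by (rule cont_pmetrics_bounded_cont_fun[OF quotient_dist_cont_pmetrics[OF E b[OF d(1)] zero]])
      (simp_all add: topspace_quotient_space quotientI xy)
  moreover have "b d x x = 0" using pseudo_metric_onD(2)[OF cont_pmetricsD(1)[OF b[OF d(1)]]] xy by blast
  ultimately show "\<exists>g. bounded_cont_fun (quotient_space X E) g \<and> g (E `` {x}) \<noteq> g (E `` {y})"
    using d(2) q xy by (intro exI[of _ "quotient_dist (b d) (E `` {x})"]) auto
qed

lemma totally_disconnected_quotient:
  assumes E: "equiv (topspace X) E"
    and b: "\<And>d. d \<in> cont_pmetrics X \<Longrightarrow> b d \<in> cont_pmetrics X"
    and u: "\<And>d. d \<in> cont_pmetrics X \<Longrightarrow> pseudo_ultrametric_on (topspace X) (b d)"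
    and eq: "E = {(x, y) \<in> topspace X \<times> topspace X. \<forall>d\<in>cont_pmetrics X. b d x y = (0::real)}"
  shows "totally_disconnected_space (quotient_space X E)"
  unfolding totally_disconnected_space_def topspace_quotient_space ball_quotient_iff
proof (intro ballI equalityI subsetI)
  fix x Q assume x: "x \<in> topspace X" and Q: "Q \<in> \<Inter>{C. clopenin (quotient_space X E) C \<and> E `` {x} \<in> C}"
  let ?Y = "quotient_space X E"
  have "clopenin ?Y (topspace ?Y)" by (simp add: clopenin_def)
  moreover have "E `` {x} \<in> topspace ?Y" using x by (simp add: topspace_quotient_space quotientI)
  ultimately have "Q \<in> topspace ?Y" using Q by blast
  then obtain y where y: "y \<in> topspace X" "Q = E `` {y}" by (auto simp: topspace_quotient_space quotient_def)
  show "Q \<in> {E `` {x}}"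
  proof (rule ccontr)
    assume "Q \<notin> {E `` {x}}"
    then have "(x, y) \<notin> E" using equiv_class_eq[OF E] y by blast
    then obtain d where d: "d \<in> cont_pmetrics X" "b d x y \<noteq> 0" using x y eq by blast
    have zero: "b d x y = 0" if "(x, y) \<in> E" for x y using that eq d by blast
    note pm = cont_pmetricsD(1)[OF b[OF d(1)]]
    note q = quotient_dist_eq[OF E pm zero x]
    have pos: "0 < b d x y" "b d x x = 0"
      using d(2) pseudo_metric_onD(1,2)[OF pm] x y(1) by (metis less_eq_real_def)+
    \<comment> \<open>The radius is the distance of the two classes itself, so the strict ball about
      the class of \<open>x\<close> just excludes that of \<open>y\<close>; being an ultrametric
      ball it is clopen.\<close>
    define K where "K = {R \<in> topspace ?Y. quotient_dist (b d) (E `` {x}) R < b d x y}"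
    have "clopenin ?Y K" unfolding K_def
    proof (rule clopenin_ultrametric_ball)
      show "quotient_dist (b d) \<in> cont_pmetrics ?Y"
        by (rule quotient_dist_cont_pmetrics[OF E b[OF d(1)] zero])
      show "pseudo_ultrametric_on (topspace ?Y) (quotient_dist (b d))"
        unfolding topspace_quotient_space by (rule quotient_dist_ultrametric[OF E u[OF d(1)] zero])
    qed (simp add: topspace_quotient_space quotientI x)
    moreover have "E `` {x} \<in> K" "Q \<notin> K"
      using q x y pos by (auto simp: K_def topspace_quotient_space quotientI)
    ultimately show False using Q by blast
  qed
next
  fix x Q assume "Q \<in> {E `` {x}}"
  then show "Q \<in> \<Inter>{C. clopenin (quotient_space X E) C \<and> E `` {x} \<in> C}" by blast
qed

section \<open>Minimality of the barrier relations\<close>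

lemma A_rel_least:
  assumes X: "completely_regular_space X" and E: "equiv (topspace X) E" "f \<subseteq> E"
    and cH: "completely_Hausdorff_space (quotient_space X E)"
  shows "A_rel (topspace X) (max_uniformity X) f \<subseteq> E"
proof clarify
  fix x y assume xy: "(x, y) \<in> A_rel (topspace X) (max_uniformity X) f"
  then have S: "x \<in> topspace X" "y \<in> topspace X" by (auto simp: A_rel_def)
  show "(x, y) \<in> E"
  proof (rule ccontr)
    assume "(x, y) \<notin> E"
    then have "E `` {x} \<noteq> E `` {y}" using eq_equiv_class[OF _ E(1) S(2)] by blast
    then obtain g where g: "bounded_cont_fun (quotient_space X E) g" "g (E `` {x}) \<noteq> g (E `` {y})"
      using cH S unfolding completely_Hausdorff_space_def topspace_quotient_space by (meson quotientI)
    have h: "bounded_cont_fun X (\<lambda>x. g (E `` {x}))" by (rule bounded_cont_fun_quotient[OF g(1)])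
    \<comment> \<open>A function lifted from the quotient is constant along \<open>f\<close>, so it
      and its negative are both monotone; together they force equal values on pairs of
      \<open>A_rel\<close>.\<close>
    then have h': "bounded_cont_fun X (\<lambda>x. - g (E `` {x}))"
      unfolding bounded_cont_fun_def by (auto simp: bounded_iff intro: continuous_intros)
    have "g (E `` {a}) = g (E `` {b})" if "(a, b) \<in> f" for a b
      using that E equiv_class_eq[OF E(1)] by (metis subsetD)
    then have "g (E `` {x}) \<le> g (E `` {y})" "- g (E `` {x}) \<le> - g (E `` {y})"
      using A_rel_monotone[OF X h _ xy] A_rel_monotone[OF X h' _ xy] by auto
    with g(2) show False by simp
  qed
qed

lemma C_rel_least:
  assumes X: "completely_regular_space X" and E: "equiv (topspace X) E" "f \<subseteq> E"
    and td: "totally_disconnected_space (quotient_space X E)"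
  shows "C_rel (topspace X) (max_uniformity X) f \<subseteq> E"
proof clarify
  fix x y assume xy: "(x, y) \<in> C_rel (topspace X) (max_uniformity X) f"
  then have S: "x \<in> topspace X" "y \<in> topspace X" by (auto simp: C_rel_def)
  show "(x, y) \<in> E"
  proof (rule ccontr)
    assume "(x, y) \<notin> E"
    then have "E `` {y} \<notin> {E `` {x}}" using eq_equiv_class[OF _ E(1) S(2)] by blast
    moreover have "\<Inter>{C. clopenin (quotient_space X E) C \<and> E `` {x} \<in> C} = {E `` {x}}"
      using td S unfolding totally_disconnected_space_def topspace_quotient_space by (meson quotientI)
    ultimately have "E `` {y} \<notin> \<Inter>{C. clopenin (quotient_space X E) C \<and> E `` {x} \<in> C}" by simp
    then obtain K where K: "clopenin (quotient_space X E) K" "E `` {x} \<in> K" "E `` {y} \<notin> K" by blast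
    have "a \<in> {x \<in> topspace X. E `` {x} \<in> K} \<longleftrightarrow> b \<in> {x \<in> topspace X. E `` {x} \<in> K}" if "(a, b) \<in> f" for a b
    proof -
      have ab: "(a, b) \<in> E" using that E by blast
      then show ?thesis using E(1) equiv_class_eq[OF E(1) ab] by (auto simp: equiv_def refl_on_def)
    qed
    from C_rel_clopen[OF X clopenin_quotient[OF K(1)] this xy] show False using K S by blast
  qed
qed

lemma closed_rel_G_rel: "closed_rel X (G_rel X f)" if "f \<subseteq> topspace X \<times> topspace X"
proof -
  have "topspace X \<times> topspace X \<in> {R. closed_rel X R \<and> trans R \<and> f \<subseteq> R}"
    using that closedin_topspace[of "prod_topology X X"] by (auto simp: closed_rel_def trans_def)
  then show ?thesis unfolding closed_rel_def G_rel_def by (intro closedin_Inter) (auto simp: closed_rel_def)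
qed

lemma subset_G_rel: "f \<subseteq> G_rel X f"
  by (auto simp: G_rel_def)

lemma trans_G_rel: "trans (G_rel X f)"
  unfolding G_rel_def trans_def by blast

lemma G_rel_least: "closed_rel X R \<Longrightarrow> trans R \<Longrightarrow> f \<subseteq> R \<Longrightarrow> G_rel X f \<subseteq> R"
  by (auto simp: G_rel_def)

section \<open>Closed preorders on sums of exhaustible pieces\<close>

text \<open>The interior is taken in \<open>X\<close>, so \<open>P\<close> is open, and a set built
  in stages is open as soon as each stage has a neighbourhood whose trace on
  \<open>K (Suc n)\<close> lies in the next stage.\<close>

definition compact_exhaustion :: "'a topology \<Rightarrow> (nat \<Rightarrow> 'a set) \<Rightarrow> 'a set \<Rightarrow> bool" where
  "compact_exhaustion X K P \<longleftrightarrow>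
     (\<forall>n. compactin X (K n) \<and> K n \<subseteq> X interior_of K (Suc n)) \<and> (\<Union>n. K n) = P"

text \<open>Uncountably many pieces are allowed, which covers spaces that are not sigma-compact;
  constructions are carried out in each piece and then united.\<close>

definition exhaustible_partition :: "'a topology \<Rightarrow> 'a set set \<Rightarrow> bool" where
  "exhaustible_partition X \<P> \<longleftrightarrow>
     \<Union>\<P> = topspace X \<and> pairwise disjnt \<P> \<and> (\<forall>P\<in>\<P>. \<exists>K. compact_exhaustion X K P)"

lemma exhaustible_partitionD:
  assumes "exhaustible_partition X \<P>"
  shows "\<Union>\<P> = topspace X" and "P \<in> \<P> \<Longrightarrow> \<exists>K. compact_exhaustion X K P"
    and "P \<in> \<P> \<Longrightarrow> Q \<in> \<P> \<Longrightarrow> x \<in> P \<Longrightarrow> x \<in> Q \<Longrightarrow> P = Q"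
  using assms unfolding exhaustible_partition_def pairwise_def disjnt_iff by blast+

lemma compact_exhaustion_mono: "compact_exhaustion X K P \<Longrightarrow> m \<le> n \<Longrightarrow> K m \<subseteq> K n"
  unfolding compact_exhaustion_def by (rule lift_Suc_mono_le[of K]) (meson interior_of_subset subset_trans)

lemma compact_exhaustion_open:
  assumes "compact_exhaustion X K P" shows "openin X P"
proof -
  have "P = (\<Union>n. X interior_of K n)"
  proof (intro equalityI UN_least)
    show "P \<subseteq> (\<Union>n. X interior_of K n)" using assms unfolding compact_exhaustion_def by blast
    show "X interior_of K n \<subseteq> P" for n
      using assms interior_of_subset[of X "K n"] unfolding compact_exhaustion_def by blast
  qed
  then show ?thesis by auto
qed

lemma exhaustible_partition_clopen:
  assumes "exhaustible_partition X \<P>" "P \<in> \<P>" shows "clopenin X P"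
proof -
  have op: "openin X Q" if "Q \<in> \<P>" for Q
    using exhaustible_partitionD(2)[OF assms(1) that] compact_exhaustion_open by blast
  have "topspace X - P = \<Union>(\<P> - {P})"
  proof (intro equalityI subsetI)
    fix x assume "x \<in> topspace X - P"
    then show "x \<in> \<Union>(\<P> - {P})" using exhaustible_partitionD(1)[OF assms(1)] by auto
  next
    fix x assume "x \<in> \<Union>(\<P> - {P})"
    then obtain Q where "Q \<in> \<P>" "Q \<noteq> P" "x \<in> Q" by blast
    then show "x \<in> topspace X - P" using exhaustible_partitionD[OF assms(1)] assms(2) by blast
  qed
  moreover have "openin X (\<Union>(\<P> - {P}))" using op by blast
  ultimately show ?thesis
    using op[OF assms(2)] openin_subset[OF op[OF assms(2)]] by (simp add: clopenin_def closedin_def)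
qed

section \<open>Closed relations and compact sets\<close>

lemma closed_rel_converse:
  assumes "closed_rel X R" shows "closed_rel X (R\<inverse>)"
proof -
  have "continuous_map (prod_topology X X) (prod_topology X X) (\<lambda>p. (snd p, fst p))"
    by (simp add: continuous_map_pairwise o_def continuous_map_fst continuous_map_snd)
  then have "closedin (prod_topology X X) {p \<in> topspace (prod_topology X X). (snd p, fst p) \<in> R}"
    using assms unfolding closed_rel_def by (rule closedin_continuous_map_preimage)
  moreover have "{p \<in> topspace (prod_topology X X). (snd p, fst p) \<in> R} = R\<inverse>"
    using closedin_subset[OF assms[unfolded closed_rel_def]] by auto
  ultimately show ?thesis by (simp add: closed_rel_def)
qed

text \<open>The tube lemma for a compact rectangle inside the open complement of
  \<open>R\<close>.\<close>

lemma closed_rel_separate_compact: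
  assumes R: "closed_rel X R" and C: "compactin X C" "compactin X D" and CD: "R \<inter> C \<times> D = {}"
  obtains G H where "openin X G" "openin X H" "C \<subseteq> G" "D \<subseteq> H" "R \<inter> G \<times> H = {}"
proof -
  have "openin (prod_topology X X) (topspace (prod_topology X X) - R)"
    by (rule openin_diff[OF openin_topspace R[unfolded closed_rel_def]])
  moreover have "C \<times> D \<subseteq> topspace (prod_topology X X) - R"
    using C CD compactin_subset_topspace by fastforce
  ultimately obtain G H where "openin X G" "openin X H" "C \<subseteq> G" "D \<subseteq> H"
      "G \<times> H \<subseteq> topspace (prod_topology X X) - R"
    using Wallace_theorem_prod_topology[OF C] by metis
  then show thesis using that[of G H] by blast
qed

lemma closedin_Image_compact:
  assumes R: "closed_rel X R" and C: "compactin X C"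
  shows "closedin X (R `` C)"
proof -
  have RS: "R \<subseteq> topspace X \<times> topspace X"
    using closedin_subset[OF R[unfolded closed_rel_def]] by simp
  have "\<exists>H. openin X H \<and> y \<in> H \<and> H \<subseteq> topspace X - R `` C" if y: "y \<in> topspace X - R `` C" for y
  proof -
    have "R \<inter> C \<times> {y} = {}" using y by blast
    then obtain G H where "openin X G" "openin X H" "C \<subseteq> G" "{y} \<subseteq> H" "R \<inter> G \<times> H = {}"
      using closed_rel_separate_compact[OF R C, of "{y}"] y by auto
    then show ?thesis using openin_subset[of X H] by (intro exI[of _ H]) blast
  qed
  then have "openin X (topspace X - R `` C)" by (subst openin_subopen) blast
  then show ?thesis using RS unfolding closedin_def by blast
qed

lemma closedin_Image_singleton:
  assumes "closed_rel X R" "x \<in> topspace X" shows "closedin X (R `` {x})"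
  using assms by (intro closedin_Image_compact) auto

lemma regular_shrink:
  assumes X: "regular_space X" and C: "compactin X C" and G: "openin X G" "C \<subseteq> G"
  obtains O1 D where "openin X O1" "closedin X D" "C \<subseteq> O1" "O1 \<subseteq> D" "D \<subseteq> G"
proof -
  have "closedin X (topspace X - G)" "disjnt C (topspace X - G)" using G by (auto simp: disjnt_iff)
  from regular_space_compact_closed_separation[OF X C this]
  obtain U V where UV: "openin X U" "openin X V" "C \<subseteq> U" "topspace X - G \<subseteq> V" "disjnt U V"
    by blast
  show thesis
  proof
    show "closedin X (topspace X - V)" using UV by blast
    show "U \<subseteq> topspace X - V" using UV(5) openin_subset[OF UV(1)] by (auto simp: disjnt_iff)
    show "topspace X - V \<subseteq> G" using UV by blast
  qed (use UV in auto)
qed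

text \<open>Closed neighbourhoods of \<open>C\<close> and \<open>D\<close> inside unrelated open
  sets are cut down to \<open>L\<close> and saturated there; images of compact sets under
  \<open>R\<close> are closed, so the results stay compact. Transitivity would carry a related pair
  of the saturations back to the unrelated open sets. The last two conclusions leave the room that
  makes the later union open.\<close>

lemma order_separation_step:
  assumes X: "regular_space X" and R: "closed_rel X R" "refl_on (topspace X) R" "trans R"
    and L: "compactin X L" and C: "compactin X C" "compactin X D" and CD: "R \<inter> C \<times> D = {}"
  obtains U V where "compactin X U" "compactin X V" "U \<subseteq> L" "V \<subseteq> L"
    "R `` U \<inter> L \<subseteq> U" "R\<inverse> `` V \<inter> L \<subseteq> V" "R \<inter> U \<times> V = {}"
    "\<exists>G. openin X G \<and> C \<subseteq> G \<and> G \<inter> L \<subseteq> U" "\<exists>H. openin X H \<and> D \<subseteq> H \<and> H \<inter> L \<subseteq> V"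
proof -
  obtain G H where GH: "openin X G" "openin X H" "C \<subseteq> G" "D \<subseteq> H" "R \<inter> G \<times> H = {}"
    using closed_rel_separate_compact[OF R(1) C CD] .
  obtain G1 G2 where G: "openin X G1" "closedin X G2" "C \<subseteq> G1" "G1 \<subseteq> G2" "G2 \<subseteq> G"
    using regular_shrink[OF X C(1) GH(1,3)] .
  obtain H1 H2 where H: "openin X H1" "closedin X H2" "D \<subseteq> H1" "H1 \<subseteq> H2" "H2 \<subseteq> H"
    using regular_shrink[OF X C(2) GH(2,4)] .
  define U V where "U = R `` (G2 \<inter> L) \<inter> L" and "V = R\<inverse> `` (H2 \<inter> L) \<inter> L"
  have LS: "L \<subseteq> topspace X" using L by (rule compactin_subset_topspace)
  have refl: "(x, x) \<in> R" if "x \<in> L" for x using that LS R(2) by (auto simp: refl_on_def)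
  show thesis
  proof
    show "compactin X U" unfolding U_def
      by (intro closed_Int_compactin closedin_Image_compact R L G)
    show "compactin X V" unfolding V_def
      by (intro closed_Int_compactin closedin_Image_compact closed_rel_converse R L H)
    show "R `` U \<inter> L \<subseteq> U" "R\<inverse> `` V \<inter> L \<subseteq> V"
      unfolding U_def V_def using R(3) by (blast dest: transD)+
    show "R \<inter> U \<times> V = {}"
    proof (rule equals0I, clarify)
      fix u v assume "(u, v) \<in> R" "u \<in> U" "v \<in> V"
      then obtain g h where "(g, u) \<in> R" "g \<in> G2" "(v, h) \<in> R" "h \<in> H2"
        unfolding U_def V_def by blast
      with \<open>(u, v) \<in> R\<close> have "(g, h) \<in> R" "g \<in> G" "h \<in> H" using R(3) G H by (blast dest: transD)+
      then show False using GH(5) by blast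
    qed
    show "\<exists>G. openin X G \<and> C \<subseteq> G \<and> G \<inter> L \<subseteq> U"
      using G refl unfolding U_def by (intro exI[of _ G1]) blast
    show "\<exists>H. openin X H \<and> D \<subseteq> H \<and> H \<inter> L \<subseteq> V"
      using H refl unfolding V_def by (intro exI[of _ H1]) blast
  qed (auto simp: U_def V_def)
qed

text \<open>Stage \<open>n\<close> is a compact pair inside \<open>K n\<close>, an up-set and a
  down-set relative to \<open>K n\<close>. The next stage separates these sets enlarged by the parts
  of \<open>A\<close> and \<open>B\<close> in \<open>K (Suc n)\<close>, and the unions over all
  stages are the sets sought.\<close>

lemma order_separation_piece:
  assumes X: "regular_space X" and R: "closed_rel X R" "refl_on (topspace X) R" "trans R"
    and K: "compact_exhaustion X K P" and P: "R `` P \<subseteq> P" "R\<inverse> `` P \<subseteq> P"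
    and A: "closedin X A" "R `` A \<subseteq> A" and B: "closedin X B" "R\<inverse> `` B \<subseteq> B" and AB: "A \<inter> B = {}"
  obtains U V where "openin X U" "openin X V" "A \<inter> P \<subseteq> U" "B \<inter> P \<subseteq> V" "U \<subseteq> P" "V \<subseteq> P"
    "R `` U \<subseteq> U" "R\<inverse> `` V \<subseteq> V" "U \<inter> V = {}"
proof -
  have Kc: "compactin X (K n)" and Ki: "K n \<subseteq> X interior_of K (Suc n)" and KP: "(\<Union>n. K n) = P" for n
    using K by (auto simp: compact_exhaustion_def)
  \<comment> \<open>No point of \<open>U\<close> may be related to a point of \<open>V\<close>: this
    is stronger than disjointness and is exactly the input of the next separation step.\<close>
  define inv where "inv n UV \<longleftrightarrow> (case UV of (U, V) \<Rightarrow> compactin X U \<and> compactin X V \<and> U \<subseteq> K n \<and> V \<subseteq> K n \<and>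
      A \<inter> K n \<subseteq> U \<and> B \<inter> K n \<subseteq> V \<and> R `` U \<inter> K n \<subseteq> U \<and> R\<inverse> `` V \<inter> K n \<subseteq> V \<and> R \<inter> U \<times> V = {})" for n UV
  define step where "step n UV UV' \<longleftrightarrow> (case UV of (U, V) \<Rightarrow> case UV' of (U', V') \<Rightarrow>
      (\<exists>G. openin X G \<and> U \<subseteq> G \<and> G \<inter> K (Suc n) \<subseteq> U') \<and> (\<exists>H. openin X H \<and> V \<subseteq> H \<and> H \<inter> K (Suc n) \<subseteq> V'))" for n UV UV'
  have cAB: "compactin X (A \<inter> K n)" "compactin X (B \<inter> K n)" for n
    by (intro closed_Int_compactin A B Kc)+
  have RAB: "R \<inter> (A \<inter> K n) \<times> (B \<inter> K n) = {}" for n using A(2) AB by blast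
  have "\<exists>UV. inv 0 UV"
  proof -
    obtain U V where UV: "compactin X U" "compactin X V" "U \<subseteq> K 0" "V \<subseteq> K 0"
        "R `` U \<inter> K 0 \<subseteq> U" "R\<inverse> `` V \<inter> K 0 \<subseteq> V" "R \<inter> U \<times> V = {}"
        "\<exists>G. openin X G \<and> A \<inter> K 0 \<subseteq> G \<and> G \<inter> K 0 \<subseteq> U" "\<exists>H. openin X H \<and> B \<inter> K 0 \<subseteq> H \<and> H \<inter> K 0 \<subseteq> V"
      using order_separation_step[OF X R Kc cAB RAB] .
    then have "A \<inter> K 0 \<subseteq> U" "B \<inter> K 0 \<subseteq> V" by blast+
    with UV show ?thesis unfolding inv_def by (intro exI[of _ "(U, V)"]) simp
  qed
  moreover have "\<exists>UV'. inv (Suc n) UV' \<and> step n UV UV'" if inv: "inv n UV" for n UV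
  proof -
    obtain U V where UV: "UV = (U, V)" by (cases UV)
    have i: "compactin X U" "compactin X V" "U \<subseteq> K n" "V \<subseteq> K n" "A \<inter> K n \<subseteq> U" "B \<inter> K n \<subseteq> V"
      "R `` U \<inter> K n \<subseteq> U" "R\<inverse> `` V \<inter> K n \<subseteq> V" "R \<inter> U \<times> V = {}"
      using inv unfolding inv_def UV by simp_all
    let ?C = "U \<union> (A \<inter> K (Suc n))" and ?D = "V \<union> (B \<inter> K (Suc n))"
    have refl: "(x, x) \<in> R" if "x \<in> K n" for x
      using that compactin_subset_topspace[OF Kc] R(2) by (auto simp: refl_on_def)
    have "U \<inter> B = {}" "V \<inter> A = {}" using i refl by blast+
    \<comment> \<open>A pair from \<open>U\<close> to \<open>B\<close> would put its source into
      \<open>B\<close>, a down-set, and a pair from \<open>A\<close> to \<open>V\<close> its target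
      into \<open>A\<close>, an up-set; both contradict the disjointness just shown.\<close>
    then have "R \<inter> ?C \<times> ?D = {}" using i(9) A(2) B(2) AB by blast
    moreover have "compactin X ?C" "compactin X ?D" by (intro compactin_Un i cAB)+
    ultimately obtain U' V' where UV': "compactin X U'" "compactin X V'" "U' \<subseteq> K (Suc n)" "V' \<subseteq> K (Suc n)"
        "R `` U' \<inter> K (Suc n) \<subseteq> U'" "R\<inverse> `` V' \<inter> K (Suc n) \<subseteq> V'" "R \<inter> U' \<times> V' = {}"
        "\<exists>G. openin X G \<and> ?C \<subseteq> G \<and> G \<inter> K (Suc n) \<subseteq> U'" "\<exists>H. openin X H \<and> ?D \<subseteq> H \<and> H \<inter> K (Suc n) \<subseteq> V'"
      using order_separation_step[OF X R Kc, of ?C ?D] by metis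
    obtain G H where GH: "openin X G" "?C \<subseteq> G" "G \<inter> K (Suc n) \<subseteq> U'"
        "openin X H" "?D \<subseteq> H" "H \<inter> K (Suc n) \<subseteq> V'" using UV'(8,9) by (elim exE conjE)
    have "A \<inter> K (Suc n) \<subseteq> U'" "B \<inter> K (Suc n) \<subseteq> V'" "U \<subseteq> G" "V \<subseteq> H" using GH(2,3,5,6) by blast+
    with UV' have "inv (Suc n) (U', V')" by (simp add: inv_def)
    moreover have "step n UV (U', V')"
      using GH(1,3,4,6) \<open>U \<subseteq> G\<close> \<open>V \<subseteq> H\<close> unfolding step_def UV by auto
    ultimately show ?thesis by blast
  qed
  ultimately obtain UV where inv: "\<And>n. inv n (UV n)" and step: "\<And>n. step n (UV n) (UV (Suc n))"
    using dependent_nat_choice[of inv step] by metis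
  define U V where "U n = fst (UV n)" and "V n = snd (UV n)" for n
  have UV: "UV n = (U n, V n)" for n by (simp add: U_def V_def)
  have i: "U n \<subseteq> K n" "V n \<subseteq> K n" "A \<inter> K n \<subseteq> U n" "B \<inter> K n \<subseteq> V n"
    "R `` U n \<inter> K n \<subseteq> U n" "R\<inverse> `` V n \<inter> K n \<subseteq> V n" "R \<inter> U n \<times> V n = {}" for n
    using inv[of n] unfolding inv_def UV by simp_all
  have sU: "\<exists>G. openin X G \<and> U n \<subseteq> G \<and> G \<inter> K (Suc n) \<subseteq> U (Suc n)"
    and sV: "\<exists>G. openin X G \<and> V n \<subseteq> G \<and> G \<inter> K (Suc n) \<subseteq> V (Suc n)" for n
    using step[of n] unfolding step_def UV by simp_all
  have K_Suc: "K n \<subseteq> K (Suc n)" for n using compact_exhaustion_mono[OF K] by simp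
  \<comment> \<open>A point of stage \<open>n\<close> is interior to \<open>K (Suc n)\<close>, so
    the neighbourhood given by the step, cut with that interior, lies in stage
    \<open>Suc n\<close>.\<close>
  have opn: "openin X (\<Union>n. W n)"
    if W: "\<And>n. W n \<subseteq> K n" "\<And>n. \<exists>G. openin X G \<and> W n \<subseteq> G \<and> G \<inter> K (Suc n) \<subseteq> W (Suc n)" for W
  proof -
    have "\<exists>H. openin X H \<and> x \<in> H \<and> H \<subseteq> (\<Union>n. W n)" if x: "x \<in> W n" for x n
    proof -
      obtain G where G: "openin X G" "W n \<subseteq> G" "G \<inter> K (Suc n) \<subseteq> W (Suc n)" using W(2) by blast
      have "x \<in> X interior_of K (Suc n)" using x W(1) Ki by blast
      moreover have "G \<inter> X interior_of K (Suc n) \<subseteq> W (Suc n)"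
        using G(3) interior_of_subset[of X "K (Suc n)"] by blast
      ultimately show ?thesis using G x by (intro exI[of _ "G \<inter> X interior_of K (Suc n)"]) auto
    qed
    then show ?thesis by (subst openin_subopen) blast
  qed
  have mono: "W m \<subseteq> W n"
    if W: "\<And>n. W n \<subseteq> K n" "\<And>n. \<exists>G. openin X G \<and> W n \<subseteq> G \<and> G \<inter> K (Suc n) \<subseteq> W (Suc n)" "m \<le> n" for W m n
  proof (rule lift_Suc_mono_le[of W])
    fix n show "W n \<subseteq> W (Suc n)" using W(1)[of n] W(2)[of n] K_Suc[of n] by blast
  qed (rule that(3))
  \<comment> \<open>Stages are invariant only relative to \<open>K n\<close>; since they increase,
    it suffices to go to a stage whose \<open>K\<close> contains the target as well.\<close>
  have inval: "T `` (\<Union>n. W n) \<subseteq> (\<Union>n. W n)"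
    if W: "\<And>n. W n \<subseteq> K n" "\<And>n. \<exists>G. openin X G \<and> W n \<subseteq> G \<and> G \<inter> K (Suc n) \<subseteq> W (Suc n)"
      and T: "T `` P \<subseteq> P" "\<And>n. T `` W n \<inter> K n \<subseteq> W n" for W T
  proof clarify
    fix x y n assume xy: "(x, y) \<in> T" "x \<in> W n"
    then have "y \<in> P" using W(1) KP T(1) by blast
    then obtain m where m: "y \<in> K m" using KP by blast
    have "x \<in> W (max n m)" using mono[OF W, of n "max n m"] xy(2) by auto
    moreover have "y \<in> K (max n m)" using compact_exhaustion_mono[OF K, of m "max n m"] m by auto
    ultimately have "y \<in> W (max n m)" using T(2)[of "max n m"] xy(1) by blast
    then show "y \<in> (\<Union>n. W n)" by blast
  qed
  show thesis
  proof
    show "openin X (\<Union>n. U n)" by (rule opn[OF i(1) sU])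
    show "openin X (\<Union>n. V n)" by (rule opn[OF i(2) sV])
    show "A \<inter> P \<subseteq> (\<Union>n. U n)" unfolding KP[symmetric] using i(3) by blast
    show "B \<inter> P \<subseteq> (\<Union>n. V n)" unfolding KP[symmetric] using i(4) by blast
    show "(\<Union>n. U n) \<subseteq> P" unfolding KP[symmetric] using i(1) by blast
    show "(\<Union>n. V n) \<subseteq> P" unfolding KP[symmetric] using i(2) by blast
    show "R `` (\<Union>n. U n) \<subseteq> (\<Union>n. U n)" by (rule inval[OF i(1) sU P(1) i(5)])
    show "R\<inverse> `` (\<Union>n. V n) \<subseteq> (\<Union>n. V n)" by (rule inval[OF i(2) sV P(2) i(6)])
    show "(\<Union>n. U n) \<inter> (\<Union>n. V n) = {}"
    proof (rule equals0I, clarify)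
      fix x m n assume x: "x \<in> U m" "x \<in> V n"
      have "x \<in> U (max m n)" "x \<in> V (max m n)"
        using mono[OF i(1) sU, of m "max m n"] mono[OF i(2) sV, of n "max m n"] x by auto
      moreover have "(x, x) \<in> R"
        using x(1) i(1) compactin_subset_topspace[OF Kc] R(2) by (blast dest: refl_onD)
      ultimately show False using i(7) by blast
    qed
  qed
qed

text \<open>Nachbin's normality for a preordered space: closed up-sets and closed down-sets. For an
  equivalence relation both are the saturated closed sets, and the condition yields normality of the
  quotient.\<close>

definition order_normal :: "'a topology \<Rightarrow> ('a \<times> 'a) set \<Rightarrow> bool" where
  "order_normal X R \<longleftrightarrow> (\<forall>A B. closedin X A \<and> R `` A \<subseteq> A \<and> closedin X B \<and> R\<inverse> `` B \<subseteq> B \<and> A \<inter> B = {} \<longrightarrow>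
     (\<exists>U V. openin X U \<and> openin X V \<and> A \<subseteq> U \<and> B \<subseteq> V \<and> R `` U \<subseteq> U \<and> R\<inverse> `` V \<subseteq> V \<and> U \<inter> V = {}))"

lemma order_normal_exhaustible:
  assumes X: "regular_space X" and R: "closed_rel X R" "refl_on (topspace X) R" "trans R"
    and P: "exhaustible_partition X \<P>" "R \<subseteq> (\<Union>P\<in>\<P>. P \<times> P)"
  shows "order_normal X R"
  unfolding order_normal_def
proof (intro allI impI, elim conjE)
  fix A B assume A: "closedin X A" "R `` A \<subseteq> A" and B: "closedin X B" "R\<inverse> `` B \<subseteq> B" and AB: "A \<inter> B = {}"
  have disj: "P = Q" if "P \<in> \<P>" "Q \<in> \<P>" "x \<in> P" "x \<in> Q" for P Q x
    by (rule exhaustible_partitionD(3)[OF P(1) that])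
  have "\<exists>UV. openin X (fst UV) \<and> openin X (snd UV) \<and> A \<inter> P \<subseteq> fst UV \<and> B \<inter> P \<subseteq> snd UV \<and> fst UV \<subseteq> P \<and> snd UV \<subseteq> P \<and>
    R `` fst UV \<subseteq> fst UV \<and> R\<inverse> `` snd UV \<subseteq> snd UV \<and> fst UV \<inter> snd UV = {}" if p: "P \<in> \<P>" for P
  proof -
    obtain K where K: "compact_exhaustion X K P" using exhaustible_partitionD(2)[OF P(1) p] by blast
    have "R `` P \<subseteq> P" "R\<inverse> `` P \<subseteq> P" using P(2) disj p by blast+
    from order_separation_piece[OF X R K this A B AB] show ?thesis by (metis fst_conv snd_conv)
  qed
  then obtain UV where UV: "\<And>P. P \<in> \<P> \<Longrightarrow> openin X (fst (UV P)) \<and> openin X (snd (UV P)) \<and>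
    A \<inter> P \<subseteq> fst (UV P) \<and> B \<inter> P \<subseteq> snd (UV P) \<and> fst (UV P) \<subseteq> P \<and> snd (UV P) \<subseteq> P \<and>
    R `` fst (UV P) \<subseteq> fst (UV P) \<and> R\<inverse> `` snd (UV P) \<subseteq> snd (UV P) \<and> fst (UV P) \<inter> snd (UV P) = {}"
    by metis
  define U V where "U P = fst (UV P)" and "V P = snd (UV P)" for P
  have op: "openin X (U P)" "openin X (V P)"
    and cover: "A \<inter> P \<subseteq> U P" "B \<inter> P \<subseteq> V P"
    and sub: "U P \<subseteq> P" "V P \<subseteq> P"
    and inval: "R `` U P \<subseteq> U P" "R\<inverse> `` V P \<subseteq> V P"
    and disjoint: "U P \<inter> V P = {}" if "P \<in> \<P>" for P
    using UV[OF that] unfolding U_def V_def by simp_all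
  have cov: "A \<subseteq> \<Union>\<P>" "B \<subseteq> \<Union>\<P>"
    using closedin_subset[OF A(1)] closedin_subset[OF B(1)] exhaustible_partitionD(1)[OF P(1)] by blast+
  have "openin X (\<Union>P\<in>\<P>. U P)" "openin X (\<Union>P\<in>\<P>. V P)" using op by blast+
  moreover have "A \<subseteq> (\<Union>P\<in>\<P>. U P)" using cov(1) cover(1) by blast
  moreover have "B \<subseteq> (\<Union>P\<in>\<P>. V P)" using cov(2) cover(2) by blast
  moreover have "R `` (\<Union>P\<in>\<P>. U P) \<subseteq> (\<Union>P\<in>\<P>. U P)" using inval(1) by blast
  moreover have "R\<inverse> `` (\<Union>P\<in>\<P>. V P) \<subseteq> (\<Union>P\<in>\<P>. V P)" using inval(2) by blast
  moreover have "(\<Union>P\<in>\<P>. U P) \<inter> (\<Union>P\<in>\<P>. V P) = {}"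
  proof (rule equals0I, clarify)
    fix x P Q assume x: "P \<in> \<P>" "x \<in> U P" "Q \<in> \<P>" "x \<in> V Q"
    then have "P = Q" using sub(1)[OF x(1)] sub(2)[OF x(3)] disj[OF x(1,3)] by blast
    then show False using x disjoint[OF x(1)] by blast
  qed
  ultimately show "\<exists>U V. openin X U \<and> openin X V \<and> A \<subseteq> U \<and> B \<subseteq> V \<and> R `` U \<subseteq> U \<and> R\<inverse> `` V \<subseteq> V \<and> U \<inter> V = {}"
    by (intro exI conjI)
qed

section \<open>The monotone Urysohn lemma\<close>

lemma dyadics_dense:
  assumes "0 \<le> a" "a < b"
  obtains r :: real where "r \<in> dyadics" "a < r" "r < b"
proof -
  \<comment> \<open>The midpoint is approximated from above within half the width of the interval,
    so the upper dyadic stays below \<open>b\<close>.\<close>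
  have "0 < (a + b) / 2" "0 < (b - a) / 2" using assms by auto
  then obtain n q r where *: "of_nat q / 2^n < (a + b) / 2" "(a + b) / 2 < of_nat r / 2^n"
      "\<bar>q / 2^n - r / 2^n\<bar> < (b - a) / 2"
    using padic_rational_approximation_straddle_pos[of "(b - a) / 2" 2 "(a + b) / 2"] by (smt (verit))
  have "real r / 2^n \<in> dyadics" by (auto simp: dyadics_def)
  moreover have "a < real r / 2^n" using * assms by (simp add: field_simps)
  moreover have "real r / 2^n < b" using * by (simp add: abs_less_iff field_simps)
  ultimately show thesis using that by blast
qed

text \<open>Urysohn's argument with open up-sets: \<open>below U V\<close> asks for a closed up-set
  between \<open>U\<close> and \<open>V\<close>, order normality lets this relation interpolate, and
  dyadic indices define a level function \<open>g\<close>. As an infimum over indices of up-sets,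
  \<open>g\<close> decreases along \<open>R\<close>, so \<open>1 - g\<close> is the function
  sought.\<close>

lemma monotone_Urysohn:
  assumes N: "order_normal X R" and R: "R \<subseteq> topspace X \<times> topspace X"
    and A: "closedin X A" "R `` A \<subseteq> A" and B: "closedin X B" "R\<inverse> `` B \<subseteq> B" and AB: "A \<inter> B = {}"
  obtains h where "bounded_cont_fun X h" "\<And>x. x \<in> A \<Longrightarrow> h x = (1::real)" "\<And>x. x \<in> B \<Longrightarrow> h x = 0"
    "\<And>x y. (x, y) \<in> R \<Longrightarrow> h x \<le> h y"
proof -
  define up where "up U \<longleftrightarrow> openin X U \<and> R `` U \<subseteq> U" for U
  define below where "below U V \<longleftrightarrow> up U \<and> up V \<and> (\<exists>D. closedin X D \<and> R `` D \<subseteq> D \<and> U \<subseteq> D \<and> D \<subseteq> V)" for U V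
  have interp: "\<exists>U. up U \<and> D \<subseteq> U \<and> below U V"
    if D: "closedin X D" "R `` D \<subseteq> D" and V: "up V" "D \<subseteq> V" for D V
  proof -
    \<comment> \<open>The complement of an open up-set is a closed down-set, so order normality
      applies to it and \<open>D\<close>; the complement of the open down-set \<open>W\<close> then
      serves as the closed up-set in between.\<close>
    have "closedin X (topspace X - V)" using V(1) unfolding up_def by blast
    moreover have "R\<inverse> `` (topspace X - V) \<subseteq> topspace X - V" using V(1) R unfolding up_def by blast
    moreover have "D \<inter> (topspace X - V) = {}" using V(2) by blast
    ultimately obtain U W where UW: "openin X U" "openin X W" "D \<subseteq> U" "topspace X - V \<subseteq> W" "R `` U \<subseteq> U"
        "R\<inverse> `` W \<subseteq> W" "U \<inter> W = {}"
      using N D unfolding order_normal_def by meson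
    have "closedin X (topspace X - W)" using UW(2) by blast
    moreover have "R `` (topspace X - W) \<subseteq> topspace X - W" using UW(6) R by blast
    moreover have "U \<subseteq> topspace X - W" using UW(7) openin_subset[OF UW(1)] by blast
    moreover have "topspace X - W \<subseteq> V" using UW(4) by blast
    moreover have "up U" using UW(1,5) by (simp add: up_def)
    ultimately show ?thesis using UW(3) V(1) unfolding below_def by blast
  qed
  have "A \<subseteq> topspace X - B" using AB closedin_subset[OF A(1)] by blast
  moreover have "up (topspace X - B)"
    unfolding up_def
  proof
    show "openin X (topspace X - B)" using B(1) by (rule openin_diff[OF openin_topspace])
    show "R `` (topspace X - B) \<subseteq> topspace X - B" using B(2) R by blast
  qed
  ultimately obtain U0 where U0: "A \<subseteq> U0" "below U0 (topspace X - B)"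
    using interp[OF A, of "topspace X - B"] by blast
  have "\<exists>G :: real \<Rightarrow> 'a set. G 0 = U0 \<and> G 1 = topspace X - B \<and>
      (\<forall>x\<in>dyadics \<inter> {0..1}. \<forall>y\<in>dyadics \<inter> {0..1}. x < y \<longrightarrow> below (G x) (G y))"
  proof (rule recursion_on_dyadic_fractions[of below, OF U0(2)])
    show "\<exists>W. below U W \<and> below W V" if UV: "below U V" for U V
    proof -
      obtain D where D: "closedin X D" "R `` D \<subseteq> D" "U \<subseteq> D" "D \<subseteq> V" "up U" "up V"
        using UV unfolding below_def by (elim conjE exE)
      obtain W where W: "up W" "D \<subseteq> W" "below W V" using interp[OF D(1,2,6,4)] by (elim conjE exE)
      have "below U W" using D W unfolding below_def by (intro conjI exI[of _ D])
      with W(3) show ?thesis by blast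
    qed
    show "below U W" if UV: "below U V" and VW: "below V W" for U V W
    proof -
      have "up U" "up W" "V \<subseteq> W" using UV VW unfolding below_def by auto
      moreover obtain D where D: "closedin X D" "R `` D \<subseteq> D" "U \<subseteq> D" "D \<subseteq> V"
        using UV unfolding below_def by (elim conjE exE)
      moreover have "D \<subseteq> W" using \<open>D \<subseteq> V\<close> \<open>V \<subseteq> W\<close> by (rule subset_trans)
      ultimately show ?thesis unfolding below_def by (intro conjI exI[of _ D])
    qed
  qed
  then obtain G :: "real \<Rightarrow> 'a set" where G01: "G 0 = U0" "G 1 = topspace X - B"
    and G: "\<And>x y. x \<in> dyadics \<inter> {0..1} \<Longrightarrow> y \<in> dyadics \<inter> {0..1} \<Longrightarrow> x < y \<Longrightarrow> below (G x) (G y)" by blast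
  have 01: "0 \<in> dyadics \<inter> {0..1::real}" "1 \<in> dyadics \<inter> {0..1::real}"
    by (force simp: dyadics_def)+
  have upG: "up (G r)" if "r \<in> dyadics \<inter> {0..1}" for r
  proof (cases "r = 0")
    case True then show ?thesis using G[OF 01] by (simp add: below_def)
  next
    case False then show ?thesis using G[OF 01(1) that] that by (simp add: below_def)
  qed
  have Gmono: "G r \<subseteq> G s" if "r \<in> dyadics \<inter> {0..1}" "s \<in> dyadics \<inter> {0..1}" "r \<le> s" for r s
    using G[OF that(1,2)] that(3) unfolding below_def by (cases "r = s") auto
  \<comment> \<open>The inserted 1 caps the infimum and is the value at points outside every
    \<open>G r\<close>.\<close>
  define g where "g x = Inf (insert 1 {r \<in> dyadics \<inter> {0..1}. x \<in> G r})" for x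
  have bdd: "bdd_below (insert 1 {r \<in> dyadics \<inter> {0..1::real}. x \<in> G r})" for x
    by (rule bdd_belowI[of _ 0]) auto
  have g_less: "g x < a \<longleftrightarrow> 1 < a \<or> (\<exists>r\<in>dyadics \<inter> {0..1}. r < a \<and> x \<in> G r)" for x a
    unfolding g_def by (subst cInf_less_iff[OF _ bdd]) auto
  have g_ge: "0 \<le> g x" for x unfolding g_def by (rule cInf_greatest) auto
  have g_le: "g x \<le> 1" for x unfolding g_def by (rule cInf_lower[OF _ bdd]) simp
  have g_greater: "a < g x \<longleftrightarrow> a < 0 \<or> (\<exists>r\<in>dyadics \<inter> {0..1}. \<exists>s\<in>dyadics \<inter> {0..1}. a < r \<and> r < s \<and> x \<notin> G s)" for x a
  proof (cases "a < 0")
    case True then show ?thesis using g_ge[of x] by simp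
  next
    case False
    have "\<exists>r\<in>dyadics \<inter> {0..1}. \<exists>s\<in>dyadics \<inter> {0..1}. a < r \<and> r < s \<and> x \<notin> G s" if a: "a < g x"
    proof -
      obtain r where r: "r \<in> dyadics" "a < r" "r < g x" using dyadics_dense[of a "g x"] False a by auto
      then obtain s where s: "s \<in> dyadics" "r < s" "s < g x" using dyadics_dense[of r "g x"] False by auto
      have "x \<notin> G s"
        using g_less[of x "g x"] s r False g_le[of x] by force
      then show ?thesis
        using r s False g_le[of x] by (intro bexI[of _ r] bexI[of _ s]) auto
    qed
    moreover have "a < g x"
      if rs: "r \<in> dyadics \<inter> {0..1}" "s \<in> dyadics \<inter> {0..1}" "a < r" "r < s" "x \<notin> G s" for r s
    proof (rule ccontr)
      assume "\<not> a < g x"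
      then have "g x < r" using rs(3) by simp
      then obtain t where "t \<in> dyadics \<inter> {0..1}" "t < r" "x \<in> G t" using g_less[of x r] rs(1) by auto
      then show False using Gmono[of t s] rs by auto
    qed
    ultimately show ?thesis using False by blast
  qed
  have "continuous_map X euclideanreal g"
    unfolding continuous_map_upper_lower_semicontinuous_lt
  proof (intro conjI allI)
    fix a
    have "{x \<in> topspace X. g x < a} = (if 1 < a then topspace X else (\<Union>r\<in>{r \<in> dyadics \<inter> {0..1}. r < a}. G r))"
      using openin_subset upG unfolding g_less up_def by auto
    then show "openin X {x \<in> topspace X. g x < a}" using upG by (auto simp: up_def)
    have "\<exists>W. openin X W \<and> x \<in> W \<and> W \<subseteq> {x \<in> topspace X. a < g x}"
      if x: "x \<in> topspace X" "a < g x" for x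
    proof (cases "a < 0")
      case True then show ?thesis using x g_greater by (intro exI[of _ "topspace X"]) auto
    next
      case False
      then obtain r s where rs: "r \<in> dyadics \<inter> {0..1}" "s \<in> dyadics \<inter> {0..1}" "a < r" "r < s" "x \<notin> G s"
        using x(2) g_greater by blast
      \<comment> \<open>A further dyadic below \<open>r\<close>: a point outside \<open>D\<close>
        misses \<open>G r\<close>, so the criterion \<open>g_greater\<close> for the pair
        \<open>q < r\<close> gives it a value above \<open>a\<close>.\<close>
      obtain q where q: "q \<in> dyadics" "a < q" "q < r" using dyadics_dense[of a r] rs False by auto
      then have q': "q \<in> dyadics \<inter> {0..1}" using rs False by auto
      obtain D where D: "closedin X D" "G r \<subseteq> D" "D \<subseteq> G s" using G[OF rs(1,2,4)] unfolding below_def by blast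
      have "topspace X - D \<subseteq> {x \<in> topspace X. a < g x}"
        using g_greater q(2,3) q' rs(1) D(2) by blast
      then show ?thesis using D x rs(5) by (intro exI[of _ "topspace X - D"]) auto
    qed
    then show "openin X {x \<in> topspace X. a < g x}" by (subst openin_subopen) blast
  qed
  moreover have "(\<lambda>x. 1 - g x) ` topspace X \<subseteq> {0..1}" using g_ge g_le by auto
  then have "bounded ((\<lambda>x. 1 - g x) ` topspace X)" by (rule bounded_subset[rotated]) simp
  ultimately have "bounded_cont_fun X (\<lambda>x. 1 - g x)"
    unfolding bounded_cont_fun_def by (auto intro: continuous_intros)
  moreover have "1 - g x = 1" if "x \<in> A" for x
  proof -
    have "x \<in> G 0" using that U0 G01 by auto
    then have "\<not> 0 < g x" using 01 unfolding g_def by (metis (mono_tags, lifting) bdd cInf_lower insertI2 mem_Collect_eq not_less)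
    then show ?thesis using g_ge[of x] by simp
  qed
  moreover have "1 - g x = 0" if "x \<in> B" for x
  proof -
    have "x \<notin> G r" if "r \<in> dyadics \<inter> {0..1}" for r
      using Gmono[OF that 01(2)] that \<open>x \<in> B\<close> G01 by auto
    then have "\<not> g x < 1" using g_less[of x 1] by blast
    then show ?thesis using g_le[of x] by simp
  qed
  moreover have "1 - g x \<le> 1 - g y" if "(x, y) \<in> R" for x y
  proof -
    have "{r \<in> dyadics \<inter> {0..1}. x \<in> G r} \<subseteq> {r \<in> dyadics \<inter> {0..1}. y \<in> G r}"
      using upG that unfolding up_def by blast
    then have "g y \<le> g x" unfolding g_def by (intro cInf_superset_mono bdd) auto
    then show ?thesis by simp
  qed
  ultimately show thesis using that by blast
qed

section \<open>Clopen saturated sets\<close>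

text \<open>For an equivalence relation \<open>E\<close> these are the preimages of the clopen sets
  of the quotient.\<close>

definition sat_clopen :: "'a topology \<Rightarrow> ('a \<times> 'a) set \<Rightarrow> 'a set set" where
  "sat_clopen X E = {W. clopenin X W \<and> (\<forall>(x, y)\<in>E. x \<in> W \<longleftrightarrow> y \<in> W)}"

lemma sat_clopen_Un: "U \<in> sat_clopen X E \<Longrightarrow> V \<in> sat_clopen X E \<Longrightarrow> U \<union> V \<in> sat_clopen X E"
  by (auto simp: sat_clopen_def clopenin_def)

lemma sat_clopen_empty: "{} \<in> sat_clopen X E"
  by (auto simp: sat_clopen_def clopenin_def)

lemma sat_clopen_Union: "finite \<F> \<Longrightarrow> \<F> \<subseteq> sat_clopen X E \<Longrightarrow> \<Union>\<F> \<in> sat_clopen X E"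
  by (induction rule: finite_induct) (auto intro: sat_clopen_Un sat_clopen_empty)

lemma sat_clopen_compl:
  assumes "E \<subseteq> topspace X \<times> topspace X" "W \<in> sat_clopen X E"
  shows "topspace X - W \<in> sat_clopen X E"
  using assms unfolding sat_clopen_def clopenin_def by fast

lemma sat_clopen_compact_cover:
  assumes C: "compactin X C" and sep: "\<And>x. x \<in> C \<Longrightarrow> \<exists>W\<in>sat_clopen X E. x \<in> W \<and> W \<inter> D = {}"
  shows "\<exists>W\<in>sat_clopen X E. C \<subseteq> W \<and> W \<inter> D = {}"
proof -
  let ?\<W> = "{W \<in> sat_clopen X E. W \<inter> D = {}}"
  have "\<And>W. W \<in> ?\<W> \<Longrightarrow> openin X W" by (simp add: sat_clopen_def clopenin_def)
  moreover have "C \<subseteq> \<Union>?\<W>" using sep by blast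
  ultimately obtain \<F> where \<F>: "finite \<F>" "\<F> \<subseteq> ?\<W>" "C \<subseteq> \<Union>\<F>"
    using compactinD[OF C, of ?\<W>] by blast
  then have "\<Union>\<F> \<in> sat_clopen X E" by (intro sat_clopen_Union) auto
  moreover have "\<Union>\<F> \<inter> D = {}" using \<F>(2) by blast
  ultimately show ?thesis using \<F>(3) by blast
qed

text \<open>Compactness is used twice: for a fixed point of \<open>C\<close> to cover
  \<open>D\<close>, and, after taking complements, to cover \<open>C\<close>.\<close>

lemma sat_clopen_separate_compact:
  assumes E: "E \<subseteq> topspace X \<times> topspace X" and C: "compactin X C" "compactin X D" and CD: "E \<inter> C \<times> D = {}"
    and sep: "\<And>x y. x \<in> topspace X \<Longrightarrow> y \<in> topspace X \<Longrightarrow> (x, y) \<notin> E \<Longrightarrow> \<exists>W\<in>sat_clopen X E. x \<in> W \<and> y \<notin> W"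
  shows "\<exists>W\<in>sat_clopen X E. C \<subseteq> W \<and> W \<inter> D = {}"
proof (rule sat_clopen_compact_cover[OF C(1)])
  fix x assume x: "x \<in> C"
  have "\<exists>W\<in>sat_clopen X E. D \<subseteq> W \<and> W \<inter> {x} = {}"
  proof (rule sat_clopen_compact_cover[OF C(2)])
    fix y assume y: "y \<in> D"
    have S: "x \<in> topspace X" "y \<in> topspace X" using x y C compactin_subset_topspace by blast+
    moreover have "(x, y) \<notin> E" using CD x y by blast
    ultimately obtain W where "W \<in> sat_clopen X E" "x \<in> W" "y \<notin> W" using sep by blast
    then show "\<exists>W\<in>sat_clopen X E. y \<in> W \<and> W \<inter> {x} = {}"
      using sat_clopen_compl[OF E] S by (intro bexI[of _ "topspace X - W"]) auto
  qed
  then obtain W where "W \<in> sat_clopen X E" "D \<subseteq> W" "x \<notin> W" by blast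
  moreover have "x \<in> topspace X" using x C(1) compactin_subset_topspace by blast
  ultimately show "\<exists>W\<in>sat_clopen X E. x \<in> W \<and> W \<inter> D = {}"
    using sat_clopen_compl[OF E] by (intro bexI[of _ "topspace X - W"]) auto
qed

text \<open>A clopen set chosen for one stage cannot be kept outside \<open>K n\<close>, so each
  stage is a new clopen saturated set of the whole space that agrees with the previous one on
  \<open>K n\<close>. The limit is therefore decided on \<open>K n\<close> by stage
  \<open>n\<close>, and both it and its complement in \<open>P\<close> are open.\<close>

lemma sat_clopen_piece:
  assumes E: "equiv (topspace X) E"
    and sep: "\<And>x y. x \<in> topspace X \<Longrightarrow> y \<in> topspace X \<Longrightarrow> (x, y) \<notin> E \<Longrightarrow> \<exists>W\<in>sat_clopen X E. x \<in> W \<and> y \<notin> W"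
    and K: "compact_exhaustion X K P" and P: "\<And>x y. (x, y) \<in> E \<Longrightarrow> x \<in> P \<longleftrightarrow> y \<in> P"
    and F: "closedin X F" "E `` F \<subseteq> F" and H: "closedin X H" "E `` H \<subseteq> H" and FH: "F \<inter> H = {}"
  shows "\<exists>W. openin X W \<and> openin X (P - W) \<and> W \<subseteq> P \<and> (\<forall>(x, y)\<in>E. x \<in> W \<longleftrightarrow> y \<in> W) \<and> F \<inter> P \<subseteq> W \<and> H \<inter> W = {}"
proof -
  have Esym: "(y, x) \<in> E" if "(x, y) \<in> E" for x y
    using E that by (auto simp: equiv_def dest: symD)
  have ES: "E \<subseteq> topspace X \<times> topspace X"
    using E by (auto simp: equiv_def refl_on_def)
  have Kc: "compactin X (K n)" and Ki: "K n \<subseteq> X interior_of K (Suc n)" and KP: "(\<Union>n. K n) = P" for n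
    using K by (auto simp: compact_exhaustion_def)
  have K_Suc: "K n \<subseteq> K (Suc n)" for n using compact_exhaustion_mono[OF K] by simp
  define inv where "inv n W \<longleftrightarrow> W \<in> sat_clopen X E \<and> F \<inter> K n \<subseteq> W \<and> H \<inter> K n \<inter> W = {}" for n W
  define step where "step n W W' \<longleftrightarrow> W' \<inter> K n = W \<inter> K n" for n :: nat and W W'
  have "\<exists>W. inv 0 W"
  proof -
    have "E \<inter> (F \<inter> K 0) \<times> (H \<inter> K 0) = {}" using F(2) FH by blast
    moreover have "compactin X (F \<inter> K 0)" "compactin X (H \<inter> K 0)"
      by (intro closed_Int_compactin F H Kc)+
    ultimately obtain W where "W \<in> sat_clopen X E" "F \<inter> K 0 \<subseteq> W" "W \<inter> (H \<inter> K 0) = {}"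
      using sat_clopen_separate_compact[OF ES _ _ _ sep] by metis
    then show ?thesis unfolding inv_def by blast
  qed
  moreover have "\<exists>W'. inv (Suc n) W' \<and> step n W W'" if inv: "inv n W" for n W
  proof -
    have W: "W \<in> sat_clopen X E" "F \<inter> K n \<subseteq> W" "H \<inter> K n \<inter> W = {}" "clopenin X W"
      "\<And>x y. (x, y) \<in> E \<Longrightarrow> x \<in> W \<longleftrightarrow> y \<in> W"
      using inv unfolding inv_def sat_clopen_def by auto
    \<comment> \<open>Putting the trace of \<open>W\<close> on \<open>K n\<close> on one side and
      the rest of \<open>K n\<close> on the other forces the next set to agree with \<open>W\<close>
      on \<open>K n\<close>.\<close>
    let ?C = "(W \<inter> K n) \<union> (F \<inter> K (Suc n))" and ?D = "((topspace X - W) \<inter> K n) \<union> (H \<inter> K (Suc n))"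
    have "compactin X ?C" "compactin X ?D"
      using W(4) by (intro compactin_Un closed_Int_compactin F H Kc; auto simp: clopenin_def)+
    \<comment> \<open>In the mixed cases saturation moves the pair onto one side: a point of
      \<open>F\<close> related to a point of \<open>K n\<close> outside \<open>W\<close> makes that
      point one of \<open>F \<inter> K n\<close>, which lies in \<open>W\<close>.\<close>
    moreover have "E \<inter> ?C \<times> ?D = {}"
    proof (rule equals0I, clarify)
      fix x y assume xy: "(x, y) \<in> E" "x \<in> ?C" "y \<in> ?D"
      have "x \<in> W \<longleftrightarrow> y \<in> W" "x \<in> F \<longleftrightarrow> y \<in> F" "x \<in> H \<longleftrightarrow> y \<in> H"
        using W(5) xy(1) Esym F(2) H(2) by blast+
      then show False using xy(2,3) W(2,3) FH by blast
    qed
    ultimately obtain W' where W': "W' \<in> sat_clopen X E" "?C \<subseteq> W'" "W' \<inter> ?D = {}"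
      using sat_clopen_separate_compact[OF ES _ _ _ sep, of ?C ?D] by metis
    have "K n \<subseteq> topspace X" using Kc compactin_subset_topspace by blast
    then have "step n W W'" using W'(2,3) unfolding step_def by blast
    moreover have "inv (Suc n) W'" using W' unfolding inv_def by blast
    ultimately show ?thesis by blast
  qed
  ultimately obtain W where inv: "\<And>n. inv n (W n)" and step: "\<And>n. step n (W n) (W (Suc n))"
    using dependent_nat_choice[of inv step] by metis
  have W: "W n \<in> sat_clopen X E" "F \<inter> K n \<subseteq> W n" "H \<inter> K n \<inter> W n = {}" for n
    using inv[of n] unfolding inv_def by auto
  have W_clopen: "openin X (W n)" "openin X (topspace X - W n)" for n
    using W(1)[of n] unfolding sat_clopen_def clopenin_def by auto
  have W_sat: "x \<in> W n \<longleftrightarrow> y \<in> W n" if "(x, y) \<in> E" for x y n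
    using W(1)[of n] that unfolding sat_clopen_def by auto
  have stable: "x \<in> W n \<longleftrightarrow> x \<in> W m" if "m \<le> n" "x \<in> K m" for m n x
    using that
  proof (induction n rule: dec_induct)
    case (step n)
    then have "x \<in> K n" using compact_exhaustion_mono[OF K, of m n] by auto
    then show ?case using step assms \<open>\<And>n. step n (W n) (W (Suc n))\<close>[of n] unfolding step_def by blast
  qed simp
  define V where "V = (\<Union>n. W n \<inter> K n)"
  have V_iff: "x \<in> V \<longleftrightarrow> x \<in> W n" if "x \<in> K n" for x n
  proof
    assume "x \<in> V"
    then obtain m where m: "x \<in> W m" "x \<in> K m" by (auto simp: V_def)
    then show "x \<in> W n" using stable[of m n] stable[of n m] that by (cases "m \<le> n") auto
  qed (use that in \<open>auto simp: V_def\<close>)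
  have int_sub: "X interior_of K n \<subseteq> K n" for n by (rule interior_of_subset)
  have "\<exists>G. openin X G \<and> x \<in> G \<and> G \<subseteq> V" if x: "x \<in> V" for x
  proof -
    obtain n where n: "x \<in> K n" using x by (auto simp: V_def)
    then have x': "x \<in> X interior_of K (Suc n)" using Ki by blast
    then have "x \<in> W (Suc n)" using x V_iff[of x "Suc n"] int_sub by blast
    moreover have "W (Suc n) \<inter> X interior_of K (Suc n) \<subseteq> V" using int_sub[of "Suc n"] by (auto simp: V_def)
    ultimately show ?thesis using x' W_clopen(1)[of "Suc n"]
      by (intro exI[of _ "W (Suc n) \<inter> X interior_of K (Suc n)"]) auto
  qed
  then have "openin X V" by (subst openin_subopen) blast
  moreover have "\<exists>G. openin X G \<and> x \<in> G \<and> G \<subseteq> P - V" if x: "x \<in> P - V" for x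
  proof -
    obtain n where n: "x \<in> K n" using x KP by blast
    then have x': "x \<in> X interior_of K (Suc n)" using Ki by blast
    then have "x \<notin> W (Suc n)" using x V_iff[of x "Suc n"] int_sub by blast
    moreover have "(topspace X - W (Suc n)) \<inter> X interior_of K (Suc n) \<subseteq> P - V"
    proof clarify
      fix z assume z: "z \<notin> W (Suc n)" "z \<in> X interior_of K (Suc n)"
      then have "z \<in> K (Suc n)" using int_sub by blast
      then show "z \<in> P - V" using V_iff[of z "Suc n"] z(1) KP by blast
    qed
    moreover have "x \<in> topspace X" using n compactin_subset_topspace[OF Kc] by blast
    ultimately show ?thesis using x' W_clopen(2)[of "Suc n"]
      by (intro exI[of _ "(topspace X - W (Suc n)) \<inter> X interior_of K (Suc n)"]) auto
  qed
  then have "openin X (P - V)" by (subst openin_subopen) blast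
  moreover have "V \<subseteq> P" unfolding V_def KP[symmetric] by blast
  moreover have "\<forall>(x, y)\<in>E. x \<in> V \<longleftrightarrow> y \<in> V"
  proof clarify
    fix x y assume xy: "(x, y) \<in> E"
    show "x \<in> V \<longleftrightarrow> y \<in> V"
    proof (cases "x \<in> P")
      case True
      then have "y \<in> P" using P[OF xy] by blast
      with True obtain m n where "x \<in> K m" "y \<in> K n" using KP by blast
      then have "x \<in> K (max m n)" "y \<in> K (max m n)"
        using compact_exhaustion_mono[OF K, of m "max m n"] compact_exhaustion_mono[OF K, of n "max m n"] by auto
      then show ?thesis using V_iff W_sat[OF xy] by blast
    next
      case False
      then have "y \<notin> P" using P[OF xy] by blast
      with False show ?thesis using \<open>V \<subseteq> P\<close> by blast
    qed
  qed
  moreover have "F \<inter> P \<subseteq> V" unfolding KP[symmetric] V_def using W(2) by blast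
  moreover have "H \<inter> V = {}" unfolding V_def using W(3) by blast
  ultimately show ?thesis by blast
qed

lemma sat_clopen_exhaustible:
  assumes E: "equiv (topspace X) E"
    and sep: "\<And>x y. x \<in> topspace X \<Longrightarrow> y \<in> topspace X \<Longrightarrow> (x, y) \<notin> E \<Longrightarrow> \<exists>W\<in>sat_clopen X E. x \<in> W \<and> y \<notin> W"
    and P: "exhaustible_partition X \<P>" "E \<subseteq> (\<Union>P\<in>\<P>. P \<times> P)"
    and F: "closedin X F" "E `` F \<subseteq> F" and H: "closedin X H" "E `` H \<subseteq> H" and FH: "F \<inter> H = {}"
  obtains W where "W \<in> sat_clopen X E" "F \<subseteq> W" "H \<inter> W = {}"
proof -
  note D = exhaustible_partitionD[OF P(1)]
  have "\<exists>W. openin X W \<and> openin X (P - W) \<and> W \<subseteq> P \<and> (\<forall>(x, y)\<in>E. x \<in> W \<longleftrightarrow> y \<in> W) \<and> F \<inter> P \<subseteq> W \<and> H \<inter> W = {}"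
    if p: "P \<in> \<P>" for P
  proof -
    obtain K where K: "compact_exhaustion X K P" using D(2)[OF p] by blast
    have "x \<in> P \<longleftrightarrow> y \<in> P" if xy: "(x, y) \<in> E" for x y
    proof -
      obtain Q where "Q \<in> \<P>" "x \<in> Q" "y \<in> Q" using xy P(2) by blast
      then show ?thesis using D(3)[OF p] by blast
    qed
    from sat_clopen_piece[OF E sep K this F H FH] show ?thesis .
  qed
  then obtain W where W: "\<And>P. P \<in> \<P> \<Longrightarrow> openin X (W P) \<and> openin X (P - W P) \<and> W P \<subseteq> P \<and>
      (\<forall>(x, y)\<in>E. x \<in> W P \<longleftrightarrow> y \<in> W P) \<and> F \<inter> P \<subseteq> W P \<and> H \<inter> W P = {}"
    by metis
  define V where "V = (\<Union>P\<in>\<P>. W P)"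
  have "topspace X - V = (\<Union>P\<in>\<P>. P - W P)"
  proof (intro equalityI subsetI)
    fix x assume x: "x \<in> topspace X - V"
    then obtain P where "P \<in> \<P>" "x \<in> P" using D(1) by blast
    then show "x \<in> (\<Union>P\<in>\<P>. P - W P)" using x by (auto simp: V_def)
  next
    fix x assume "x \<in> (\<Union>P\<in>\<P>. P - W P)"
    then obtain P where P: "P \<in> \<P>" "x \<in> P" "x \<notin> W P" by blast
    have "x \<notin> W Q" if "Q \<in> \<P>" for Q
      using W[OF that] D(3)[OF P(1) that P(2)] P(3) by blast
    then show "x \<in> topspace X - V" using P D(1) by (auto simp: V_def)
  qed
  moreover have "openin X (\<Union>P\<in>\<P>. P - W P)" using W by blast
  moreover have "openin X V" unfolding V_def using W by blast
  ultimately have "clopenin X V" using openin_subset[of X V] by (simp add: clopenin_def closedin_def)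
  moreover have "\<forall>(x, y)\<in>E. x \<in> V \<longleftrightarrow> y \<in> V"
  proof clarify
    fix x y assume xy: "(x, y) \<in> E"
    have "x \<in> W P \<longleftrightarrow> y \<in> W P" if "P \<in> \<P>" for P using W[OF that] xy by blast
    then show "x \<in> V \<longleftrightarrow> y \<in> V" by (auto simp: V_def)
  qed
  ultimately have "V \<in> sat_clopen X E" by (simp add: sat_clopen_def)
  moreover have "F \<subseteq> V"
  proof
    fix x assume x: "x \<in> F"
    then obtain P where "P \<in> \<P>" "x \<in> P" using D(1) closedin_subset[OF F(1)] by blast
    then show "x \<in> V" using W[of P] x by (auto simp: V_def)
  qed
  moreover have "H \<inter> V = {}" using W by (auto simp: V_def)
  ultimately show thesis using that by blast
qed

section \<open>Existence of exhaustible partitions\<close>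

lemma locally_compact_compact_neighbourhood:
  assumes X: "locally_compact_space X" and C: "compactin X C"
  shows "\<exists>D. compactin X D \<and> C \<subseteq> X interior_of D"
proof -
  let ?\<U> = "{U. openin X U \<and> (\<exists>K. compactin X K \<and> U \<subseteq> K)}"
  have "C \<subseteq> \<Union>?\<U>"
  proof
    fix x assume "x \<in> C"
    then have "x \<in> topspace X" using compactin_subset_topspace[OF C] by blast
    then obtain U K where "openin X U" "compactin X K" "x \<in> U" "U \<subseteq> K"
      using X unfolding locally_compact_space_def by metis
    then show "x \<in> \<Union>?\<U>" by blast
  qed
  then obtain \<F> where \<F>: "finite \<F>" "\<F> \<subseteq> ?\<U>" "C \<subseteq> \<Union>\<F>"
    using compactinD[OF C, of ?\<U>] by blast
  have "\<forall>U\<in>\<F>. \<exists>K. compactin X K \<and> U \<subseteq> K" using \<F>(2) by blast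
  then obtain K where K: "\<And>U. U \<in> \<F> \<Longrightarrow> compactin X (K U) \<and> U \<subseteq> K U" by metis
  have "compactin X (\<Union>(K ` \<F>))" using \<F>(1) K by (intro compactin_Union) auto
  moreover have "openin X (\<Union>\<F>)" using \<F>(2) by blast
  then have "\<Union>\<F> \<subseteq> X interior_of (\<Union>(K ` \<F>))"
    using K by (intro interior_of_maximal) blast+
  ultimately show ?thesis using \<F>(3) by blast
qed

lemma sigma_compact_exhaustible:
  assumes X: "locally_compact_space X" and S: "sigma_compact_space X"
  shows "exhaustible_partition X {topspace X}"
proof -
  obtain \<K> where \<K>: "countable \<K>" "\<forall>K\<in>\<K>. compactin X K" "\<Union>\<K> = topspace X"
    using S unfolding sigma_compact_space_def by (elim exE conjE)
  \<comment> \<open>The inserted empty set keeps the enumerated family nonempty, which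
    \<open>from_nat_into\<close> requires.\<close>
  define L where "L = from_nat_into (insert {} \<K>)"
  have rL: "range L = insert {} \<K>" unfolding L_def using \<K>(1) by (intro range_from_nat_into) auto
  have L: "compactin X (L n)" for n using \<K>(2) rL by (metis compactin_empty insertE rangeI)
  obtain g where g: "\<And>C. compactin X C \<Longrightarrow> compactin X (g C) \<and> C \<subseteq> X interior_of g C"
    using locally_compact_compact_neighbourhood[OF X] by metis
  \<comment> \<open>Each stage absorbs the next set of the enumeration and passes to a compact
    neighbourhood, which provides the interior condition.\<close>
  define K where "K = rec_nat {} (\<lambda>n C. g (C \<union> L n))"
  have K_Suc: "K (Suc n) = g (K n \<union> L n)" for n by (simp add: K_def)
  have K: "compactin X (K n)" for n
  proof (induction n)
    case (Suc n) then show ?case unfolding K_Suc using g L by (blast intro: compactin_Un)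
  qed (simp add: K_def)
  have sub: "K n \<union> L n \<subseteq> X interior_of K (Suc n)" for n
    unfolding K_Suc using g[of "K n \<union> L n"] K L by (simp add: compactin_Un)
  have "(\<Union>n. K n) = topspace X"
  proof (intro equalityI subsetI)
    fix x assume "x \<in> topspace X"
    then obtain n where "x \<in> L n" using \<K>(3) rL by (metis UnionE insertCI rangeE)
    then have "x \<in> K (Suc n)" using sub[of n] interior_of_subset[of X "K (Suc n)"] by blast
    then show "x \<in> (\<Union>n. K n)" by blast
  next
    fix x assume "x \<in> (\<Union>n. K n)"
    then show "x \<in> topspace X" using K compactin_subset_topspace by blast
  qed
  then have "compact_exhaustion X K (topspace X)"
    unfolding compact_exhaustion_def using K sub by blast
  then show ?thesis by (auto simp: exhaustible_partition_def)
qed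

text \<open>Upper semicontinuity: a finite family of open sets covering the image of
  \<open>x\<close> covers the images of all points near \<open>x\<close>; compactness of
  \<open>C\<close> leaves finitely many such \<open>x\<close>.\<close>

lemma cusc_compact_image:
  assumes f: "cusc X f" "f \<subseteq> topspace X \<times> topspace X" and C: "compactin X C"
  shows "compactin X (f `` C)"
  unfolding compactin_def
proof (intro conjI allI impI)
  show "f `` C \<subseteq> topspace X" using f(2) by blast
  fix \<U> assume \<U>: "Ball \<U> (openin X) \<and> f `` C \<subseteq> \<Union>\<U>"
  have "\<exists>\<F>. finite \<F> \<and> \<F> \<subseteq> \<U> \<and> f `` {x} \<subseteq> \<Union>\<F>" if x: "x \<in> C" for x
  proof (rule compactinD)
    show "compactin X (f `` {x})" using f(1) x compactin_subset_topspace[OF C] unfolding cusc_def by blast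
  qed (use \<U> x in auto)
  then obtain \<F> where \<F>: "\<And>x. x \<in> C \<Longrightarrow> finite (\<F> x) \<and> \<F> x \<subseteq> \<U> \<and> f `` {x} \<subseteq> \<Union>(\<F> x)" by metis
  \<comment> \<open>The points whose whole image lies in the union of the finite family at
    \<open>x\<close>; it is open because preimages of closed sets are closed.\<close>
  define W where "W x = topspace X - f\<inverse> `` (topspace X - \<Union>(\<F> x))" for x
  have opW: "openin X (W x)" if "x \<in> C" for x
  proof -
    have "openin X (\<Union>(\<F> x))" using \<F>[OF that] \<U> by blast
    then have "closedin X (f\<inverse> `` (topspace X - \<Union>(\<F> x)))" using f(1) unfolding cusc_def by blast
    then show ?thesis unfolding W_def by blast
  qed
  moreover have "x \<in> W x" if "x \<in> C" for x
    using \<F>[OF that] that compactin_subset_topspace[OF C] unfolding W_def by blast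
  then have "C \<subseteq> \<Union>(W ` C)" by blast
  ultimately obtain \<D> where "finite \<D>" "\<D> \<subseteq> W ` C" "C \<subseteq> \<Union>\<D>"
    using compactinD[OF C, of "W ` C"] by blast
  then obtain D where D: "finite D" "D \<subseteq> C" "C \<subseteq> \<Union>(W ` D)"
    by (metis finite_subset_image)
  have "f `` C \<subseteq> \<Union>(\<Union>(\<F> ` D))"
  proof clarify
    fix x y assume xy: "x \<in> C" "(x, y) \<in> f"
    then obtain z where z: "z \<in> D" "x \<in> W z" using D(3) by blast
    have "y \<in> topspace X" using xy(2) f(2) by blast
    then have "y \<in> \<Union>(\<F> z)" using xy(2) z(2) unfolding W_def by blast
    then show "y \<in> \<Union>(\<Union>(\<F> ` D))" using z by blast
  qed
  moreover have "finite (\<Union>(\<F> ` D))" "\<Union>(\<F> ` D) \<subseteq> \<U>" using D \<F> by blast+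
  ultimately show "\<exists>\<F>. finite \<F> \<and> \<F> \<subseteq> \<U> \<and> f `` C \<subseteq> \<Union>\<F>" by blast
qed

lemma locally_finite_compact:
  assumes \<V>: "locally_finite_in X \<V>" and C: "compactin X C"
  shows "finite {V \<in> \<V>. V \<inter> C \<noteq> {}}"
proof -
  let ?\<W> = "{W. openin X W \<and> finite {V \<in> \<V>. V \<inter> W \<noteq> {}}}"
  have "C \<subseteq> \<Union>?\<W>"
  proof
    fix x assume "x \<in> C"
    then have "x \<in> topspace X" using compactin_subset_topspace[OF C] by blast
    then obtain W where "openin X W" "x \<in> W" "finite {V \<in> \<V>. V \<inter> W \<noteq> {}}"
      using \<V> unfolding locally_finite_in_def by metis
    then show "x \<in> \<Union>?\<W>" by blast
  qed
  then obtain \<F> where \<F>: "finite \<F>" "\<F> \<subseteq> ?\<W>" "C \<subseteq> \<Union>\<F>"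
    using compactinD[OF C, of ?\<W>] by blast
  then have "finite (\<Union>W\<in>\<F>. {V \<in> \<V>. V \<inter> W \<noteq> {}})" by blast
  moreover have "{V \<in> \<V>. V \<inter> C \<noteq> {}} \<subseteq> (\<Union>W\<in>\<F>. {V \<in> \<V>. V \<inter> W \<noteq> {}})" using \<F>(3) by blast
  ultimately show ?thesis by (rule rev_finite_subset)
qed

text \<open>The pieces are the classes of the equivalence relation generated by \<open>f\<close> and by membership in
  a common member of a locally finite compact cover; the points reachable in \<open>n\<close> steps from a given
  one form a compact set.\<close>

lemma proper_exhaustible:
  assumes X: "locally_compact_space X" "paracompact_space X" "Hausdorff_space X"
    and f: "proper_rel X f" "f \<subseteq> topspace X \<times> topspace X"
  shows "\<exists>\<P>. exhaustible_partition X \<P> \<and> f \<subseteq> (\<Union>P\<in>\<P>. P \<times> P)"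
proof -
  let ?\<U> = "{U. openin X U \<and> (\<exists>K. compactin X K \<and> U \<subseteq> K)}"
  have "\<Union>?\<U> = topspace X"
  proof (intro equalityI subsetI)
    fix x assume "x \<in> topspace X"
    then obtain U K where "openin X U" "compactin X K" "x \<in> U" "U \<subseteq> K"
      using X(1) unfolding locally_compact_space_def by metis
    then show "x \<in> \<Union>?\<U>" by blast
  next
    fix x assume "x \<in> \<Union>?\<U>"
    then obtain U where "openin X U" "x \<in> U" by blast
    then show "x \<in> topspace X" using openin_subset by blast
  qed
  moreover have "\<forall>U\<in>?\<U>. openin X U" by blast
  ultimately have "(\<forall>U\<in>?\<U>. openin X U) \<and> \<Union>?\<U> = topspace X" by (intro conjI)
  from mp[OF spec[OF X(2)[unfolded paracompact_space_def]] this]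
  obtain \<V> where "\<forall>V\<in>\<V>. openin X V" "\<Union>\<V> = topspace X"
    "\<forall>V\<in>\<V>. \<exists>U\<in>?\<U>. V \<subseteq> U" "locally_finite_in X \<V>" by (elim exE conjE)
  then have \<V>: "\<And>V. V \<in> \<V> \<Longrightarrow> openin X V" "\<Union>\<V> = topspace X"
    "\<And>V. V \<in> \<V> \<Longrightarrow> \<exists>U\<in>?\<U>. V \<subseteq> U" "locally_finite_in X \<V>" by simp_all
  \<comment> \<open>Taking closures keeps the family locally finite and makes its members compact,
    since each open member lies in a compact set and \<open>X\<close> is Hausdorff.\<close>
  define \<C> where "\<C> = (\<lambda>V. X closure_of V) ` \<V>"
  have \<C>_fin: "locally_finite_in X \<C>" unfolding \<C>_def by (rule locally_finite_in_closure[OF \<V>(4)])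
  have \<C>_comp: "compactin X D" if D: "D \<in> \<C>" for D
  proof -
    obtain V where V: "D = X closure_of V" "V \<in> \<V>" using D unfolding \<C>_def by blast
    moreover obtain K where "compactin X K" "V \<subseteq> K" using \<V>(3)[OF V(2)] by auto
    ultimately show ?thesis
      using closed_compactin[of X K D] closure_of_minimal[of V K X] compactin_imp_closedin[OF X(3)] by simp
  qed
  define T where "T = (\<Union>D\<in>\<C>. D \<times> D) \<union> f \<union> f\<inverse>"
  have T_sym: "sym T" unfolding T_def sym_def by blast
  have T_comp: "compactin X (T `` C)" if C: "compactin X C" for C
  proof -
    have "T `` C = \<Union>{D \<in> \<C>. D \<inter> C \<noteq> {}} \<union> f `` C \<union> f\<inverse> `` C" unfolding T_def by blast
    moreover have "compactin X (\<Union>{D \<in> \<C>. D \<inter> C \<noteq> {}})"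
      using locally_finite_compact[OF \<C>_fin C] \<C>_comp by (intro compactin_Union) auto
    moreover have "compactin X (f `` C)" "compactin X (f\<inverse> `` C)"
      using f C by (auto intro!: cusc_compact_image simp: proper_rel_def)
    ultimately show ?thesis by (simp add: compactin_Un)
  qed
  have T_nhd: "\<exists>V. openin X V \<and> x \<in> V \<and> V \<subseteq> T `` {x}" if "x \<in> topspace X" for x
  proof -
    obtain V where V: "V \<in> \<V>" "x \<in> V" using \<V>(2) \<open>x \<in> topspace X\<close> by blast
    then have "V \<subseteq> X closure_of V" using \<V>(1) openin_subset closure_of_subset by metis
    moreover have "X closure_of V \<in> \<C>" using V(1) by (simp add: \<C>_def)
    ultimately have "V \<subseteq> T `` {x}" using V(2) unfolding T_def by blast
    then show ?thesis using V \<V>(1) by blast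
  qed
  define \<P> where "\<P> = (\<lambda>x. T\<^sup>* `` {x}) ` topspace X"
  have exh: "compact_exhaustion X (\<lambda>n. (T ^^ n) `` {x}) (T\<^sup>* `` {x})" if x: "x \<in> topspace X" for x
    unfolding compact_exhaustion_def
  proof (intro conjI allI)
    have Suc: "(T ^^ Suc n) `` {x} = T `` ((T ^^ n) `` {x})" for n by auto
    fix n
    show c: "compactin X ((T ^^ n) `` {x})"
    proof (induction n)
      case 0 then show ?case using x by simp
    next
      case (Suc n) then show ?case unfolding \<open>\<And>n. (T ^^ Suc n) `` {x} = T `` ((T ^^ n) `` {x})\<close> by (rule T_comp)
    qed
    show "(T ^^ n) `` {x} \<subseteq> X interior_of ((T ^^ Suc n) `` {x})"
    proof
      fix y assume y: "y \<in> (T ^^ n) `` {x}"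
      then have "y \<in> topspace X" using compactin_subset_topspace[OF c] by blast
      then obtain V where "openin X V" "y \<in> V" "V \<subseteq> T `` {y}" using T_nhd by blast
      moreover have "T `` {y} \<subseteq> (T ^^ Suc n) `` {x}" using y unfolding Suc by blast
      ultimately show "y \<in> X interior_of ((T ^^ Suc n) `` {x})" unfolding interior_of_def by blast
    qed
  next
    show "(\<Union>n. (T ^^ n) `` {x}) = T\<^sup>* `` {x}" by (auto simp: rtrancl_power)
  qed
  have T_eq: "T\<^sup>* `` {x} = T\<^sup>* `` {y}" if "(x, y) \<in> T\<^sup>*" for x y
  proof -
    have "(y, x) \<in> T\<^sup>*" using sym_rtrancl[OF T_sym] that by (rule symD)
    then show ?thesis using that by (auto intro: rtrancl_trans)
  qed
  have "T\<^sup>* `` {x} \<subseteq> topspace X" if "x \<in> topspace X" for x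
    using openin_subset[OF compact_exhaustion_open[OF exh[OF that]]] .
  then have "\<Union>\<P> = topspace X" unfolding \<P>_def by blast
  moreover have "pairwise disjnt \<P>"
  proof (rule pairwiseI)
    fix P Q assume PQ: "P \<in> \<P>" "Q \<in> \<P>" "P \<noteq> Q"
    then obtain x y where xy: "P = T\<^sup>* `` {x}" "Q = T\<^sup>* `` {y}" by (auto simp: \<P>_def)
    show "disjnt P Q"
    proof (rule ccontr)
      assume "\<not> disjnt P Q"
      then obtain z where "(x, z) \<in> T\<^sup>*" "(y, z) \<in> T\<^sup>*" unfolding xy disjnt_iff by blast
      then have "P = Q" using T_eq unfolding xy by metis
      with PQ(3) show False by contradiction
    qed
  qed
  moreover have "\<forall>P\<in>\<P>. \<exists>K. compact_exhaustion X K P" using exh unfolding \<P>_def by blast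
  ultimately have "exhaustible_partition X \<P>" by (simp add: exhaustible_partition_def)
  moreover have "f \<subseteq> (\<Union>P\<in>\<P>. P \<times> P)"
  proof clarify
    fix a b assume ab: "(a, b) \<in> f"
    then have "a \<in> topspace X" "(a, b) \<in> T\<^sup>*" using f(2) by (auto simp: T_def)
    then show "(a, b) \<in> (\<Union>P\<in>\<P>. P \<times> P)" unfolding \<P>_def by blast
  qed
  ultimately show ?thesis by blast
qed

text \<open>The pieces are clopen and respected by \<open>f\<close>, so \<open>C_rel_clopen\<close>
  applies to each. Through \<open>A_rel_subset_C_rel\<close> the conclusion passes to
  \<open>A_rel\<close>.\<close>

lemma C_rel_subset_partition:
  assumes X: "completely_regular_space X" and P: "exhaustible_partition X \<P>" "f \<subseteq> (\<Union>P\<in>\<P>. P \<times> P)"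
  shows "C_rel (topspace X) (max_uniformity X) f \<subseteq> (\<Union>P\<in>\<P>. P \<times> P)"
proof clarify
  fix x y assume xy: "(x, y) \<in> C_rel (topspace X) (max_uniformity X) f"
  then have "x \<in> topspace X" by (auto simp: C_rel_def)
  then obtain P where p: "P \<in> \<P>" "x \<in> P" using exhaustible_partitionD(1)[OF P(1)] by blast
  have "a \<in> P \<longleftrightarrow> b \<in> P" if ab: "(a, b) \<in> f" for a b
  proof -
    obtain Q where "Q \<in> \<P>" "a \<in> Q" "b \<in> Q" using ab P(2) by blast
    then show ?thesis using exhaustible_partitionD(3)[OF P(1) p(1)] by blast
  qed
  from C_rel_clopen[OF X exhaustible_partition_clopen[OF P(1) p(1)] this xy] p
  show "(x, y) \<in> (\<Union>P\<in>\<P>. P \<times> P)" by blast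
qed

section \<open>Quotients of exhaustible spaces\<close>

lemma exhaustible_partition_exists:
  assumes "locally_compact_space X" "paracompact_space X" "Hausdorff_space X" "f \<subseteq> topspace X \<times> topspace X"
    and "sigma_compact_space X \<or> proper_rel X f"
  obtains \<P> where "exhaustible_partition X \<P>" "f \<subseteq> (\<Union>P\<in>\<P>. P \<times> P)"
  using assms(5)
proof
  assume "sigma_compact_space X"
  then show thesis using sigma_compact_exhaustible[OF assms(1)] assms(4) that[of "{topspace X}"] by auto
next
  assume "proper_rel X f"
  then show thesis using proper_exhaustible[OF assms(1-3) _ assms(4)] that by blast
qed

lemma A_rel_subset_G_rel:
  assumes X: "completely_regular_space X" "Hausdorff_space X" and f: "f \<subseteq> topspace X \<times> topspace X"
    and P: "exhaustible_partition X \<P>" and G: "G_rel X f \<subseteq> (\<Union>P\<in>\<P>. P \<times> P)"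
  shows "A_rel (topspace X) (max_uniformity X) f \<subseteq> Id_on (topspace X) \<union> G_rel X f"
proof clarify
  let ?R = "Id_on (topspace X) \<union> G_rel X f"
  fix x y assume xy: "(x, y) \<in> A_rel (topspace X) (max_uniformity X) f" and nG: "(x, y) \<notin> G_rel X f"
  have S: "x \<in> topspace X" "y \<in> topspace X" using xy by (auto simp: A_rel_def)
  have GS: "G_rel X f \<subseteq> topspace X \<times> topspace X"
    using closedin_subset[OF closed_rel_G_rel[OF f, unfolded closed_rel_def]] by simp
  have "Id_on (topspace X) = (\<lambda>x. (x, x)) ` topspace X" by auto
  then have "closedin (prod_topology X X) (Id_on (topspace X))"
    using X(2) by (simp add: Hausdorff_space_closedin_diagonal)
  then have cl: "closed_rel X ?R"
    using closed_rel_G_rel[OF f] unfolding closed_rel_def by (rule closedin_Un)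
  have refl: "refl_on (topspace X) ?R" using GS by (auto simp: refl_on_def)
  have tr: "trans ?R" using trans_G_rel[of X f] unfolding trans_def by blast
  have RP: "?R \<subseteq> (\<Union>P\<in>\<P>. P \<times> P)" using G exhaustible_partitionD(1)[OF P] by blast
  have N: "order_normal X ?R"
    by (rule order_normal_exhaustible[OF completely_regular_imp_regular_space[OF X(1)] cl refl tr P RP])
  show "(x, y) \<in> Id_on (topspace X)"
  proof (rule ccontr)
    assume "(x, y) \<notin> Id_on (topspace X)"
    with nG have nR: "(x, y) \<notin> ?R" by blast
    have RS: "?R \<subseteq> topspace X \<times> topspace X" using GS by auto
    \<comment> \<open>The closed up-set of \<open>x\<close> and the closed down-set of
      \<open>y\<close> are disjoint by transitivity. A monotone function that is 1 on the former and
      0 on the latter contradicts \<open>h x \<le> h y\<close>, which \<open>A_rel_monotone\<close>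
      would give.\<close>
    have "?R `` (?R `` {x}) \<subseteq> ?R `` {x}" "?R\<inverse> `` (?R\<inverse> `` {y}) \<subseteq> ?R\<inverse> `` {y}"
      using tr unfolding trans_def by blast+
    moreover have "?R `` {x} \<inter> ?R\<inverse> `` {y} = {}" using tr nR unfolding trans_def by blast
    ultimately obtain h where h: "bounded_cont_fun X h" "\<And>z. z \<in> ?R `` {x} \<Longrightarrow> h z = (1::real)"
        "\<And>z. z \<in> ?R\<inverse> `` {y} \<Longrightarrow> h z = 0" "\<And>a b. (a, b) \<in> ?R \<Longrightarrow> h a \<le> h b"
      using monotone_Urysohn[OF N RS closedin_Image_singleton[OF cl S(1)] _
          closedin_Image_singleton[OF closed_rel_converse[OF cl] S(2)]] by metis
    have "h a \<le> h b" if "(a, b) \<in> f" for a b using h(4) subset_G_rel[of f X] that by blast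
    from A_rel_monotone[OF X(1) h(1) this xy] have "h x \<le> h y" .
    moreover have "h x = 1" "h y = 0" using h(2)[of x] h(3)[of y] S by auto
    ultimately show False by simp
  qed
qed

section \<open>Normality of the quotient\<close>

lemma quotient_preimage:
  assumes E: "equiv S E" and U: "U \<subseteq> S" "E `` U \<subseteq> U"
  shows "{x \<in> S. E `` {x} \<in> (\<lambda>x. E `` {x}) ` U} = U"
proof -
  have "x \<in> U" if "x \<in> S" "u \<in> U" "E `` {x} = E `` {u}" for x u
    using eq_equiv_class[OF that(3)[symmetric] E that(1)] U that(2) by blast
  then show ?thesis using U(1) by auto
qed

lemma openin_quotient_image:
  assumes E: "equiv (topspace X) E" and U: "openin X U" "E `` U \<subseteq> U"
  shows "openin (quotient_space X E) ((\<lambda>x. E `` {x}) ` U)"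
  unfolding openin_quotient_space quotient_preimage[OF E openin_subset[OF U(1)] U(2)]
  using U(1) openin_subset[OF U(1)] by (auto intro: quotientI)

lemma saturated_preimage:
  assumes E: "equiv S E" shows "E `` {x \<in> S. E `` {x} \<in> B} \<subseteq> {x \<in> S. E `` {x} \<in> B}"
proof clarify
  fix x y assume "(x, y) \<in> E" "E `` {x} \<in> B"
  then show "y \<in> S \<and> E `` {y} \<in> B"
    using equiv_class_eq[OF E] E by (auto simp: equiv_def)
qed

lemma normal_space_quotient:
  assumes E: "equiv (topspace X) E" and N: "order_normal X E"
  shows "normal_space (quotient_space X E)"
  unfolding normal_space_def
proof clarify
  fix A B assume AB: "closedin (quotient_space X E) A" "closedin (quotient_space X E) B" "disjnt A B"
  let ?q = "\<lambda>x. E `` {x}"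
  \<comment> \<open>Symmetry makes up-sets and down-sets the same saturated sets, so their images
    separate \<open>A\<close> and \<open>B\<close> downstairs.\<close>
  have conv: "E\<inverse> = E" using E by (simp add: equiv_def sym_conv_converse_eq)
  have "closedin X {x \<in> topspace X. ?q x \<in> A}" "closedin X {x \<in> topspace X. ?q x \<in> B}"
    by (intro closedin_continuous_map_preimage[OF continuous_map_quotient_space] AB)+
  moreover have "{x \<in> topspace X. ?q x \<in> A} \<inter> {x \<in> topspace X. ?q x \<in> B} = {}"
    using AB(3) by (auto simp: disjnt_iff)
  ultimately have "\<exists>U V. openin X U \<and> openin X V \<and> {x \<in> topspace X. ?q x \<in> A} \<subseteq> U \<and>
      {x \<in> topspace X. ?q x \<in> B} \<subseteq> V \<and> E `` U \<subseteq> U \<and> E `` V \<subseteq> V \<and> U \<inter> V = {}"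
    using saturated_preimage[OF E]
    by (intro N[unfolded order_normal_def conv, THEN spec, THEN spec, THEN mp] conjI)
  then obtain U V where UV: "openin X U" "openin X V" "{x \<in> topspace X. ?q x \<in> A} \<subseteq> U"
      "{x \<in> topspace X. ?q x \<in> B} \<subseteq> V" "E `` U \<subseteq> U" "E `` V \<subseteq> V" "U \<inter> V = {}"
    by (elim exE conjE)
  show "\<exists>U V. openin (quotient_space X E) U \<and> openin (quotient_space X E) V \<and> A \<subseteq> U \<and> B \<subseteq> V \<and> disjnt U V"
  proof (intro exI conjI)
    show "openin (quotient_space X E) (?q ` U)" "openin (quotient_space X E) (?q ` V)"
      by (rule openin_quotient_image[OF E]; fact)+
    have sub: "C \<subseteq> ?q ` W" if C: "closedin (quotient_space X E) C" "{x \<in> topspace X. ?q x \<in> C} \<subseteq> W" for C W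
    proof
      fix Q assume Q: "Q \<in> C"
      then obtain x where "x \<in> topspace X" "Q = ?q x"
        using closedin_subset[OF C(1)] by (auto simp: topspace_quotient_space quotient_def)
      then show "Q \<in> ?q ` W" using Q C(2) by blast
    qed
    show "A \<subseteq> ?q ` U" "B \<subseteq> ?q ` V" by (rule sub; fact)+
    show "disjnt (?q ` U) (?q ` V)"
      unfolding disjnt_iff
    proof clarify
      fix u v assume uv: "u \<in> U" "v \<in> V" "E `` {u} = E `` {v}"
      then have "(u, v) \<in> E" using eq_equiv_class[OF uv(3) E] openin_subset[OF UV(2)] by blast
      then show False using uv UV(5,7) by blast
    qed
  qed
qed

section \<open>Separation and zero-dimensionality of the quotient\<close>

lemma Hausdorff_space_completely_Hausdorff:
  assumes "completely_Hausdorff_space Y" shows "Hausdorff_space Y"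
  unfolding Hausdorff_space_def
proof (intro allI impI, elim conjE)
  fix x y assume xy: "x \<in> topspace Y" "y \<in> topspace Y" "x \<noteq> y"
  then obtain g where g: "bounded_cont_fun Y g" "g x \<noteq> g y"
    using assms unfolding completely_Hausdorff_space_def by meson
  obtain U V where UV: "open U" "open V" "g x \<in> U" "g y \<in> V" "U \<inter> V = {}"
    using hausdorff[OF g(2)] by blast
  have op: "openin Y {z \<in> topspace Y. g z \<in> W}" if "open W" for W
    using g(1) that by (intro openin_continuous_map_preimage[of _ euclideanreal]) (auto simp: bounded_cont_fun_def)
  show "\<exists>U V. openin Y U \<and> openin Y V \<and> x \<in> U \<and> y \<in> V \<and> disjnt U V"
    using op[OF UV(1)] op[OF UV(2)] UV(3-5) xy
    by (intro exI[of _ "{z \<in> topspace Y. g z \<in> U}"] exI[of _ "{z \<in> topspace Y. g z \<in> V}"])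
      (auto simp: disjnt_iff)
qed

lemma totally_disconnected_separation:
  assumes "totally_disconnected_space Y" "x \<in> topspace Y" "y \<noteq> x"
  obtains K where "clopenin Y K" "x \<in> K" "y \<notin> K"
proof -
  have "y \<notin> \<Inter>{C. clopenin Y C \<and> x \<in> C}"
    using assms unfolding totally_disconnected_space_def by simp
  then show thesis using that by blast
qed

lemma completely_Hausdorff_totally_disconnected:
  assumes "totally_disconnected_space Y" shows "completely_Hausdorff_space Y"
  unfolding completely_Hausdorff_space_def
proof (intro ballI impI)
  fix x y assume "x \<in> topspace Y" "y \<in> topspace Y" "x \<noteq> y"
  then obtain K where K: "clopenin Y K" "x \<in> K" "y \<notin> K"
    using totally_disconnected_separation[OF assms, of x y] by metis
  then show "\<exists>g. bounded_cont_fun Y g \<and> g x \<noteq> g y"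
    by (intro exI[of _ "indicat_real K"]) (simp add: clopen_bounded_cont_fun)
qed

text \<open>The closed set and the complement of the interior of its neighbourhood are lifted to
  disjoint closed saturated sets of \<open>X\<close>, separated there by a saturated clopen set, and
  the result is projected. Total disconnectedness supplies the separation of single points that
  starts the construction.\<close>

lemma strongly_zero_dim_quotient:
  assumes E: "equiv (topspace X) E" and td: "totally_disconnected_space (quotient_space X E)"
    and P: "exhaustible_partition X \<P>" "E \<subseteq> (\<Union>P\<in>\<P>. P \<times> P)"
  shows "strongly_zero_dim_space (quotient_space X E)"
  unfolding strongly_zero_dim_space_def
proof (intro allI impI, elim conjE)
  let ?Y = "quotient_space X E" and ?q = "\<lambda>x. E `` {x}"
  fix C N assume C: "closedin ?Y C" and N: "N \<subseteq> topspace ?Y" and CN: "C \<subseteq> ?Y interior_of N"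
  have sep: "\<exists>W\<in>sat_clopen X E. x \<in> W \<and> y \<notin> W"
    if xy: "x \<in> topspace X" "y \<in> topspace X" "(x, y) \<notin> E" for x y
  proof -
    have "?q x \<in> topspace ?Y" using xy(1) by (simp add: topspace_quotient_space quotientI)
    moreover have "?q y \<noteq> ?q x" using xy(3) eq_equiv_class[OF _ E xy(2), of x] by metis
    ultimately obtain K where K: "clopenin ?Y K" "?q x \<in> K" "?q y \<notin> K"
      by (rule totally_disconnected_separation[OF td])
    have "a \<in> {x \<in> topspace X. ?q x \<in> K} \<longleftrightarrow> b \<in> {x \<in> topspace X. ?q x \<in> K}" if "(a, b) \<in> E" for a b
    proof -
      have "a \<in> topspace X" "b \<in> topspace X" using E that by (auto simp: equiv_def)
      then show ?thesis using equiv_class_eq[OF E that] by simp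
    qed
    then have sat: "\<forall>(a, b)\<in>E. a \<in> {x \<in> topspace X. ?q x \<in> K} \<longleftrightarrow> b \<in> {x \<in> topspace X. ?q x \<in> K}"
      by blast
    have "{x \<in> topspace X. ?q x \<in> K} \<in> sat_clopen X E"
      unfolding sat_clopen_def by (intro CollectI conjI clopenin_quotient[OF K(1)] sat)
    then show ?thesis using K(2,3) xy(1) by (intro bexI) auto
  qed
  define F H where "F = {x \<in> topspace X. ?q x \<in> C}"
    and "H = {x \<in> topspace X. ?q x \<in> topspace ?Y - ?Y interior_of N}"
  have closed: "closedin X F" unfolding F_def
    by (rule closedin_continuous_map_preimage[OF continuous_map_quotient_space C])
  have closed': "closedin X H" unfolding H_def
    by (rule closedin_continuous_map_preimage[OF continuous_map_quotient_space
          closedin_diff[OF closedin_topspace openin_interior_of]])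
  have sat: "E `` F \<subseteq> F" "E `` H \<subseteq> H"
    unfolding F_def H_def by (rule saturated_preimage[OF E])+
  have disj: "F \<inter> H = {}" using CN by (auto simp: F_def H_def)
  obtain W where W: "W \<in> sat_clopen X E" "F \<subseteq> W" "H \<inter> W = {}"
  proof (rule sat_clopen_exhaustible[OF E _ P closed sat(1) closed' sat(2) disj])
    fix x y assume "x \<in> topspace X" "y \<in> topspace X" "(x, y) \<notin> E"
    then show "\<exists>W\<in>sat_clopen X E. x \<in> W \<and> y \<notin> W" by (rule sep)
  qed (rule that)
  have W': "openin X W" "openin X (topspace X - W)" "E `` W \<subseteq> W" "E `` (topspace X - W) \<subseteq> topspace X - W"
    using W(1) E unfolding sat_clopen_def clopenin_def by (auto simp: equiv_def)
  have WS: "W \<subseteq> topspace X" using W'(1) by (rule openin_subset)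
  have "topspace ?Y - ?q ` W = ?q ` (topspace X - W)"
    using quotient_preimage[OF E WS W'(3)] by (auto simp: topspace_quotient_space quotient_def)
  then have "clopenin ?Y (?q ` W)"
    using openin_quotient_image[OF E W'(1,3)] openin_quotient_image[OF E W'(2,4)]
      openin_subset[OF openin_quotient_image[OF E W'(1,3)]]
    unfolding clopenin_def closedin_def by simp
  moreover have "C \<subseteq> ?q ` W"
  proof
    fix Q assume Q: "Q \<in> C"
    then obtain x where x: "x \<in> topspace X" "Q = ?q x"
      using closedin_subset[OF C] by (auto simp: topspace_quotient_space quotient_def)
    then have "x \<in> F" using Q by (simp add: F_def)
    then show "Q \<in> ?q ` W" using W(2) x by blast
  qed
  moreover have "?q ` W \<subseteq> N"
  proof clarify
    fix x assume x: "x \<in> W"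
    then have "?q x \<in> topspace ?Y" using WS by (auto simp: topspace_quotient_space intro: quotientI)
    moreover have "x \<notin> H" using x W(3) by blast
    ultimately have "?q x \<in> ?Y interior_of N" using x WS by (auto simp: H_def)
    then show "?q x \<in> N" using interior_of_subset[of ?Y N] by blast
  qed
  ultimately show "\<exists>K. clopenin ?Y K \<and> C \<subseteq> K \<and> K \<subseteq> N" by blast
qed

lemma strongly_zero_dim_clopen_base:
  assumes "strongly_zero_dim_space Y" "Hausdorff_space Y" "openin Y W" "x \<in> W"
  obtains K where "clopenin Y K" "x \<in> K" "K \<subseteq> W"
proof -
  have "closedin Y {x}" "W \<subseteq> topspace Y" "{x} \<subseteq> Y interior_of W"
    using assms openin_subset[OF assms(3)] by (auto simp: closedin_Hausdorff_singleton interior_of_openin)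
  then show thesis using assms(1) that unfolding strongly_zero_dim_space_def by (metis insert_subset)
qed

lemma tau0_strongly_zero_dim:
  assumes "strongly_zero_dim_space Y" "Hausdorff_space Y" shows "tau0 Y = Y"
  unfolding topology_eq
proof (intro allI iffI)
  fix W assume "openin Y W"
  then have "\<exists>K. openin (tau0 Y) K \<and> x \<in> K \<and> K \<subseteq> W" if "x \<in> W" for x
    using strongly_zero_dim_clopen_base[OF assms _ that] openin_tau0_clopen by metis
  then show "openin (tau0 Y) W" by (subst openin_subopen) blast
qed (rule openin_tau0_imp_openin)

lemma completely_regular_strongly_zero_dim:
  assumes "strongly_zero_dim_space Y" "Hausdorff_space Y" shows "completely_regular_space Y"
  unfolding completely_regular_space_alt'
proof clarify
  fix W x assume "openin Y W" "x \<in> W"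
  then obtain K where K: "clopenin Y K" "x \<in> K" "K \<subseteq> W"
    using strongly_zero_dim_clopen_base[OF assms] by metis
  have "continuous_map Y euclideanreal (indicat_real K)"
    using clopen_bounded_cont_fun[OF K(1)] by (simp add: bounded_cont_fun_def)
  then have "continuous_map Y euclideanreal (\<lambda>y. 1 - indicat_real K y)"
    by (intro continuous_intros) auto
  then show "\<exists>h. continuous_map Y euclideanreal h \<and> h x = 0 \<and> h ` (topspace Y - W) \<subseteq> {1}"
    using K by (intro exI[of _ "\<lambda>y. 1 - indicat_real K y"]) (auto simp: indicator_def)
qed

theorem theorem7p11:
  fixes X :: "'a topology" and f A C :: "('a \<times> 'a) set" and U :: "('a \<times> 'a) filter"
  assumes "topspace X \<noteq> {}"
    and "completely_regular_space X" and "Hausdorff_space X"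
    and "f \<subseteq> topspace X \<times> topspace X"
    and "U = max_uniformity X"
    and "A = A_rel (topspace X) U f"
    and "C = C_rel (topspace X) U f"
  shows
   "(equiv (topspace X) (G_rel X f) \<longrightarrow>
       smallest_rel (\<lambda>E. equiv (topspace X) E \<and> closed_rel X E \<and> f \<subseteq> E) (G_rel X f)) \<and>

    (equiv (topspace X) A \<longrightarrow>
       smallest_rel (\<lambda>E. equiv (topspace X) E \<and> closed_rel X E \<and> f \<subseteq> E \<and>
           completely_Hausdorff_space (quotient_space X E)) A \<and>
       (G_rel X f = A \<longleftrightarrow>
          equiv (topspace X) (G_rel X f) \<and>
          completely_Hausdorff_space (quotient_space X (G_rel X f))) \<and>
       (\<forall>d\<in>gage (topspace X) U. \<forall>x\<in>topspace X. \<forall>y\<in>topspace X. ell f d x y = s_ell f d x y) \<and>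
       projects_to_gage X A (ell f ` gage (topspace X) U)
         (gage (topspace X // A)
           (max_uniformity (tau (quotient_space X A)))) \<and>
       (locally_compact_space X \<and> paracompact_space X \<and>
        (sigma_compact_space X \<or> proper_rel X f) \<longrightarrow>
          Id_on (topspace X) \<union> G_rel X f = A \<and>
          Hausdorff_space (quotient_space X A) \<and>
          normal_space (quotient_space X A) \<and>
          quotient_space X A =
            tau (quotient_space X A))) \<and>

    (equiv (topspace X) C \<longrightarrow>
       smallest_rel (\<lambda>E. equiv (topspace X) E \<and> closed_rel X E \<and> f \<subseteq> E \<and>
           totally_disconnected_space (quotient_space X E)) C \<and>
       (\<forall>d\<in>gage (topspace X) U. \<forall>x\<in>topspace X. \<forall>y\<in>topspace X. m_bar f d x y = s_m_bar f d x y) \<and>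
       projects_to_gage X C (m_bar f ` gage (topspace X) U)
         (zero_dim_gage (tau0 (quotient_space X C))) \<and>
       (locally_compact_space X \<and> paracompact_space X \<and>
        (sigma_compact_space X \<or> proper_rel X f) \<longrightarrow>
          Hausdorff_space (quotient_space X C) \<and>
          strongly_zero_dim_space (quotient_space X C) \<and>
          quotient_space X C =
            tau (quotient_space X C) \<and>
          quotient_space X C =
            tau0 (quotient_space X C)))"
proof (intro conjI impI)
  assume "equiv (topspace X) (G_rel X f)"
  then show "smallest_rel (\<lambda>E. equiv (topspace X) E \<and> closed_rel X E \<and> f \<subseteq> E) (G_rel X f)"
    unfolding smallest_rel_def
    using closed_rel_G_rel[OF assms(4)] subset_G_rel[of f X] G_rel_least[of X _ f]
    by (auto simp: equiv_def)
next
  note X = assms(2) and G = gage_max_uniformity[OF assms(2), folded assms(5)]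
  assume eq: "equiv (topspace X) A"
  note ell = ell_of_equiv_A_rel[OF assms(1,2,4) assms(6)[unfolded assms(5)] eq]
  have clA: "closed_rel X A" by (rule closed_rel_zero_set[where b = "ell f", OF ell(4,3)])
  have cH: "completely_Hausdorff_space (quotient_space X A)"
    by (rule completely_Hausdorff_quotient[where b = "ell f", OF eq ell(4,3)])
  have least: "A \<subseteq> E" if "equiv (topspace X) E" "f \<subseteq> E" "completely_Hausdorff_space (quotient_space X E)" for E
    unfolding assms(5,6) by (rule A_rel_least[OF X that])
  have GA: "G_rel X f \<subseteq> A"
    using eq by (intro G_rel_least clA ell(2)) (simp add: equiv_def)
  show "smallest_rel (\<lambda>E. equiv (topspace X) E \<and> closed_rel X E \<and> f \<subseteq> E \<and>
           completely_Hausdorff_space (quotient_space X E)) A"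
    unfolding smallest_rel_def using eq clA ell(2) cH least by blast
  show "G_rel X f = A \<longleftrightarrow> equiv (topspace X) (G_rel X f) \<and>
          completely_Hausdorff_space (quotient_space X (G_rel X f))"
  proof
    assume "equiv (topspace X) (G_rel X f) \<and> completely_Hausdorff_space (quotient_space X (G_rel X f))"
    then show "G_rel X f = A" using GA least[OF _ subset_G_rel] by (intro equalityI) auto
  qed (use eq cH in simp)
  show "\<forall>d\<in>gage (topspace X) U. \<forall>x\<in>topspace X. \<forall>y\<in>topspace X. ell f d x y = s_ell f d x y"
    unfolding G s_ell_def using pseudo_metric_onD(3)[OF cont_pmetricsD(1)[OF ell(4)]] by simp
  have zero: "ell f d x y = 0" if "d \<in> cont_pmetrics X" "(x, y) \<in> A" for d x y
    using that ell(3) by blast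
  \<comment> \<open>Passing to \<open>tau\<close> keeps the carrier and the bounded continuous
    pseudo-metrics and yields complete regularity, so the gage can be computed on the quotient
    itself.\<close>
  have "gage (topspace X // A) (max_uniformity (tau (quotient_space X A))) = cont_pmetrics (quotient_space X A)"
    using gage_max_uniformity[OF completely_regular_space_tau[of "quotient_space X A"]]
    by (simp add: topspace_tau topspace_quotient_space cont_pmetrics_tau)
  moreover have "projects_to_gage X A (ell f ` cont_pmetrics X) (cont_pmetrics (quotient_space X A))"
  proof (rule projects_to_gageI[OF eq])
    fix d assume "d \<in> ell f ` cont_pmetrics X"
    then show d: "d \<in> cont_pmetrics X \<and> (\<forall>(x, y)\<in>A. d x y = 0)" using ell(4) zero by blast
    then show "quotient_dist d \<in> cont_pmetrics (quotient_space X A)"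
      by (intro quotient_dist_cont_pmetrics[OF eq]) auto
  next
    fix e assume e: "e \<in> cont_pmetrics (quotient_space X A)"
    \<comment> \<open>The pull-back of \<open>e\<close> vanishes on \<open>f\<close>, hence is its
      own barrier function and so a preimage of \<open>e\<close>.\<close>
    define d where "d x y = e (A `` {x}) (A `` {y})" for x y
    have d: "d \<in> cont_pmetrics X"
      using e unfolding cont_pmetrics_quotient_iff d_def .
    interpret pseudo_metric_rel "topspace X" d f
      using cont_pmetricsD(1)[OF d] assms(4) ell(1) by unfold_locales
    have "d a b = 0" if "(a, b) \<in> f" for a b
    proof -
      have "(a, b) \<in> A" using that ell(2) by blast
      then have "d a b = d a a" using equiv_class_eq[OF eq] by (simp add: d_def)
      then show ?thesis using refl_0 that assms(4) by auto
    qed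
    moreover have "ell f d x x = 0" if "x \<in> topspace X" for x
      using pseudo_metric_onD(2)[OF cont_pmetricsD(1)[OF ell(4)[OF d]]] that by blast
    ultimately have "\<forall>x\<in>topspace X. \<forall>y\<in>topspace X. ell f d x y = d x y" using ell_eq by blast
    then show "\<exists>d\<in>ell f ` cont_pmetrics X. \<forall>x\<in>topspace X. \<forall>y\<in>topspace X. d x y = e (A `` {x}) (A `` {y})"
      using d unfolding d_def by blast
  qed
  ultimately show "projects_to_gage X A (ell f ` gage (topspace X) U)
      (gage (topspace X // A) (max_uniformity (tau (quotient_space X A))))"
    unfolding G by simp
  assume "locally_compact_space X \<and> paracompact_space X \<and> (sigma_compact_space X \<or> proper_rel X f)"
  then obtain \<P> where P: "exhaustible_partition X \<P>" "f \<subseteq> (\<Union>P\<in>\<P>. P \<times> P)"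
    using exhaustible_partition_exists[OF _ _ assms(3,4)] by metis
  have AP: "A \<subseteq> (\<Union>P\<in>\<P>. P \<times> P)"
    using A_rel_subset_C_rel[OF assms(4), of U] C_rel_subset_partition[OF X P]
    unfolding assms(5,6) by (rule subset_trans)
  have "G_rel X f \<subseteq> (\<Union>P\<in>\<P>. P \<times> P)" using GA AP by blast
  from A_rel_subset_G_rel[OF assms(2-4) P(1) this]
  have "A \<subseteq> Id_on (topspace X) \<union> G_rel X f" unfolding assms(5,6) .
  then show "Id_on (topspace X) \<union> G_rel X f = A"
    using GA eq by (auto simp: equiv_def refl_on_def)
  show H: "Hausdorff_space (quotient_space X A)"
    by (rule Hausdorff_space_completely_Hausdorff[OF cH])
  \<comment> \<open>Order normality is now applied to the equivalence relation \<open>A\<close>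
    itself, in contrast to the directed preorder used for \<open>G_rel\<close>.\<close>
  have "order_normal X A"
    using eq by (intro order_normal_exhaustible[OF completely_regular_imp_regular_space[OF X] clA _ _ P(1) AP])
      (auto simp: equiv_def)
  then show N: "normal_space (quotient_space X A)" by (rule normal_space_quotient[OF eq])
  show "quotient_space X A = tau (quotient_space X A)"
    using tau_completely_regular[OF normal_imp_completely_regular_space[OF N]] H by simp
next
  note X = assms(2) and G = gage_max_uniformity[OF assms(2), folded assms(5)]
  assume eq: "equiv (topspace X) C"
  note m_bar = m_bar_of_equiv_C_rel[OF assms(1,2,4) assms(7)[unfolded assms(5)] eq]
  have clC: "closed_rel X C" by (rule closed_rel_zero_set[where b = "m_bar f", OF m_bar(4,3)])
  have td: "totally_disconnected_space (quotient_space X C)"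
    by (rule totally_disconnected_quotient[where b = "m_bar f", OF eq m_bar(4,5,3)])
  have least: "C \<subseteq> E" if "equiv (topspace X) E" "f \<subseteq> E" "totally_disconnected_space (quotient_space X E)" for E
    unfolding assms(5,7) by (rule C_rel_least[OF X that])
  show "smallest_rel (\<lambda>E. equiv (topspace X) E \<and> closed_rel X E \<and> f \<subseteq> E \<and>
           totally_disconnected_space (quotient_space X E)) C"
    unfolding smallest_rel_def using eq clC m_bar(2) td least by blast
  show "\<forall>d\<in>gage (topspace X) U. \<forall>x\<in>topspace X. \<forall>y\<in>topspace X. m_bar f d x y = s_m_bar f d x y"
    unfolding G s_m_bar_def using pseudo_metric_onD(3)[OF cont_pmetricsD(1)[OF m_bar(4)]] by simp
  have zero: "m_bar f d x y = 0" if "d \<in> cont_pmetrics X" "(x, y) \<in> C" for d x y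
    using that m_bar(3) by blast
  show "projects_to_gage X C (m_bar f ` gage (topspace X) U) (zero_dim_gage (tau0 (quotient_space X C)))"
    unfolding G zero_dim_gage_tau0
  proof (rule projects_to_gageI[OF eq])
    fix d assume d: "d \<in> m_bar f ` cont_pmetrics X"
    then show d': "d \<in> cont_pmetrics X \<and> (\<forall>(x, y)\<in>C. d x y = 0)" using m_bar(4) zero by blast
    have "pseudo_ultrametric_on (topspace X) d" using d m_bar(5) by blast
    with d' show "quotient_dist d \<in> {e \<in> cont_pmetrics (quotient_space X C).
        pseudo_ultrametric_on (topspace (quotient_space X C)) e}"
      unfolding topspace_quotient_space
      by (intro CollectI conjI quotient_dist_cont_pmetrics[OF eq] quotient_dist_ultrametric[OF eq]) auto
  next
    fix e assume "e \<in> {e \<in> cont_pmetrics (quotient_space X C).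
        pseudo_ultrametric_on (topspace (quotient_space X C)) e}"
    then have e: "e \<in> cont_pmetrics (quotient_space X C)" "pseudo_ultrametric_on (topspace X // C) e"
      by (auto simp: topspace_quotient_space)
    show "e \<in> cont_pmetrics (quotient_space X C)" by (rule e(1))
    \<comment> \<open>As for \<open>A\<close>, but being fixed by \<open>m_bar\<close> also requires
      the pull-back to be an ultrametric, which it inherits from \<open>e\<close>.\<close>
    define d where "d x y = e (C `` {x}) (C `` {y})" for x y
    have d: "d \<in> cont_pmetrics X"
      using e(1) unfolding cont_pmetrics_quotient_iff d_def .
    have u: "pseudo_ultrametric_on (topspace X) d"
      using e(2) cont_pmetricsD(1)[OF d] unfolding pseudo_ultrametric_on_def ball_quotient_iff d_def by blast
    interpret pseudo_metric_rel "topspace X" d f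
      using cont_pmetricsD(1)[OF d] assms(4) m_bar(1) by unfold_locales
    have "d a b = 0" if "(a, b) \<in> f" for a b
    proof -
      have "(a, b) \<in> C" using that m_bar(2) by blast
      then have "d a b = d a a" using equiv_class_eq[OF eq] by (simp add: d_def)
      then show ?thesis using refl_0 that assms(4) by auto
    qed
    moreover have "m_bar f d x x = 0" if "x \<in> topspace X" for x
      using pseudo_metric_onD(2)[OF cont_pmetricsD(1)[OF m_bar(4)[OF d]]] that by blast
    ultimately have "\<forall>x\<in>topspace X. \<forall>y\<in>topspace X. m_bar f d x y = d x y" using m_bar_eq u by blast
    then show "\<exists>d\<in>m_bar f ` cont_pmetrics X. \<forall>x\<in>topspace X. \<forall>y\<in>topspace X. d x y = e (C `` {x}) (C `` {y})"
      using d unfolding d_def by blast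
  qed
  assume "locally_compact_space X \<and> paracompact_space X \<and> (sigma_compact_space X \<or> proper_rel X f)"
  then obtain \<P> where P: "exhaustible_partition X \<P>" "f \<subseteq> (\<Union>P\<in>\<P>. P \<times> P)"
    using exhaustible_partition_exists[OF _ _ assms(3,4)] by metis
  have CP: "C \<subseteq> (\<Union>P\<in>\<P>. P \<times> P)"
    using C_rel_subset_partition[OF X P] unfolding assms(5,7) .
  show H: "Hausdorff_space (quotient_space X C)"
    by (rule Hausdorff_space_completely_Hausdorff[OF completely_Hausdorff_totally_disconnected[OF td]])
  show Z: "strongly_zero_dim_space (quotient_space X C)"
    by (rule strongly_zero_dim_quotient[OF eq td P(1) CP])
  show "quotient_space X C = tau (quotient_space X C)"
    using tau_completely_regular[OF completely_regular_strongly_zero_dim[OF Z H]] ..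
  show "quotient_space X C = tau0 (quotient_space X C)"
    using tau0_strongly_zero_dim[OF Z H] ..
qed

end
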